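(* Let $C(S^1)^{(n)}\subset M_n(\mathbb C)$ be the operator system of $n\times n$ complex Toeplitz matrices. There is an isomorphism of $C^*$-algebras $$C^*_{\mathrm{env}}(C(S^1)^{(n)})\cong M_n(\mathbb C).$$ Moreover, independently of $n$, one has $\mathrm{prop}(C(S^1)^{(n)})=2$.
   Context: $n$ is a positive integer. $C(S^1)^{(n)}$ is the space of matrices $T=(t_{k-l})_{k,l}$, with $t_j\in\mathbb C$ for $|j|\le n-1$; it is a unital operator system in $M_n(\mathbb C)$. For a unital operator system $E$, a $C^*$-extension is a unital completely isometric (equivalently complete order injective) map $\kappa:E\to A$ into a unital $C^*$-algebra with $A=C^*(\kappa(E))$. The $C^*$-envelope $\imath_E:E\to C^*_{\mathrm{env}}(E)$ is the $C^*$-extension with the universal property that for every $C^*$-extension $\lambda:E\to B$ there is a unique surjective $*$-homomorphism $\rho:B\to C^*_{\mathrm{env}}(E)$ with $\rho\circ\lambda=\imath_E$. For $E$ inside a $C^*$-algebra and an integer $k>0$, $E^{\circ k}$ is the norm closure of the linear span of products of at most $k$ elements of $E$; the propagation number $\mathrm{prop}(E)$ is the smallest integer $k>0$ such that $\imath_E(E)^{\circ k}\subseteq C^*_{\mathrm{env}}(E)$ is a $C^*$-algebra ($\infty$ if none exists).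
   Formalization: The claim that the propagation number equals 2 is stated for n ≥ 2 only, since for n = 1 the system is the complex numbers, already a C*-algebra, and its propagation number is 1. *)

theory Defs
  imports
    "HOL-Analysis.Abstract_Metric_Spaces"
    "HOL-Library.Extended_Nat"
    "Jordan_Normal_Form.Schur_Decomposition"
    "Jordan_Normal_Form.VS_Connect"
begin

hide_const (open) Multiset.mult Polynomial.smult

section \<open>Unital C*-algebras with explicit carriers\<close>

record 'a cstar = "(complex, 'a) module" +
  adj :: "'a \<Rightarrow> 'a"
  nrm :: "'a \<Rightarrow> real"

text \<open>The distance is set to 0 outside the carrier, because \<^locale>\<open>Metric_space\<close> asks for
  nonnegativity and symmetry on the whole type.\<close>

definition cstar_dist :: "('a, 'm) cstar_scheme \<Rightarrow> 'a \<Rightarrow> 'a \<Rightarrow> real" where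
  "cstar_dist A x y =
     (if x \<in> carrier A \<and> y \<in> carrier A then nrm A (x \<ominus>\<^bsub>A\<^esub> y) else 0)"

locale cstar_algebra =
  ring A + Module.module "class_ring :: complex ring" A
  for A :: "('a, 'm) cstar_scheme" (structure) +
  assumes smult_mult_left:
      "\<lbrakk>x \<in> carrier A; y \<in> carrier A\<rbrakk> \<Longrightarrow> (c \<odot> x) \<otimes> y = c \<odot> (x \<otimes> y)"
    and smult_mult_right:
      "\<lbrakk>x \<in> carrier A; y \<in> carrier A\<rbrakk> \<Longrightarrow> x \<otimes> (c \<odot> y) = c \<odot> (x \<otimes> y)"
    and adj_closed: "x \<in> carrier A \<Longrightarrow> adj A x \<in> carrier A"
    and adj_adj: "x \<in> carrier A \<Longrightarrow> adj A (adj A x) = x"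
    and adj_add:
      "\<lbrakk>x \<in> carrier A; y \<in> carrier A\<rbrakk> \<Longrightarrow> adj A (x \<oplus> y) = adj A x \<oplus> adj A y"
    and adj_smult: "x \<in> carrier A \<Longrightarrow> adj A (c \<odot> x) = cnj c \<odot> adj A x"
    and adj_mult:
      "\<lbrakk>x \<in> carrier A; y \<in> carrier A\<rbrakk> \<Longrightarrow> adj A (x \<otimes> y) = adj A y \<otimes> adj A x"
    and nrm_nonneg: "x \<in> carrier A \<Longrightarrow> 0 \<le> nrm A x"
    and nrm_eq_0: "x \<in> carrier A \<Longrightarrow> nrm A x = 0 \<longleftrightarrow> x = \<zero>"
    and nrm_smult: "x \<in> carrier A \<Longrightarrow> nrm A (c \<odot> x) = cmod c * nrm A x"
    and nrm_triangle:
      "\<lbrakk>x \<in> carrier A; y \<in> carrier A\<rbrakk> \<Longrightarrow> nrm A (x \<oplus> y) \<le> nrm A x + nrm A y"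
    and nrm_mult:
      "\<lbrakk>x \<in> carrier A; y \<in> carrier A\<rbrakk> \<Longrightarrow> nrm A (x \<otimes> y) \<le> nrm A x * nrm A y"
    and nrm_cstar: "x \<in> carrier A \<Longrightarrow> nrm A (adj A x \<otimes> x) = (nrm A x)\<^sup>2"
    and complete: "Metric_space.mcomplete (carrier A) (cstar_dist A)"

definition norm_closure :: "('a, 'm) cstar_scheme \<Rightarrow> 'a set \<Rightarrow> 'a set" where
  "norm_closure A S =
     Abstract_Topology.closure_of (Metric_space.mtopology (carrier A) (cstar_dist A)) S"

definition cstar_subalgebra :: "('a, 'm) cstar_scheme \<Rightarrow> 'a set \<Rightarrow> bool" where
  "cstar_subalgebra A S \<longleftrightarrow> S \<subseteq> carrier A \<and> cstar_algebra (A\<lparr>carrier := S\<rparr>)"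

definition cstar_generated :: "('a, 'm) cstar_scheme \<Rightarrow> 'a set \<Rightarrow> 'a set" where
  "cstar_generated A S = cstar_subalgebra A hull S"

definition star_hom :: "('a, 'm) cstar_scheme \<Rightarrow> ('b, 'k) cstar_scheme \<Rightarrow> ('a \<Rightarrow> 'b) set" where
  "star_hom A B = {\<rho> \<in> Ring.ring_hom A B.
     \<forall>x\<in>carrier A. \<rho> (adj A x) = adj B (\<rho> x) \<and> (\<forall>c. \<rho> (c \<odot>\<^bsub>A\<^esub> x) = c \<odot>\<^bsub>B\<^esub> \<rho> x)}"

definition cstar_isomorphic :: "('a, 'm) cstar_scheme \<Rightarrow> ('b, 'k) cstar_scheme \<Rightarrow> bool" where
  "cstar_isomorphic A B \<longleftrightarrow> (\<exists>\<rho>\<in>star_hom A B. bij_betw \<rho> (carrier A) (carrier B))"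


section \<open>Unital operator systems and their C*-extensions\<close>

definition operator_system :: "('a, 'm) cstar_scheme \<Rightarrow> 'a set \<Rightarrow> bool" where
  "operator_system A E \<longleftrightarrow>
     cstar_algebra A \<and> Module.submodule E (class_ring :: complex ring) A \<and>
     \<one>\<^bsub>A\<^esub> \<in> E \<and> (\<forall>x\<in>E. adj A x \<in> E)"

definition matrices_over :: "nat \<Rightarrow> 'a set \<Rightarrow> 'a mat set" where
  "matrices_over p S = {X \<in> carrier_mat p p. elements_mat X \<subseteq> S}"

text \<open>Positive elements of \<open>M\<^sub>p(A)\<close>: those of the form \<open>Y\<^sup>*Y\<close> with \<open>Y \<in> M\<^sub>p(A)\<close>, where
  \<open>(Y\<^sup>*)\<^sub>i\<^sub>k = (Y\<^sub>k\<^sub>i)\<^sup>*\<close>.\<close>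

definition mat_positive :: "('a, 'm) cstar_scheme \<Rightarrow> nat \<Rightarrow> 'a mat \<Rightarrow> bool" where
  "mat_positive A p X \<longleftrightarrow> (\<exists>Y\<in>matrices_over p (carrier A).
     X = mat p p (\<lambda>(i, j). \<Oplus>\<^bsub>A\<^esub>k\<in>{..<p}. adj A (Y $$ (k, i)) \<otimes>\<^bsub>A\<^esub> Y $$ (k, j)))"

definition unital_complete_order_injection ::
  "('a, 'm) cstar_scheme \<Rightarrow> 'a set \<Rightarrow> ('b, 'k) cstar_scheme \<Rightarrow> ('a \<Rightarrow> 'b) \<Rightarrow> bool" where
  "unital_complete_order_injection A E B \<kappa> \<longleftrightarrow>
     \<kappa> \<in> E \<rightarrow> carrier B \<and> inj_on \<kappa> E \<and>
     (\<forall>x\<in>E. \<forall>y\<in>E. \<kappa> (x \<oplus>\<^bsub>A\<^esub> y) = \<kappa> x \<oplus>\<^bsub>B\<^esub> \<kappa> y) \<and>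
     (\<forall>c. \<forall>x\<in>E. \<kappa> (c \<odot>\<^bsub>A\<^esub> x) = c \<odot>\<^bsub>B\<^esub> \<kappa> x) \<and>
     \<kappa> \<one>\<^bsub>A\<^esub> = \<one>\<^bsub>B\<^esub> \<and>
     (\<forall>p. \<forall>X\<in>matrices_over p E. mat_positive A p X \<longleftrightarrow> mat_positive B p (map_mat \<kappa> X))"

definition cstar_extension ::
  "('a, 'm) cstar_scheme \<Rightarrow> 'a set \<Rightarrow> ('b, 'k) cstar_scheme \<Rightarrow> ('a \<Rightarrow> 'b) \<Rightarrow> bool" where
  "cstar_extension A E B \<kappa> \<longleftrightarrow>
     cstar_algebra B \<and> unital_complete_order_injection A E B \<kappa> \<and>
     carrier B = cstar_generated B (\<kappa> ` E)"

text \<open>HOL formulas cannot quantify over types, so the type \<open>'b\<close> over which the competing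
  C*-extensions range is a parameter; the universal property is the one for all C*-algebras
  when \<open>'b\<close> is left as a type variable in a theorem. Uniqueness of \<open>\<rho>\<close> is as a function on
  the carrier, hence the restriction to \<^const>\<open>extensional\<close> functions.\<close>

definition cstar_envelope ::
  "'b itself \<Rightarrow> ('a, 'm) cstar_scheme \<Rightarrow> 'a set \<Rightarrow> ('c, 'k) cstar_scheme \<Rightarrow> ('a \<Rightarrow> 'c) \<Rightarrow> bool" where
  "cstar_envelope (_ :: 'b itself) A E C \<iota> \<longleftrightarrow>
     operator_system A E \<and> cstar_extension A E C \<iota> \<and>
     (\<forall>(B :: 'b cstar) \<kappa>. cstar_extension A E B \<kappa> \<longrightarrow>
        (\<exists>!\<rho>. \<rho> \<in> extensional (carrier B) \<and> \<rho> \<in> star_hom B C \<and>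
              \<rho> ` carrier B = carrier C \<and> (\<forall>x\<in>E. \<rho> (\<kappa> x) = \<iota> x)))"


section \<open>Propagation number\<close>

definition system_power :: "('a, 'm) cstar_scheme \<Rightarrow> 'a set \<Rightarrow> nat \<Rightarrow> 'a set" where
  "system_power A F k = norm_closure A (LinearCombinations.module.span (class_ring :: complex ring) A
     {foldr (\<otimes>\<^bsub>A\<^esub>) xs \<one>\<^bsub>A\<^esub> | xs. set xs \<subseteq> F \<and> xs \<noteq> [] \<and> length xs \<le> k})"

text \<open>To be applied to the image \<open>F = \<iota>\<^sub>E(E)\<close> of an operator system in its C*-envelope \<open>C\<close>.
  The infimum of the empty set in \<^typ>\<open>enat\<close> is \<open>\<infinity>\<close>.\<close>

definition propagation_number :: "('c, 'k) cstar_scheme \<Rightarrow> 'c set \<Rightarrow> enat" where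
  "propagation_number C F = Inf {enat k | k. 0 < k \<and> cstar_subalgebra C (system_power C F k)}"


section \<open>Toeplitz matrices in the full matrix algebra\<close>

definition operator_norm :: "complex mat \<Rightarrow> real" where
  "operator_norm T = (SUP v\<in>{v \<in> carrier_vec (dim_col T). Re (v \<bullet>c v) \<le> 1}.
     sqrt (Re ((T *\<^sub>v v) \<bullet>c (T *\<^sub>v v))))"

definition mat_cstar :: "nat \<Rightarrow> complex mat cstar" where
  "mat_cstar n = \<lparr>carrier = carrier_mat n n, mult = (*), one = 1\<^sub>m n,
     zero = 0\<^sub>m n n, add = (+), smult = (\<cdot>\<^sub>m), adj = mat_adjoint, nrm = operator_norm\<rparr>"

definition toeplitz :: "nat \<Rightarrow> complex mat set" where
  "toeplitz n = {mat n n (\<lambda>(k, l). t (int k - int l)) | t :: int \<Rightarrow> complex. True}"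

end

theory Submission
  imports Defs "HOL-Analysis.Urysohn" "HOL-Analysis.L2_Norm"
begin

text \<open>
  Write \<open>T\<^sub>j\<close> for the matrix with ones on the \<open>j\<close>-th diagonal. The matrices
  \<open>T\<^sub>j \<plusminus> T\<^bsub>j-n\<^esub>\<close> with \<open>0 \<le> j < n\<close> are unitary and span the Toeplitz matrices. If \<open>g\<close> is one
  of them and \<open>\<kappa>\<close> is a complete order injection into \<open>B\<close>, positivity of the \<open>2 \<times> 2\<close> matrix
  \<open>[[1, g], [g\<^sup>*, 1]]\<close> makes \<open>\<kappa>(g)\<close> a contraction.

  The homomorphism \<open>B \<rightarrow> M\<^sub>n\<close> is constructed without an extension theorem, by proving
  \<open>\<parallel>p(g)\<parallel> \<le> 2 \<parallel>p(\<kappa>(g))\<parallel>\<close> for every noncommutative polynomial \<open>p\<close>. Compute \<open>p(g) v\<close> step by step,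
  with one variable for every intermediate result. A step \<open>v\<^sub>t = g v\<^sub>s\<close> is penalised by the form
  \<open>\<bar>v\<^sub>t\<bar>\<^sup>2 + \<bar>v\<^sub>s\<bar>\<^sup>2 - 2 Re \<langle>v\<^sub>t, g v\<^sub>s\<rangle>\<close>, whose coefficients are Toeplitz matrices. In \<open>B\<close> it dominates
  \<open>\<bar>v\<^sub>t - \<kappa>(g) v\<^sub>s\<bar>\<^sup>2\<close>, so with suitable weights the total penalty \<open>Q\<close> dominates
  \<open>\<bar>v\<^sub>p - p(\<kappa>(g)) v\<^sub>1\<bar>\<^sup>2\<close>, where \<open>v\<^sub>1\<close> is the input and \<open>v\<^sub>p\<close> the output, and then
  \<open>2 s \<bar>v\<^sub>1\<bar>\<^sup>2 + 2 Q - \<bar>v\<^sub>p\<bar>\<^sup>2\<close> is a sum of squares for \<open>s > \<parallel>p(\<kappa>(g))\<parallel>\<^sup>2\<close>. By complete order injectivity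
  it is positive over \<open>M\<^sub>n\<close>, where \<open>Q\<close> vanishes along the actual computation.

  Both the surjectivity onto \<open>M\<^sub>n\<close> and the propagation number rest on
  \<open>e\<^bsub>km\<^esub> = T\<^sub>k T\<^bsub>-m\<^esub> - T\<^bsub>k+1\<^esub> T\<^bsub>-(m+1)\<^esub>\<close>.
\<close>

section \<open>C*-algebras\<close>

text \<open>The obstacle is that \<open>\<kappa>\<close> is controlled only on Toeplitz matrices,
  while products of Toeplitz matrices need not be Toeplitz and nothing is assumed about
  \<open>\<kappa>\<close> and products. One variable per intermediate result linearises a product:
  every coefficient of the penalty is then a Toeplitz matrix. The price is a form in many variables,
  so positivity is needed for matrices of unbounded size; this is where complete order injectivity
  enters. Isometries are used because over M_n the penalty of a step is |v_t - g v_s|^2 when g^* g =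
  1, hence zero on the actual computation, while in B a contraction is enough for the domination.
  The factor 2 goes back to |a + b|^2 <= 2 |a|^2 + 2 |b|^2. It does no harm: the estimate only has
  to show that p(\<kappa>(g)) determines p(g) and that this assignment extends to limits.
  Contractivity comes afterwards, from multiplicativity. Positivity is always witnessed by explicit
  sums of squares, and the only analytic input is a square root of 1 - a for ||a|| < 1.\<close>

context cstar_algebra
begin

lemma ring_A: "ring A"
  by unfold_locales

lemma module_A: "Module.module (class_ring :: complex ring) A"
  by unfold_locales

lemma abelian_group_A: "abelian_group A"
  by unfold_locales

lemmas ring_facts = ring.ring_simprules[OF ring_A]

lemma add_diff_cancel:
  assumes "x \<in> carrier A" "y \<in> carrier A"
  shows "x \<oplus> (y \<ominus> x) = y"
proof -
  have "y \<ominus> x = \<ominus> x \<oplus> y"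
    unfolding ring_facts(14) by (rule ring_facts(10)) (use assms ring_facts(3) in auto)
  then show ?thesis using assms ring_facts(17) by simp
qed

lemma diff_add_diff:
  "x \<in> carrier A \<Longrightarrow> y \<in> carrier A \<Longrightarrow> z \<in> carrier A \<Longrightarrow> (x \<ominus> y) \<oplus> (y \<ominus> z) = x \<ominus> z"
  by (simp add: ring_facts)

lemma scale_closed [simp]: "x \<in> carrier A \<Longrightarrow> c \<odot> x \<in> carrier A"
  by (rule smult_closed) simp_all

lemma smult_smult: "x \<in> carrier A \<Longrightarrow> c \<odot> (d \<odot> x) = (c * d) \<odot> x"
  using smult_assoc1[of c d x] by simp

lemma smult_add_left: "x \<in> carrier A \<Longrightarrow> (c + d) \<odot> x = c \<odot> x \<oplus> d \<odot> x"
  using smult_l_distr[of c d x] by simp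

lemma smult_add_right: "x \<in> carrier A \<Longrightarrow> y \<in> carrier A \<Longrightarrow> c \<odot> (x \<oplus> y) = c \<odot> x \<oplus> c \<odot> y"
  using smult_r_distr[of c x y] by simp

lemma one_smult [simp]: "x \<in> carrier A \<Longrightarrow> 1 \<odot> x = x"
  using smult_one by simp

lemma zero_smult [simp]: "x \<in> carrier A \<Longrightarrow> 0 \<odot> x = \<zero>"
  using smult_l_null by simp

lemma uminus_smult: "x \<in> carrier A \<Longrightarrow> (- c) \<odot> x = \<ominus> (c \<odot> x)"
  using smult_l_minus[of c x] by (simp add: class_ring_simps)

lemma smult_uminus: "x \<in> carrier A \<Longrightarrow> c \<odot> (\<ominus> x) = \<ominus> (c \<odot> x)"
  using smult_r_minus[of c x] by simp

declare adj_closed [simp] adj_adj [simp]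

lemma adj_zero [simp]: "adj A \<zero> = \<zero>"
  using adj_smult[of \<zero> 0] by simp

lemma adj_one [simp]: "adj A \<one> = \<one>"
  using adj_mult[of "\<one>" "adj A \<one>"] by simp

lemma adj_uminus: "x \<in> carrier A \<Longrightarrow> adj A (\<ominus> x) = \<ominus> adj A x"
  using adj_smult[of x "-1"] by (simp add: uminus_smult)

lemma nrm_uminus: "x \<in> carrier A \<Longrightarrow> nrm A (\<ominus> x) = nrm A x"
  using nrm_smult[of x "-1"] by (simp add: uminus_smult)

lemma nrm_zero [simp]: "nrm A \<zero> = 0"
  using nrm_eq_0 by simp

text \<open>The C*-identity and submultiplicativity give ||y||^2 <= ||y^*|| ||y||. One factor
  cancels, and exchanging y with its adjoint yields equality.\<close>

lemma nrm_adj: "x \<in> carrier A \<Longrightarrow> nrm A (adj A x) = nrm A x"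
proof -
  have le: "nrm A y \<le> nrm A (adj A y)" if y: "y \<in> carrier A" for y
  proof (cases "nrm A y = 0")
    case True
    then show ?thesis using y nrm_nonneg by simp
  next
    case False
    have "nrm A y * nrm A y \<le> nrm A (adj A y) * nrm A y"
      using nrm_cstar[OF y] nrm_mult[of "adj A y" y] y by (simp add: power2_eq_square)
    with False nrm_nonneg[OF y] show ?thesis by simp
  qed
  assume "x \<in> carrier A"
  then show ?thesis using le[of x] le[of "adj A x"] by simp
qed

lemma nrm_diff_commute:
  "x \<in> carrier A \<Longrightarrow> y \<in> carrier A \<Longrightarrow> nrm A (x \<ominus> y) = nrm A (y \<ominus> x)"
  using nrm_uminus[of "x \<ominus> y"] by (simp add: ring_facts)

lemma Metric_space_cstar: "Metric_space (carrier A) (cstar_dist A)"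
proof
  fix x y z
  show "0 \<le> cstar_dist A x y" by (simp add: cstar_dist_def nrm_nonneg)
  show "cstar_dist A x y = cstar_dist A y x"
    using nrm_diff_commute by (simp add: cstar_dist_def)
  assume x: "x \<in> carrier A" and y: "y \<in> carrier A"
  then show "cstar_dist A x y = 0 \<longleftrightarrow> x = y"
    by (simp add: cstar_dist_def nrm_eq_0)
  assume z: "z \<in> carrier A"
  have "x \<ominus> z = (x \<ominus> y) \<oplus> (y \<ominus> z)"
    using x y z by (simp add: ring_facts)
  then show "cstar_dist A x z \<le> cstar_dist A x y + cstar_dist A y z"
    using x y z nrm_triangle[of "x \<ominus> y" "y \<ominus> z"] by (simp add: cstar_dist_def)
qed

text \<open>Squaring is Lipschitz with constant 2 r on the ball of radius r, by x x - y y = x (x -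
  y) + (x - y) y. After halving the constant is r, as the fixed point argument for square roots
  requires.\<close>

lemma nrm_square_diff:
  assumes "x \<in> carrier A" "y \<in> carrier A" "nrm A x \<le> r" "nrm A y \<le> r"
  shows "nrm A (x \<otimes> x \<ominus> y \<otimes> y) \<le> 2 * r * nrm A (x \<ominus> y)"
proof -
  have d: "x \<ominus> y \<in> carrier A" using assms by (simp add: ring_facts)
  have "0 \<le> r" using assms nrm_nonneg[of x] by linarith
  have "x \<otimes> x \<ominus> y \<otimes> y = x \<otimes> (x \<ominus> y) \<oplus> (x \<ominus> y) \<otimes> y"
    using assms by (simp add: ring_facts)
  then have "nrm A (x \<otimes> x \<ominus> y \<otimes> y) \<le> nrm A (x \<otimes> (x \<ominus> y)) + nrm A ((x \<ominus> y) \<otimes> y)"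
    using nrm_triangle[of "x \<otimes> (x \<ominus> y)" "(x \<ominus> y) \<otimes> y"] d assms by (simp add: ring_facts(5))
  also have "\<dots> \<le> nrm A x * nrm A (x \<ominus> y) + nrm A (x \<ominus> y) * nrm A y"
    using nrm_mult d assms by (intro add_mono) auto
  also have "\<dots> \<le> r * nrm A (x \<ominus> y) + nrm A (x \<ominus> y) * r"
    using assms nrm_nonneg[OF d] by (intro add_mono mult_mono) (auto simp: nrm_nonneg \<open>0 \<le> r\<close>)
  finally show ?thesis by simp
qed

text \<open>\<open>1 - z\<close> is the square root of \<open>1 - a\<close>, and \<open>z\<close> is the fixed point of the contraction
  \<open>z \<mapsto> (a + z\<^sup>2) / 2\<close> on a ball of radius less than 1.\<close>

lemma sqrt_fixed_point:
  assumes a: "a \<in> carrier A" "adj A a = a" "nrm A a < 1"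
  obtains z where "z \<in> carrier A" "adj A z = z" "a \<oplus> z \<otimes> z = z \<oplus> z"
proof -
  interpret Metric_space "carrier A" "cstar_dist A" by (rule Metric_space_cstar)
  \<comment> \<open>The midpoint of ||a|| and 1: the ball is mapped into itself because (||a|| +
    r^2) / 2 <= (||a|| + 1) / 2 = r, and r < 1 also serves as the contraction constant.\<close>
  define r where "r = (1 + nrm A a) / 2"
  define f where "f z = (1/2) \<odot> (a \<oplus> z \<otimes> z)" for z
  define S where "S = mcball \<zero> r"
  have r: "0 \<le> r" "r < 1" using a nrm_nonneg[of a] by (auto simp: r_def)
  have S_iff: "z \<in> S \<longleftrightarrow> z \<in> carrier A \<and> nrm A z \<le> r" for z
    using nrm_uminus[of z] by (auto simp: S_def in_mcball cstar_dist_def ring_facts)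
  interpret S: Submetric "carrier A" "cstar_dist A" S
    by standard (auto simp: S_iff)
  have fS: "f \<in> S \<rightarrow> S"
  proof
    fix z assume z: "z \<in> S"
    have "nrm A (f z) = nrm A (a \<oplus> z \<otimes> z) / 2"
      using a z by (simp add: f_def nrm_smult S_iff ring_facts)
    also have "nrm A (a \<oplus> z \<otimes> z) \<le> nrm A a + nrm A z * nrm A z"
      using nrm_triangle[of a "z \<otimes> z"] nrm_mult[of z z] a z by (simp add: S_iff ring_facts)
    also have "nrm A z * nrm A z \<le> r * r"
      using z nrm_nonneg by (intro mult_mono) (auto simp: S_iff r)
    also have "r * r \<le> 1"
      using r by (simp add: mult_le_one)
    finally show "f z \<in> S"
      using a z by (simp add: S_iff f_def r_def ring_facts)
  qed
  have con: "cstar_dist A (f x) (f y) \<le> r * cstar_dist A x y" if "x \<in> S" "y \<in> S" for x y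
  proof -
    have xy: "x \<in> carrier A" "y \<in> carrier A" "nrm A x \<le> r" "nrm A y \<le> r"
      using that by (auto simp: S_iff)
    have fxy: "f x \<in> carrier A" "f y \<in> carrier A" using xy a by (auto simp: f_def ring_facts)
    have "f x \<ominus> f y = (1/2) \<odot> (x \<otimes> x \<ominus> y \<otimes> y)"
      using xy a by (simp add: f_def smult_add_right smult_uminus ring_facts)
    then have "nrm A (f x \<ominus> f y) = nrm A (x \<otimes> x \<ominus> y \<otimes> y) / 2"
      using xy by (simp add: nrm_smult ring_facts)
    then show ?thesis
      using nrm_square_diff[OF xy] xy fxy by (simp add: cstar_dist_def)
  qed
  have comp: "Metric_space.mcomplete S (cstar_dist A)"
    by (rule S.closedin_mcomplete_imp_mcomplete) (auto simp: S_def complete)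
  have "S \<noteq> {}" using r S_iff[of "\<zero>"] by (auto simp: ring_facts)
  from S.sub.Banach_fixedpoint_thm[OF comp this fS r(2) con]
  obtain z where z: "z \<in> S" "f z = z" by auto
  have zc: "z \<in> carrier A" using z by (simp add: S_iff)
  \<comment> \<open>\<open>f\<close> commutes with the adjoint, so the adjoint of the fixed point is
    again a fixed point in the ball; uniqueness makes \<open>z\<close> self-adjoint.\<close>
  have "adj A (f z) = f (adj A z)"
    using zc a by (simp add: f_def adj_smult adj_add adj_mult ring_facts)
  then have "f (adj A z) = adj A z" using z by simp
  moreover have "adj A z \<in> S" using z by (simp add: S_iff nrm_adj)
  ultimately have "adj A z = z"
    using S.sub.contraction_imp_unique_fixpoint[OF _ z(2) fS r(2) con] z by blast
  moreover have "a \<oplus> z \<otimes> z = z \<oplus> z"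
  proof -
    have "z \<oplus> z = f z \<oplus> f z" using z by simp
    also have "\<dots> = (1/2 + 1/2) \<odot> (a \<oplus> z \<otimes> z)"
      unfolding f_def using a zc by (subst smult_add_left) (auto simp: ring_facts)
    finally show ?thesis using a zc by (simp add: ring_facts)
  qed
  ultimately show thesis using that zc by blast
qed

text \<open>Positivity of t - b^* b in the form of an explicit square: for a = b^* b / t the square
  root 1 - z satisfies (1 - z)^2 = 1 - a, so y = sqrt t (1 - z) works. The inequality is strict
  because the square root is constructed only for ||a|| < 1.\<close>

lemma scaled_one_minus_square:
  assumes b: "b \<in> carrier A" and t: "(nrm A b)\<^sup>2 < t"
  obtains y where "y \<in> carrier A"
    "complex_of_real t \<odot> \<one> = adj A b \<otimes> b \<oplus> adj A y \<otimes> y"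
proof -
  have t0: "t > 0" using t by (smt (verit) zero_le_power2)
  define a where "a = complex_of_real (1/t) \<odot> (adj A b \<otimes> b)"
  have a: "a \<in> carrier A" "adj A a = a"
    using b by (auto simp: a_def adj_smult adj_mult ring_facts)
  have "nrm A a = (nrm A b)\<^sup>2 / t"
    using b t0 by (simp add: a_def nrm_smult nrm_cstar norm_divide ring_facts)
  then have "nrm A a < 1" using t t0 by simp
  from sqrt_fixed_point[OF a this]
  obtain z where z: "z \<in> carrier A" "adj A z = z" "a \<oplus> z \<otimes> z = z \<oplus> z" .
  define y where "y = complex_of_real (sqrt t) \<odot> (\<one> \<ominus> z)"
  have y: "y \<in> carrier A" using z by (simp add: y_def ring_facts)
  have "adj A y \<otimes> y = complex_of_real t \<odot> ((\<one> \<ominus> z) \<otimes> (\<one> \<ominus> z))"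
    using z t0 by (simp add: y_def adj_smult smult_mult_left smult_mult_right smult_smult
        adj_add adj_uminus a_minus_def ring_facts(1-6) flip: of_real_mult)
  also have "(\<one> \<ominus> z) \<otimes> (\<one> \<ominus> z) = \<one> \<oplus> z \<otimes> z \<ominus> (z \<oplus> z)"
    using z by (simp add: ring_facts)
  also have "\<dots> = \<one> \<ominus> a"
    using z(1) a unfolding z(3)[symmetric] by (simp add: ring_facts)
  also have "complex_of_real t \<odot> (\<one> \<ominus> a) = complex_of_real t \<odot> \<one> \<ominus> adj A b \<otimes> b"
    using a(1) b t0
    by (simp add: a_minus_def smult_add_right smult_uminus ring_facts(1-6))
       (simp add: a_def smult_smult ring_facts(1-6) flip: of_real_mult)
  finally have "adj A b \<otimes> b \<oplus> adj A y \<otimes> y = complex_of_real t \<odot> \<one>"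
    using b by (simp add: add_diff_cancel ring_facts(1-6))
  with y show thesis using that by simp
qed

section \<open>Norm closures and C*-subalgebras\<close>

lemma norm_closure_eq:
  assumes "S \<subseteq> carrier A"
  shows "norm_closure A S = {x \<in> carrier A. \<forall>e>0. \<exists>y\<in>S. nrm A (y \<ominus> x) < e}"
proof -
  interpret Metric_space "carrier A" "cstar_dist A" by (rule Metric_space_cstar)
  show ?thesis
    unfolding norm_closure_def metric_closure_of 
  proof (rule Collect_cong, rule conj_cong[OF refl], intro iff_allI imp_cong[OF refl] bex_cong[OF refl])
    fix x e y assume "x \<in> carrier A" "y \<in> S"
    then show "y \<in> mball x e \<longleftrightarrow> nrm A (y \<ominus> x) < e"
      using assms by (auto simp: in_mball cstar_dist_def nrm_diff_commute)
  qed
qed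

lemma is_cstar_algebra: "cstar_algebra A"
  by unfold_locales

lemma cstar_subalgebra_carrier: "cstar_subalgebra A (carrier A)"
  by (simp add: cstar_subalgebra_def is_cstar_algebra)

text \<open>Subtraction goes through an additive inverse that is chosen within the carrier, so
  shrinking the carrier might change it. Uniqueness of inverses in \<open>A\<close> excludes
  this.\<close>

lemma restrict_minus:
  assumes "ring (A\<lparr>carrier := S\<rparr>)" "S \<subseteq> carrier A" "x \<in> S" "y \<in> S"
  shows "x \<ominus>\<^bsub>A\<lparr>carrier := S\<rparr>\<^esub> y = x \<ominus> y"
proof -
  interpret S: ring "A\<lparr>carrier := S\<rparr>" by fact
  let ?m = "\<ominus>\<^bsub>A\<lparr>carrier := S\<rparr>\<^esub> y"
  have m: "?m \<in> S" using S.a_inv_closed[of y] assms by simp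
  have "?m \<oplus> y = \<zero>" using S.l_neg[of y] assms by simp
  then have "\<ominus> y = ?m"
    by (rule abelian_group.minus_equality[OF abelian_group_A]) (use m assms(2,4) in blast)+
  then show ?thesis by (simp add: a_minus_def)
qed

lemma cstar_subalgebraI:
  assumes sub: "S \<subseteq> carrier A" and one: "\<one> \<in> S"
    and add: "\<And>x y. x \<in> S \<Longrightarrow> y \<in> S \<Longrightarrow> x \<oplus> y \<in> S"
    and mult: "\<And>x y. x \<in> S \<Longrightarrow> y \<in> S \<Longrightarrow> x \<otimes> y \<in> S"
    and smult: "\<And>c x. x \<in> S \<Longrightarrow> c \<odot> x \<in> S"
    and adj: "\<And>x. x \<in> S \<Longrightarrow> adj A x \<in> S"
    and clo: "\<And>l. l \<in> carrier A \<Longrightarrow> (\<And>e. e > 0 \<Longrightarrow> \<exists>x\<in>S. nrm A (x \<ominus> l) < e) \<Longrightarrow> l \<in> S"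
  shows "cstar_subalgebra A S"
proof -
  let ?B = "A\<lparr>carrier := S\<rparr>"
  have c: "x \<in> carrier A" if "x \<in> S" for x using sub that by blast
  have zero: "\<zero> \<in> S" using smult[OF one, of 0] one c by simp
  have minus: "\<ominus> x \<in> S" if "x \<in> S" for x
    using smult[OF that, of "-1"] c[OF that] by (simp add: uminus_smult)
  have abS: "abelian_group ?B"
    proof (rule abelian_groupI)
    fix x assume "x \<in> carrier ?B"
    then show "\<exists>y\<in>carrier ?B. y \<oplus>\<^bsub>?B\<^esub> x = \<zero>\<^bsub>?B\<^esub>"
      using minus c ring_facts(9) by auto
  qed (use zero add c in \<open>auto simp: ring_facts\<close>)
  have ringS: "ring ?B"
    by (rule ringI[OF abS])
       (use one mult c in \<open>auto intro!: monoidI simp: ring_facts\<close>)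
  have modS: "Module.module (class_ring :: complex ring) ?B"
    by (rule moduleI) (use abS smult c in \<open>auto simp: smult_add_left smult_add_right smult_smult R.is_cring\<close>)
  have dist: "cstar_dist ?B x y = cstar_dist A x y" if "x \<in> S" "y \<in> S" for x y
    using that c restrict_minus[OF ringS sub] by (simp add: cstar_dist_def)
  interpret Metric_space "carrier A" "cstar_dist A" by (rule Metric_space_cstar)
  interpret S: Submetric "carrier A" "cstar_dist A" S by standard (rule sub)
  have S_complete: "Metric_space.mcomplete S (cstar_dist A)"
  proof (rule S.sequentially_closedin_mcomplete_imp_mcomplete[OF complete])
    fix \<sigma> l assume l: "range \<sigma> \<subseteq> S \<and> limitin mtopology \<sigma> l sequentially"
    then have lA: "l \<in> carrier A" by (simp add: limit_metric_sequentially)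
    show "l \<in> S"
    proof (rule clo[OF lA])
      fix e :: real assume "e > 0"
      then obtain N where "\<forall>n\<ge>N. \<sigma> n \<in> carrier A \<and> cstar_dist A (\<sigma> n) l < e"
        using l by (auto simp: limit_metric_sequentially)
      then have "nrm A (\<sigma> N \<ominus> l) < e" using lA by (auto simp: cstar_dist_def)
      then show "\<exists>x\<in>S. nrm A (x \<ominus> l) < e" using l by blast
    qed
  qed
  \<comment> \<open>\<open>cstar_dist\<close> vanishes outside the carrier, so the distances of
    \<open>?B\<close> and \<open>A\<close> agree only on \<open>S\<close>. The metric axioms and
    completeness are therefore carried over pointwise and not by rewriting the distance
    function.\<close>
  have dist_eq: "Metric_space S (cstar_dist ?B)"
  proof
    fix x y z
    show "0 \<le> cstar_dist ?B x y"
      using dist[of x y] nonneg[of x y] by (cases "x \<in> S \<and> y \<in> S") (auto simp: cstar_dist_def)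
    show "cstar_dist ?B x y = cstar_dist ?B y x"
      using dist[of x y] dist[of y x] commute[of x y]
      by (cases "x \<in> S \<and> y \<in> S") (auto simp: cstar_dist_def)
    assume "x \<in> S" "y \<in> S"
    then show "(cstar_dist ?B x y = 0) = (x = y)" using dist c by simp
    assume "z \<in> S"
    then show "cstar_dist ?B x z \<le> cstar_dist ?B x y + cstar_dist ?B y z"
      using dist c triangle \<open>x \<in> S\<close> \<open>y \<in> S\<close> by simp
  qed
  interpret SB: Metric_space S "cstar_dist ?B" by (rule dist_eq)
  have B_complete: "SB.mcomplete"
    unfolding SB.mcomplete_def
  proof (intro allI impI)
    fix \<sigma> assume "SB.MCauchy \<sigma>"
    then have "S.sub.MCauchy \<sigma>"
      unfolding SB.MCauchy_def S.sub.MCauchy_def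
      by (metis dist range_subsetD)
    then obtain x where "limitin S.sub.mtopology \<sigma> x sequentially"
      using S_complete by (auto simp: S.sub.mcomplete_def)
    then have "limitin SB.mtopology \<sigma> x sequentially"
      unfolding SB.limit_metric_sequentially S.sub.limit_metric_sequentially
      by (metis dist)
    then show "\<exists>x. limitin SB.mtopology \<sigma> x sequentially" ..
  qed
  have "cstar_algebra ?B"
    using B_complete one add mult smult adj c
    by (intro cstar_algebra.intro ringS modS cstar_algebra_axioms.intro)
       (auto simp: smult_mult_left smult_mult_right adj_add adj_smult adj_mult nrm_nonneg
         nrm_eq_0 nrm_smult nrm_triangle nrm_mult nrm_cstar)
  then show ?thesis using sub by (simp add: cstar_subalgebra_def)
qed

lemma cstar_subalgebraD:
  assumes "cstar_subalgebra A S"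
  shows "S \<subseteq> carrier A" "\<one> \<in> S"
    "\<And>x y. x \<in> S \<Longrightarrow> y \<in> S \<Longrightarrow> x \<oplus> y \<in> S"
    "\<And>x y. x \<in> S \<Longrightarrow> y \<in> S \<Longrightarrow> x \<otimes> y \<in> S"
    "\<And>c x. x \<in> S \<Longrightarrow> c \<odot> x \<in> S"
    "\<And>x. x \<in> S \<Longrightarrow> adj A x \<in> S"
proof -
  interpret S: cstar_algebra "A\<lparr>carrier := S\<rparr>"
    using assms by (simp add: cstar_subalgebra_def)
  show "S \<subseteq> carrier A" using assms by (simp add: cstar_subalgebra_def)
  show "\<one> \<in> S" using S.ring_facts(6) by simp
  show "\<And>x y. x \<in> S \<Longrightarrow> y \<in> S \<Longrightarrow> x \<oplus> y \<in> S" using S.ring_facts(1) by simp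
  show "\<And>x y. x \<in> S \<Longrightarrow> y \<in> S \<Longrightarrow> x \<otimes> y \<in> S" using S.ring_facts(5) by simp
  show "\<And>c x. x \<in> S \<Longrightarrow> c \<odot> x \<in> S" using S.scale_closed by simp
  show "\<And>x. x \<in> S \<Longrightarrow> adj A x \<in> S" using S.adj_closed by simp
qed

end

section \<open>The C*-algebra of matrices\<close>

text \<open>Removes the strict inequality left by \<open>scaled_one_minus_square\<close>: bounds
  obtained for every s > ||b||^2 pass to ||b||^2 itself.\<close>

lemma le_mult_if_le_greater:
  fixes a c x :: real
  assumes "0 \<le> c" "\<And>s. a < s \<Longrightarrow> x \<le> s * c"
  shows "x \<le> a * c"
proof (rule tendsto_lowerbound)
  show "((\<lambda>s. s * c) \<longlongrightarrow> a * c) (at_right a)" by (intro tendsto_intros)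
  show "\<forall>\<^sub>F s in at_right a. x \<le> s * c"
    using assms(2) by (auto simp: eventually_at_right_field intro: exI[of _ "a + 1"])
qed simp

section \<open>Euclidean norm, inner product and adjoint\<close>

definition vnorm :: "complex vec \<Rightarrow> real" where
  "vnorm v = sqrt (Re (v \<bullet>c v))"

lemma cscalar_self: "v \<bullet>c v = complex_of_real (\<Sum>i<dim_vec v. (cmod (v $ i))\<^sup>2)"
  by (simp add: scalar_prod_def atLeast0LessThan complex_norm_square del: of_real_power)

lemma vnorm_L2: "vnorm v = L2_set (\<lambda>i. cmod (v $ i)) {..<dim_vec v}"
  unfolding vnorm_def cscalar_self L2_set_def by simp

lemma vnorm_nonneg [simp]: "0 \<le> vnorm v"
  by (simp add: vnorm_L2)

lemma vnorm_square: "complex_of_real ((vnorm v)\<^sup>2) = v \<bullet>c v"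
  unfolding vnorm_def cscalar_self by (simp add: sum_nonneg)

lemma vnorm_eq_0: "v \<in> carrier_vec n \<Longrightarrow> vnorm v = 0 \<longleftrightarrow> v = 0\<^sub>v n"
  unfolding vnorm_L2 by (subst L2_set_eq_0_iff) auto

lemma vnorm_triangle:
  assumes "v \<in> carrier_vec n" "w \<in> carrier_vec n"
  shows "vnorm (v + w) \<le> vnorm v + vnorm w"
proof -
  have "vnorm (v + w) \<le> L2_set (\<lambda>i. cmod (v $ i) + cmod (w $ i)) {..<n}"
    unfolding vnorm_L2 using assms by (auto intro!: L2_set_mono norm_triangle_ineq)
  also have "\<dots> \<le> vnorm v + vnorm w"
    unfolding vnorm_L2 using assms L2_set_triangle_ineq by auto
  finally show ?thesis .
qed

lemma vnorm_smult: "vnorm (c \<cdot>\<^sub>v v) = cmod c * vnorm v"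
  unfolding vnorm_L2 L2_set_right_distrib[OF norm_ge_zero]
  by (rule L2_set_cong) (simp_all add: norm_mult)

lemma cmod_cscalar_le:
  assumes "v \<in> carrier_vec n" "w \<in> carrier_vec n"
  shows "cmod (v \<bullet>c w) \<le> vnorm v * vnorm w"
proof -
  have "cmod (v \<bullet>c w) \<le> (\<Sum>i<n. cmod (v $ i) * cmod (w $ i))"
    using assms by (auto simp: scalar_prod_def atLeast0LessThan norm_mult intro!: sum_norm_le)
  also have "\<dots> \<le> vnorm v * vnorm w"
    unfolding vnorm_L2 using assms L2_set_mult_ineq[of "\<lambda>i. cmod (v $ i)" "\<lambda>i. cmod (w $ i)" "{..<n}"]
    by simp
  finally show ?thesis .
qed

lemma cmod_index_le: "i < dim_vec v \<Longrightarrow> cmod (v $ i) \<le> vnorm v"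
  unfolding vnorm_L2 by (rule member_le_L2_set) auto

lemma vnorm_unit_vec [simp]: "i < n \<Longrightarrow> vnorm (unit_vec n i) = 1"
  by (simp add: vnorm_def)

lemma mat_adjoint_carrier [simp]:
  "M \<in> carrier_mat m n \<Longrightarrow> mat_adjoint M \<in> carrier_mat n m"
  by (auto simp: mat_adjoint_def)

lemma mat_adjoint_dim [simp]:
  "dim_row (mat_adjoint M) = dim_col M" "dim_col (mat_adjoint M) = dim_row M"
  by (auto simp: mat_adjoint_def)

lemma mat_adjoint_index [simp]:
  fixes M :: "complex mat"
  shows "i < dim_col M \<Longrightarrow> j < dim_row M \<Longrightarrow> mat_adjoint M $$ (i, j) = cnj (M $$ (j, i))"
  by (simp add: mat_adjoint_def mat_of_rows_def)

lemma mat_adjoint_adjoint [simp]: "mat_adjoint (mat_adjoint M) = (M :: complex mat)"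
  by (rule eq_matI) auto

lemma mat_adjoint_mult:
  fixes M N :: "complex mat"
  assumes "M \<in> carrier_mat m k" "N \<in> carrier_mat k n"
  shows "mat_adjoint (M * N) = mat_adjoint N * mat_adjoint M"
  by (rule eq_matI) (use assms in \<open>auto simp: scalar_prod_def mult.commute intro!: sum.cong\<close>)

lemma cscalar_mult_mat_vec:
  fixes M :: "complex mat"
  assumes "M \<in> carrier_mat m n" "v \<in> carrier_vec n" "w \<in> carrier_vec m"
  shows "(M *\<^sub>v v) \<bullet>c w = v \<bullet>c (mat_adjoint M *\<^sub>v w)"
proof -
  have "(M *\<^sub>v v) \<bullet>c w = (\<Sum>i<m. \<Sum>j<n. M $$ (i, j) * v $ j * cnj (w $ i))"
    using assms by (auto simp: scalar_prod_def atLeast0LessThan sum_distrib_right intro!: sum.cong)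
  also have "\<dots> = (\<Sum>j<n. \<Sum>i<m. M $$ (i, j) * v $ j * cnj (w $ i))"
    by (rule sum.swap)
  also have "\<dots> = v \<bullet>c (mat_adjoint M *\<^sub>v w)"
    using assms by (auto simp: scalar_prod_def atLeast0LessThan sum_distrib_left intro!: sum.cong)
  finally show ?thesis .
qed

text \<open>A crude bound through the sum of all entries. It makes the supremum defining the
  operator norm finite and later turns entrywise convergence into norm convergence.\<close>

lemma vnorm_mult_mat_vec_le:
  assumes T: "T \<in> carrier_mat m n" and v: "v \<in> carrier_vec n"
  shows "vnorm (T *\<^sub>v v) \<le> (\<Sum>i<m. \<Sum>j<n. cmod (T $$ (i, j))) * vnorm v"
proof -
  have "vnorm (T *\<^sub>v v) \<le> (\<Sum>i<m. cmod ((T *\<^sub>v v) $ i))"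
  proof -
    have "dim_vec (T *\<^sub>v v) = m" using T by simp
    then show ?thesis unfolding vnorm_L2 by (metis L2_set_le_sum norm_ge_zero)
  qed
  also have "\<dots> \<le> (\<Sum>i<m. \<Sum>j<n. cmod (T $$ (i, j)) * vnorm v)"
  proof (rule sum_mono)
    fix i assume i: "i \<in> {..<m}"
    have "cmod ((T *\<^sub>v v) $ i) \<le> (\<Sum>j<n. cmod (T $$ (i, j) * v $ j))"
      using T v i by (auto simp: scalar_prod_def atLeast0LessThan intro!: sum_norm_le)
    also have "\<dots> \<le> (\<Sum>j<n. cmod (T $$ (i, j)) * vnorm v)"
      using v by (auto simp: norm_mult intro!: sum_mono mult_left_mono cmod_index_le)
    finally show "cmod ((T *\<^sub>v v) $ i) \<le> (\<Sum>j<n. cmod (T $$ (i, j)) * vnorm v)" .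
  qed
  finally show ?thesis by (simp add: sum_distrib_right)
qed

section \<open>The operator norm\<close>

lemma operator_norm_eq:
  "operator_norm T = (SUP v\<in>{v \<in> carrier_vec (dim_col T). vnorm v \<le> 1}. vnorm (T *\<^sub>v v))"
  by (simp add: operator_norm_def vnorm_def)

lemma operator_norm_le:
  assumes "T \<in> carrier_mat m n" "0 \<le> C"
    and "\<And>v. v \<in> carrier_vec n \<Longrightarrow> vnorm (T *\<^sub>v v) \<le> C * vnorm v"
  shows "operator_norm T \<le> C"
  unfolding operator_norm_eq
proof (rule cSUP_least)
  show "{v \<in> carrier_vec (dim_col T). vnorm v \<le> 1} \<noteq> {}"
    using vnorm_eq_0[of "0\<^sub>v (dim_col T)" "dim_col T"] by (auto intro!: exI[of _ "0\<^sub>v (dim_col T)"])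
  fix v assume "v \<in> {v \<in> carrier_vec (dim_col T). vnorm v \<le> 1}"
  then have "v \<in> carrier_vec n" "vnorm v \<le> 1" using assms by auto
  then show "vnorm (T *\<^sub>v v) \<le> C"
    using assms(3)[of v] mult_left_mono[of "vnorm v" 1 C] assms(2) by simp
qed

lemma operator_norm_bound:
  assumes T: "T \<in> carrier_mat m n" and v: "v \<in> carrier_vec n"
  shows "vnorm (T *\<^sub>v v) \<le> operator_norm T * vnorm v"
proof (cases "vnorm v = 0")
  case True
  then show ?thesis using vnorm_mult_mat_vec_le[OF T v] by simp
next
  case False
  define u where "u = complex_of_real (1 / vnorm v) \<cdot>\<^sub>v v"
  have vu: "v = complex_of_real (vnorm v) \<cdot>\<^sub>v u"
    using False by (simp add: u_def smult_smult_assoc)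
  have u: "u \<in> carrier_vec n" "vnorm u = 1"
    using v False by (auto simp: u_def vnorm_smult norm_divide)
  let ?S = "\<Sum>i<m. \<Sum>j<n. cmod (T $$ (i, j))"
  have "vnorm (T *\<^sub>v u) \<le> operator_norm T"
    unfolding operator_norm_eq
  proof (rule cSUP_upper)
    show "bdd_above ((\<lambda>v. vnorm (T *\<^sub>v v)) ` {v \<in> carrier_vec (dim_col T). vnorm v \<le> 1})"
    proof (rule bdd_aboveI2)
      fix w assume "w \<in> {v \<in> carrier_vec (dim_col T). vnorm v \<le> 1}"
      then have w: "w \<in> carrier_vec n" "vnorm w \<le> 1" using T by auto
      have "vnorm (T *\<^sub>v w) \<le> ?S * vnorm w" by (rule vnorm_mult_mat_vec_le[OF T w(1)])
      also have "\<dots> \<le> ?S * 1" by (rule mult_left_mono[OF w(2)]) (simp add: sum_nonneg)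
      finally show "vnorm (T *\<^sub>v w) \<le> ?S" by simp
    qed
  qed (use u T in auto)
  then have "vnorm v * vnorm (T *\<^sub>v u) \<le> operator_norm T * vnorm v"
    using mult_left_mono[OF _ vnorm_nonneg[of v]] by (metis mult.commute)
  moreover have "T *\<^sub>v v = complex_of_real (vnorm v) \<cdot>\<^sub>v (T *\<^sub>v u)"
    using mult_mat_vec[OF T u(1)] vu by metis
  ultimately show ?thesis by (simp add: vnorm_smult)
qed

lemma operator_norm_nonneg:
  assumes "T \<in> carrier_mat m n"
  shows "0 \<le> operator_norm T"
proof (cases "n = 0")
  \<comment> \<open>For n = 0 there is no unit vector to test with; the supremum runs over the empty
    vector alone.\<close>
  case True
  then have "{v \<in> carrier_vec (dim_col T). vnorm v \<le> 1} = {0\<^sub>v 0}"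
    using assms by (auto simp: vnorm_L2)
  then show ?thesis by (simp add: operator_norm_eq)
next
  case False
  then show ?thesis
    using operator_norm_bound[OF assms, of "unit_vec n 0"] 
      vnorm_nonneg[of "T *\<^sub>v unit_vec n 0"] by (simp del: vnorm_nonneg)
qed

lemma cmod_entry_le:
  assumes T: "T \<in> carrier_mat m n" and ij: "i < m" "j < n"
  shows "cmod (T $$ (i, j)) \<le> operator_norm T"
proof -
  have "T *\<^sub>v unit_vec n j = col T j" using T ij by auto
  then have "cmod (T $$ (i, j)) \<le> vnorm (T *\<^sub>v unit_vec n j)"
    using cmod_index_le[of i "col T j"] T ij by auto
  also have "\<dots> \<le> operator_norm T"
    using operator_norm_bound[OF T, of "unit_vec n j"] ij by simp
  finally show ?thesis .
qed

lemma operator_norm_le_sum: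
  assumes "T \<in> carrier_mat m n"
  shows "operator_norm T \<le> (\<Sum>i<m. \<Sum>j<n. cmod (T $$ (i, j)))"
  by (rule operator_norm_le[OF assms _ vnorm_mult_mat_vec_le[OF assms]]) (simp add: sum_nonneg)

text \<open>|T^* v|^2 = <T T^* v, v> <= ||T|| |T^* v| |v|, and one factor |T^* v| cancels.\<close>

lemma operator_norm_adjoint_le:
  assumes T: "T \<in> carrier_mat m n"
  shows "operator_norm (mat_adjoint T) \<le> operator_norm T"
proof (rule operator_norm_le[OF mat_adjoint_carrier[OF T] operator_norm_nonneg[OF T]])
  fix v :: "complex vec" assume v: "v \<in> carrier_vec m"
  let ?w = "mat_adjoint T *\<^sub>v v"
  have w: "?w \<in> carrier_vec n" by (rule mult_mat_vec_carrier[OF mat_adjoint_carrier[OF T] v])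
  have "complex_of_real ((vnorm ?w)\<^sup>2) = (T *\<^sub>v ?w) \<bullet>c v"
    unfolding vnorm_square cscalar_mult_mat_vec[OF T w v] ..
  then have "(vnorm ?w)\<^sup>2 = cmod ((T *\<^sub>v ?w) \<bullet>c v)"
    by (metis norm_of_real abs_of_nonneg zero_le_power2)
  also have "\<dots> \<le> vnorm (T *\<^sub>v ?w) * vnorm v"
    by (rule cmod_cscalar_le) (use T w v in auto)
  also have "\<dots> \<le> (operator_norm T * vnorm ?w) * vnorm v"
    by (rule mult_right_mono[OF operator_norm_bound[OF T w]]) simp
  finally have "vnorm ?w * vnorm ?w \<le> vnorm ?w * (operator_norm T * vnorm v)"
    by (simp add: power2_eq_square ac_simps)
  then show "vnorm ?w \<le> operator_norm T * vnorm v"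
    by (cases "vnorm ?w = 0") (auto simp: operator_norm_nonneg[OF T] less_le)
qed

lemma operator_norm_mult:
  assumes S: "S \<in> carrier_mat m k" and T: "T \<in> carrier_mat k n"
  shows "operator_norm (S * T) \<le> operator_norm S * operator_norm T"
proof (rule operator_norm_le[OF mult_carrier_mat[OF S T]])
  show "0 \<le> operator_norm S * operator_norm T"
    using S T operator_norm_nonneg by auto
  fix v :: "complex vec" assume v: "v \<in> carrier_vec n"
  have "vnorm (S * T *\<^sub>v v) = vnorm (S *\<^sub>v (T *\<^sub>v v))"
    using S T v by (simp add: assoc_mult_mat_vec)
  also have "\<dots> \<le> operator_norm S * vnorm (T *\<^sub>v v)"
    by (rule operator_norm_bound) (use S T v in auto)
  also have "\<dots> \<le> operator_norm S * (operator_norm T * vnorm v)"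
    by (rule mult_left_mono[OF operator_norm_bound[OF T v] operator_norm_nonneg[OF S]])
  finally show "vnorm (S * T *\<^sub>v v) \<le> operator_norm S * operator_norm T * vnorm v"
    by (simp add: mult.assoc)
qed

text \<open>The lower bound is |T v|^2 = <v, T^* T v> <= ||T^* T|| |v|^2; the upper one follows from
  ||T^*|| <= ||T||.\<close>

lemma operator_norm_cstar:
  assumes T: "T \<in> carrier_mat m n"
  shows "operator_norm (mat_adjoint T * T) = (operator_norm T)\<^sup>2"
proof (rule antisym)
  have T': "mat_adjoint T \<in> carrier_mat n m" using T by simp
  note pos = operator_norm_nonneg[OF T]
  show "operator_norm (mat_adjoint T * T) \<le> (operator_norm T)\<^sup>2"
    using operator_norm_mult[OF T' T] mult_right_mono[OF operator_norm_adjoint_le[OF T] pos]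
    by (simp add: power2_eq_square)
  have P: "mat_adjoint T * T \<in> carrier_mat n n" using T by auto
  note Ppos = operator_norm_nonneg[OF P]
  have "operator_norm T \<le> sqrt (operator_norm (mat_adjoint T * T))"
  proof (rule operator_norm_le[OF T])
    fix v :: "complex vec" assume v: "v \<in> carrier_vec n"
    have Tv: "T *\<^sub>v v \<in> carrier_vec m" using T v by auto
    have "complex_of_real ((vnorm (T *\<^sub>v v))\<^sup>2) = v \<bullet>c (mat_adjoint T * T *\<^sub>v v)"
      unfolding vnorm_square cscalar_mult_mat_vec[OF T v Tv]
      using T v by (simp add: assoc_mult_mat_vec[OF T' T])
    then have "(vnorm (T *\<^sub>v v))\<^sup>2 = cmod (v \<bullet>c (mat_adjoint T * T *\<^sub>v v))"
      by (metis norm_of_real abs_of_nonneg zero_le_power2)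
    also have "\<dots> \<le> vnorm v * vnorm (mat_adjoint T * T *\<^sub>v v)"
      by (rule cmod_cscalar_le) (use P v in auto)
    also have "\<dots> \<le> vnorm v * (operator_norm (mat_adjoint T * T) * vnorm v)"
      by (rule mult_left_mono[OF operator_norm_bound[OF P v]]) simp
    finally have "(vnorm (T *\<^sub>v v))\<^sup>2 \<le> (sqrt (operator_norm (mat_adjoint T * T)) * vnorm v)\<^sup>2"
      using Ppos by (simp add: power_mult_distrib power2_eq_square[of "vnorm v"] ac_simps)
    then show "vnorm (T *\<^sub>v v) \<le> sqrt (operator_norm (mat_adjoint T * T)) * vnorm v"
      by (rule power2_le_imp_le) (use Ppos in auto)
  qed (use Ppos in auto)
  then have "(operator_norm T)\<^sup>2 \<le> (sqrt (operator_norm (mat_adjoint T * T)))\<^sup>2"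
    using pos by (rule power_mono)
  then show "(operator_norm T)\<^sup>2 \<le> operator_norm (mat_adjoint T * T)"
    using Ppos by simp
qed

lemma operator_norm_eq_0:
  assumes T: "T \<in> carrier_mat m n"
  shows "operator_norm T = 0 \<longleftrightarrow> T = 0\<^sub>m m n"
proof
  assume z: "operator_norm T = 0"
  show "T = 0\<^sub>m m n"
    by (rule eq_matI) (use T z cmod_entry_le[OF T] in auto)
next
  assume "T = 0\<^sub>m m n"
  then have "operator_norm T \<le> 0" using operator_norm_le_sum[OF T] by simp
  then show "operator_norm T = 0" using operator_norm_nonneg[OF T] by simp
qed

lemma operator_norm_triangle:
  assumes S: "S \<in> carrier_mat m n" and T: "T \<in> carrier_mat m n"
  shows "operator_norm (S + T) \<le> operator_norm S + operator_norm T"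
proof (rule operator_norm_le)
  show "S + T \<in> carrier_mat m n" using S T by simp
  show "0 \<le> operator_norm S + operator_norm T" using S T operator_norm_nonneg by auto
  fix v :: "complex vec" assume v: "v \<in> carrier_vec n"
  have "vnorm ((S + T) *\<^sub>v v) \<le> vnorm (S *\<^sub>v v) + vnorm (T *\<^sub>v v)"
    unfolding add_mult_distrib_mat_vec[OF S T v]
    by (rule vnorm_triangle[where n = m]) (use S T v in auto)
  also have "\<dots> \<le> operator_norm S * vnorm v + operator_norm T * vnorm v"
    by (intro add_mono operator_norm_bound[OF S v] operator_norm_bound[OF T v])
  finally show "vnorm ((S + T) *\<^sub>v v) \<le> (operator_norm S + operator_norm T) * vnorm v"
    by (simp add: algebra_simps)
qed

lemma operator_norm_smult_le:
  assumes T: "T \<in> carrier_mat m n"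
  shows "operator_norm (c \<cdot>\<^sub>m T) \<le> cmod c * operator_norm T"
proof (rule operator_norm_le)
  show "c \<cdot>\<^sub>m T \<in> carrier_mat m n" using T by simp
  show "0 \<le> cmod c * operator_norm T" using operator_norm_nonneg[OF T] by simp
  fix v :: "complex vec" assume v: "v \<in> carrier_vec n"
  have "(c \<cdot>\<^sub>m T) *\<^sub>v v = c \<cdot>\<^sub>v (T *\<^sub>v v)" using T v by auto
  then show "vnorm ((c \<cdot>\<^sub>m T) *\<^sub>v v) \<le> cmod c * operator_norm T * vnorm v"
    using operator_norm_bound[OF T v] by (simp add: vnorm_smult mult.assoc mult_left_mono)
qed

lemma operator_norm_smult:
  assumes T: "T \<in> carrier_mat m n"
  shows "operator_norm (c \<cdot>\<^sub>m T) = cmod c * operator_norm T"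
proof (cases "c = 0")
  case True
  then show ?thesis
    using operator_norm_smult_le[OF T, of c] operator_norm_nonneg[of "c \<cdot>\<^sub>m T" m n] T by auto
next
  case False
  have cT: "c \<cdot>\<^sub>m T \<in> carrier_mat m n" using T by simp
  have "(1/c) \<cdot>\<^sub>m (c \<cdot>\<^sub>m T) = T" using False T by (intro eq_matI) auto
  then have "cmod c * operator_norm T \<le> cmod c * (cmod (1/c) * operator_norm (c \<cdot>\<^sub>m T))"
    using operator_norm_smult_le[OF cT, of "1/c"] by (intro mult_left_mono) auto
  also have "\<dots> = operator_norm (c \<cdot>\<^sub>m T)" using False by (simp add: norm_divide)
  finally show ?thesis using operator_norm_smult_le[OF T, of c] by simp
qed

section \<open>Verification of the C*-axioms for matrices\<close>

lemma mat_cstar_simps [simp]: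
  "carrier (mat_cstar n) = carrier_mat n n"
  "x \<otimes>\<^bsub>mat_cstar n\<^esub> y = x * y"
  "\<one>\<^bsub>mat_cstar n\<^esub> = 1\<^sub>m n"
  "\<zero>\<^bsub>mat_cstar n\<^esub> = 0\<^sub>m n n"
  "x \<oplus>\<^bsub>mat_cstar n\<^esub> y = x + y"
  "c \<odot>\<^bsub>mat_cstar n\<^esub> x = c \<cdot>\<^sub>m x"
  "adj (mat_cstar n) x = mat_adjoint x"
  "nrm (mat_cstar n) x = operator_norm x"
  by (simp_all add: mat_cstar_def)

lemma abelian_group_mat_cstar: "abelian_group (mat_cstar n)"
proof (rule abelian_groupI)
  fix x assume "x \<in> carrier (mat_cstar n)"
  then show "\<exists>y\<in>carrier (mat_cstar n). y \<oplus>\<^bsub>mat_cstar n\<^esub> x = \<zero>\<^bsub>mat_cstar n\<^esub>"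
    by (auto intro!: bexI[of _ "- x"])
qed (auto intro: comm_add_mat)

lemma ring_mat_cstar: "ring (mat_cstar n)"
  by (rule ringI[OF abelian_group_mat_cstar])
     (auto intro!: monoidI simp: add_mult_distrib_mat mult_add_distrib_mat)

lemma mat_cstar_minus:
  assumes "x \<in> carrier_mat n n" "y \<in> carrier_mat n n"
  shows "x \<ominus>\<^bsub>mat_cstar n\<^esub> y = x - y"
proof -
  have "\<ominus>\<^bsub>mat_cstar n\<^esub> y = - y"
    by (rule abelian_group.minus_equality[OF abelian_group_mat_cstar]) (use assms in auto)
  then show ?thesis
    using assms by (simp add: a_minus_def add_uminus_minus_mat)
qed

lemma module_mat_cstar: "Module.module (class_ring :: complex ring) (mat_cstar n)"
  by (rule moduleI)
     (auto simp: abelian_group_mat_cstar class_cring.is_cring add_smult_distrib_right_mat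
       add_smult_distrib_left_mat smult_smult_assoc)

text \<open>Entries are dominated by the operator norm, so each entry converges. The sum of the
  entrywise errors dominates the operator norm of the difference and brings norm convergence
  back.\<close>

lemma operator_norm_convergent:
  fixes \<sigma> :: "nat \<Rightarrow> complex mat"
  assumes \<sigma>: "\<And>k. \<sigma> k \<in> carrier_mat n n"
    and cauchy: "\<And>e. e > 0 \<Longrightarrow> \<exists>N. \<forall>k\<ge>N. \<forall>l\<ge>N. operator_norm (\<sigma> k - \<sigma> l) < e"
  obtains L where "L \<in> carrier_mat n n" "(\<lambda>k. operator_norm (\<sigma> k - L)) \<longlonglongrightarrow> 0"
proof -
  have "\<exists>l. (\<lambda>k. \<sigma> k $$ (i, j)) \<longlonglongrightarrow> l" if ij: "i < n" "j < n" for i j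
  proof -
    have "Cauchy (\<lambda>k. \<sigma> k $$ (i, j))"
    proof (rule metric_CauchyI)
      fix e :: real assume "e > 0"
      then obtain N where N: "\<And>k l. k \<ge> N \<Longrightarrow> l \<ge> N \<Longrightarrow> operator_norm (\<sigma> k - \<sigma> l) < e"
        using cauchy by blast
      have "dist (\<sigma> k $$ (i, j)) (\<sigma> l $$ (i, j)) < e" if "k \<ge> N" "l \<ge> N" for k l
        using cmod_entry_le[OF minus_carrier_mat[OF \<sigma>[of l], of "\<sigma> k"] ij] ij \<sigma>[of k] \<sigma>[of l] N[OF that]
        by (auto simp: dist_norm)
      then show "\<exists>M. \<forall>m\<ge>M. \<forall>n\<ge>M. dist (\<sigma> m $$ (i, j)) (\<sigma> n $$ (i, j)) < e" by blast
    qed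
    then show ?thesis by (simp add: Cauchy_convergent_iff convergent_def)
  qed
  then obtain L where L: "\<And>i j. i < n \<Longrightarrow> j < n \<Longrightarrow> (\<lambda>k. \<sigma> k $$ (i, j)) \<longlonglongrightarrow> L i j"
    by metis
  let ?L = "mat n n (\<lambda>(i, j). L i j)"
  have "(\<lambda>k. \<Sum>i<n. \<Sum>j<n. cmod (\<sigma> k $$ (i, j) - L i j)) \<longlonglongrightarrow> (\<Sum>i<n. \<Sum>j<n. 0)"
    by (intro tendsto_sum) (use L in \<open>auto simp: tendsto_norm_zero_iff LIM_zero_iff\<close>)
  then have lim: "(\<lambda>k. \<Sum>i<n. \<Sum>j<n. cmod (\<sigma> k $$ (i, j) - L i j)) \<longlonglongrightarrow> 0" by simp
  have "(\<lambda>k. operator_norm (\<sigma> k - ?L)) \<longlonglongrightarrow> 0"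
  proof (rule tendsto_sandwich[OF _ _ tendsto_const lim])
    have c: "\<sigma> k - ?L \<in> carrier_mat n n" for k using \<sigma>[of k] by auto
    show "\<forall>\<^sub>F k in sequentially. 0 \<le> operator_norm (\<sigma> k - ?L)"
      using operator_norm_nonneg[OF c] by simp
    show "\<forall>\<^sub>F k in sequentially. operator_norm (\<sigma> k - ?L)
        \<le> (\<Sum>i<n. \<Sum>j<n. cmod (\<sigma> k $$ (i, j) - L i j))"
      using operator_norm_le_sum[OF c] \<sigma> by (auto simp: carrier_matD[OF \<sigma>])
  qed
  then show thesis using that[of ?L] by simp
qed

lemma cstar_dist_mat:
  assumes "x \<in> carrier_mat n n" "y \<in> carrier_mat n n"
  shows "cstar_dist (mat_cstar n) x y = operator_norm (x - y)"
  using assms by (simp add: cstar_dist_def mat_cstar_minus)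

theorem cstar_algebra_mat_cstar: "cstar_algebra (mat_cstar n)"
proof (intro cstar_algebra.intro ring_mat_cstar module_mat_cstar cstar_algebra_axioms.intro)
  interpret Metric_space "carrier_mat n n" "cstar_dist (mat_cstar n)"
  proof
    fix x y z :: "complex mat"
    show "0 \<le> cstar_dist (mat_cstar n) x y"
      by (auto simp: cstar_dist_def mat_cstar_minus intro!: operator_norm_nonneg)
    show "cstar_dist (mat_cstar n) x y = cstar_dist (mat_cstar n) y x"
    proof (cases "x \<in> carrier_mat n n \<and> y \<in> carrier_mat n n")
      case True
      then have "y - x = (-1) \<cdot>\<^sub>m (x - y)" by (intro eq_matI) auto
      then show ?thesis
        using True operator_norm_smult[of "x - y" n n "-1"] by (simp add: cstar_dist_mat minus_carrier_mat)
    qed (auto simp: cstar_dist_def)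
    assume x: "x \<in> carrier_mat n n" and y: "y \<in> carrier_mat n n"
    have "x - y = 0\<^sub>m n n \<longleftrightarrow> x = y"
    proof
      assume "x - y = 0\<^sub>m n n"
      then have "(x - y) + y = y" using y by simp
      then show "x = y" using x y by (auto simp: minus_add_uminus_mat[of x n n y])
    qed (use y in auto)
    then show "(cstar_dist (mat_cstar n) x y = 0) = (x = y)"
      using x y by (simp add: cstar_dist_mat minus_carrier_mat operator_norm_eq_0[of _ n n])
    assume z: "z \<in> carrier_mat n n"
    have "x - z = (x - y) + (y - z)" using x y z by (intro eq_matI) auto
    then show "cstar_dist (mat_cstar n) x z
        \<le> cstar_dist (mat_cstar n) x y + cstar_dist (mat_cstar n) y z"
      using x y z by (simp add: cstar_dist_mat minus_carrier_mat operator_norm_triangle[of _ n n])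
  qed
  show "Metric_space.mcomplete (carrier (mat_cstar n)) (cstar_dist (mat_cstar n))"
    unfolding mat_cstar_simps mcomplete_def
  proof (intro allI impI)
    fix \<sigma> assume "MCauchy \<sigma>"
    then have \<sigma>: "\<sigma> k \<in> carrier_mat n n" for k by (auto simp: MCauchy_def)
    have "\<exists>N. \<forall>k\<ge>N. \<forall>l\<ge>N. operator_norm (\<sigma> k - \<sigma> l) < e" if "e > 0" for e
      using \<open>MCauchy \<sigma>\<close> that unfolding MCauchy_def by (simp add: cstar_dist_mat \<sigma>)
    then obtain L where L: "L \<in> carrier_mat n n" "(\<lambda>k. operator_norm (\<sigma> k - L)) \<longlonglongrightarrow> 0"
      using operator_norm_convergent[of \<sigma> n] \<sigma> by blast
    have "\<exists>N. \<forall>k\<ge>N. operator_norm (\<sigma> k - L) < e" if "e > 0" for e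
      using LIMSEQ_D[OF L(2) that] by fastforce
    then have "limitin mtopology \<sigma> L sequentially"
      unfolding limit_metric_sequentially using L(1) by (simp add: cstar_dist_mat \<sigma>)
    then show "\<exists>L. limitin mtopology \<sigma> L sequentially" ..
  qed
next
  fix x y :: "complex mat" and c
  assume x: "x \<in> carrier (mat_cstar n)"
  show "adj (mat_cstar n) (c \<odot>\<^bsub>mat_cstar n\<^esub> x) = cnj c \<odot>\<^bsub>mat_cstar n\<^esub> adj (mat_cstar n) x"
    using x by (auto intro!: eq_matI)
  assume y: "y \<in> carrier (mat_cstar n)"
  show "adj (mat_cstar n) (x \<oplus>\<^bsub>mat_cstar n\<^esub> y)
      = adj (mat_cstar n) x \<oplus>\<^bsub>mat_cstar n\<^esub> adj (mat_cstar n) y"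
    using x y by (auto intro!: eq_matI)
qed (simp_all add: mat_adjoint_mult[of _ n n _ n] operator_norm_nonneg[of _ n n]
    operator_norm_eq_0[of _ n n] operator_norm_smult[of _ n n] operator_norm_triangle[of _ n n]
    operator_norm_mult[of _ n n] operator_norm_cstar[of _ n n]
    mult_smult_assoc_mat[of _ n n _ n] mult_smult_distrib[of _ n n _ n])

section \<open>Sums of squares\<close>

context cstar_algebra
begin

text \<open>A function of two indices stands for the form sum_kl v_k^* X_kl v_l in formal variables
  v_k. An arbitrary index type postpones the choice of a finite matrix size until positivity is
  transferred.\<close>

definition form :: "('i \<Rightarrow> 'i \<Rightarrow> 'a) \<Rightarrow> bool" where
  "form X \<longleftrightarrow> (\<forall>k l. X k l \<in> carrier A)"

text \<open>The form |sum_k r_k v_k|^2 of the row \<open>r\<close>.\<close>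

definition sq :: "('i \<Rightarrow> 'a) \<Rightarrow> 'i \<Rightarrow> 'i \<Rightarrow> 'a" where
  "sq r = (\<lambda>k l. adj A (r k) \<otimes> r l)"

definition add_form :: "('i \<Rightarrow> 'i \<Rightarrow> 'a) \<Rightarrow> ('i \<Rightarrow> 'i \<Rightarrow> 'a) \<Rightarrow> 'i \<Rightarrow> 'i \<Rightarrow> 'a" (infixl "\<boxplus>" 65) where
  "X \<boxplus> Y = (\<lambda>k l. X k l \<oplus> Y k l)"

definition scale_form :: "real \<Rightarrow> ('i \<Rightarrow> 'i \<Rightarrow> 'a) \<Rightarrow> 'i \<Rightarrow> 'i \<Rightarrow> 'a" (infixr "\<boxdot>" 70) where
  "c \<boxdot> X = (\<lambda>k l. complex_of_real c \<odot> X k l)"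

text \<open>An inductive predicate makes stability under sums and positive scaling plain inductions;
  the number of squares surfaces only in \<open>sos_rows\<close>.\<close>

inductive sos :: "('i \<Rightarrow> 'i \<Rightarrow> 'a) \<Rightarrow> bool" where
  sos_zero: "sos (\<lambda>k l. \<zero>)"
| sos_add_sq: "sos X \<Longrightarrow> (\<And>k. r k \<in> carrier A) \<Longrightarrow> sos (X \<boxplus> sq r)"

text \<open>The order is witnessed by an explicit remainder. Writing Y as X plus a sum of squares
  keeps subtraction out of the calculus of forms.\<close>

definition sos_le :: "('i \<Rightarrow> 'i \<Rightarrow> 'a) \<Rightarrow> ('i \<Rightarrow> 'i \<Rightarrow> 'a) \<Rightarrow> bool" (infix "\<preceq>" 50) where
  "X \<preceq> Y \<longleftrightarrow> form X \<and> (\<exists>S. sos S \<and> Y = X \<boxplus> S)"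

lemma formD [simp]: "form X \<Longrightarrow> X k l \<in> carrier A"
  by (simp add: form_def)

lemma form_sq [simp]: "(\<And>k. r k \<in> carrier A) \<Longrightarrow> form (sq r)"
  by (simp add: form_def sq_def ring_facts)

lemma form_add [simp]: "form X \<Longrightarrow> form Y \<Longrightarrow> form (X \<boxplus> Y)"
  by (simp add: form_def add_form_def ring_facts)

lemma form_scale [simp]: "form X \<Longrightarrow> form (c \<boxdot> X)"
  by (simp add: form_def scale_form_def)

lemma sos_form: "sos X \<Longrightarrow> form X"
  by (induction rule: sos.induct) (auto simp: form_def[of "\<lambda>k l. \<zero>"] ring_facts)

lemma add_form_assoc: "form X \<Longrightarrow> form Y \<Longrightarrow> form Z \<Longrightarrow> X \<boxplus> Y \<boxplus> Z = X \<boxplus> (Y \<boxplus> Z)"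
  by (simp add: add_form_def ring_facts)

lemma add_form_commute: "form X \<Longrightarrow> form Y \<Longrightarrow> X \<boxplus> Y = Y \<boxplus> X"
  unfolding add_form_def by (intro ext ring_facts(10)) auto

lemma add_form_zero: "form X \<Longrightarrow> X \<boxplus> (\<lambda>k l. \<zero>) = X"
  by (simp add: add_form_def ring_facts)

lemma add_form_interchange:
  "form X \<Longrightarrow> form Y \<Longrightarrow> form Z \<Longrightarrow> form W \<Longrightarrow> (X \<boxplus> Y) \<boxplus> (Z \<boxplus> W) = (X \<boxplus> Z) \<boxplus> (Y \<boxplus> W)"
  by (simp add: add_form_def ring_facts)

lemma scale_form_add: "form X \<Longrightarrow> form Y \<Longrightarrow> c \<boxdot> (X \<boxplus> Y) = c \<boxdot> X \<boxplus> c \<boxdot> Y"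
  by (simp add: add_form_def scale_form_def smult_add_right)

lemma sos_add: "sos Y \<Longrightarrow> sos X \<Longrightarrow> sos (X \<boxplus> Y)"
proof (induction rule: sos.induct)
  case sos_zero
  then show ?case by (simp add: add_form_zero sos_form)
next
  case (sos_add_sq Y r)
  then show ?case
    using add_form_assoc[of X Y "sq r"] sos.sos_add_sq[of "X \<boxplus> Y" r] by (simp add: sos_form)
qed

lemma sos_sq: "(\<And>k. r k \<in> carrier A) \<Longrightarrow> sos (sq r)"
  using sos_add_sq[OF sos_zero, of r] add_form_zero[OF form_sq[of r]]
    add_form_commute[OF form_sq[of r] sos_form[OF sos_zero]] by metis

lemma scale_sq:
  "(\<And>k. r k \<in> carrier A) \<Longrightarrow> 0 \<le> c \<Longrightarrow> c \<boxdot> sq r = sq (\<lambda>k. complex_of_real (sqrt c) \<odot> r k)"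
  by (simp add: scale_form_def sq_def adj_smult smult_mult_left smult_mult_right smult_smult ring_facts(5)
      flip: of_real_mult)

lemma sos_scale: "sos X \<Longrightarrow> 0 \<le> c \<Longrightarrow> sos (c \<boxdot> X)"
proof (induction rule: sos.induct)
  case sos_zero
  then show ?case using sos.sos_zero by (simp add: scale_form_def)
next
  case (sos_add_sq X r)
  then show ?case
    using sos.sos_add_sq[of "c \<boxdot> X" "\<lambda>k. complex_of_real (sqrt c) \<odot> r k"]
    by (simp add: scale_form_add sos_form scale_sq)
qed

lemma sos_leI: "form X \<Longrightarrow> sos S \<Longrightarrow> Y = X \<boxplus> S \<Longrightarrow> X \<preceq> Y"
  by (auto simp: sos_le_def)

lemma sos_le_form: "X \<preceq> Y \<Longrightarrow> form X" "X \<preceq> Y \<Longrightarrow> form Y"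
  by (auto simp: sos_le_def sos_form)

lemma sos_le_refl: "form X \<Longrightarrow> X \<preceq> X"
  using sos_leI[OF _ sos_zero, of X X] by (simp add: add_form_zero)

lemma sos_leE:
  assumes "X \<preceq> Y"
  obtains S where "form X" "sos S" "form S" "Y = X \<boxplus> S"
  using assms sos_form unfolding sos_le_def by blast

lemma sos_le_trans [trans]:
  assumes "X \<preceq> Y" "Y \<preceq> Z"
  shows "X \<preceq> Z"
proof -
  obtain S T where "form X" "sos S" "form S" "Y = X \<boxplus> S" "sos T" "form T" "Z = Y \<boxplus> T"
    using assms by (meson sos_leE)
  then show ?thesis
    using sos_leI[of X "S \<boxplus> T"] by (simp add: add_form_assoc sos_add)
qed

lemma sos_le_add:
  assumes "X \<preceq> Y" "X' \<preceq> Y'"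
  shows "X \<boxplus> X' \<preceq> Y \<boxplus> Y'"
proof -
  obtain S S' where "form X" "form X'" "sos S" "form S" "Y = X \<boxplus> S"
      "sos S'" "form S'" "Y' = X' \<boxplus> S'"
    using assms by (meson sos_leE)
  then show ?thesis
    using sos_leI[of "X \<boxplus> X'" "S \<boxplus> S'"] by (simp add: add_form_interchange sos_add)
qed

lemma sos_le_scale:
  assumes "X \<preceq> Y" "0 \<le> c"
  shows "c \<boxdot> X \<preceq> c \<boxdot> Y"
proof -
  obtain S where "form X" "sos S" "form S" "Y = X \<boxplus> S"
    using assms by (meson sos_leE)
  then show ?thesis
    using sos_leI[of "c \<boxdot> X" "c \<boxdot> S"] assms(2) by (simp add: scale_form_add sos_scale)
qed

text \<open>The parallelogram identity: the remainder is the square of the row r - s. The factors 2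
  in the penalty originate here.\<close>

lemma sq_add_le:
  assumes r: "\<And>k. r k \<in> carrier A" and s: "\<And>k. s k \<in> carrier A"
  shows "sq (\<lambda>k. r k \<oplus> s k) \<preceq> 2 \<boxdot> sq r \<boxplus> 2 \<boxdot> sq s"
proof (rule sos_leI)
  show "sos (sq (\<lambda>k. r k \<ominus> s k))" by (rule sos_sq) (simp add: r s ring_facts)
  have two: "2 \<odot> x = x \<oplus> x" if "x \<in> carrier A" for x
    using smult_add_left[OF that, of 1 1] that by simp
  show "2 \<boxdot> sq r \<boxplus> 2 \<boxdot> sq s = sq (\<lambda>k. r k \<oplus> s k) \<boxplus> sq (\<lambda>k. r k \<ominus> s k)"
  proof (intro ext)
    fix k l
    \<comment> \<open>\<open>?W\<close> collects the diagonal terms and \<open>?Z\<close> the cross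
      terms, which change sign between the two squares and cancel in their sum.\<close>
    let ?W = "sq r k l \<oplus> sq s k l" and ?Z = "adj A (r k) \<otimes> s l \<oplus> adj A (s k) \<otimes> r l"
    have c: "?W \<in> carrier A" "?Z \<in> carrier A" using r s by (auto simp: sq_def ring_facts)
    have "sq (\<lambda>k. r k \<oplus> s k) k l = ?W \<oplus> ?Z"
      by (simp add: sq_def r s ring_facts adj_add)
    moreover have "sq (\<lambda>k. r k \<ominus> s k) k l = ?W \<ominus> ?Z"
      by (simp add: sq_def r s ring_facts adj_add adj_uminus)
    ultimately have "sq (\<lambda>k. r k \<oplus> s k) k l \<oplus> sq (\<lambda>k. r k \<ominus> s k) k l = ?W \<oplus> (?Z \<oplus> (?W \<ominus> ?Z))"
      using c ring_facts(7)[of ?W ?Z "?W \<ominus> ?Z"] ring_facts(4)[of ?W ?Z] by simp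
    also have "\<dots> = ?W \<oplus> ?W" by (simp only: add_diff_cancel c)
    finally show "(2 \<boxdot> sq r \<boxplus> 2 \<boxdot> sq s) k l = (sq (\<lambda>k. r k \<oplus> s k) \<boxplus> sq (\<lambda>k. r k \<ominus> s k)) k l"
      by (simp add: add_form_def scale_form_def sq_def two r s ring_facts)
  qed
qed (use r s in \<open>simp add: ring_facts\<close>)

text \<open>Insert c 1 = b^* b + y^* y between the adjoint of r_k and r_l; the remainder is the
  square of the row y r.\<close>

lemma sq_mult_le:
  assumes b: "b \<in> carrier A" and y: "y \<in> carrier A"
    and eq: "complex_of_real c \<odot> \<one> = adj A b \<otimes> b \<oplus> adj A y \<otimes> y"
    and r: "\<And>k. r k \<in> carrier A"
  shows "sq (\<lambda>k. b \<otimes> r k) \<preceq> c \<boxdot> sq r"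
proof (rule sos_leI)
  show "sos (sq (\<lambda>k. y \<otimes> r k))" by (rule sos_sq) (simp add: r y ring_facts)
  have "complex_of_real c \<odot> (adj A (r k) \<otimes> r l) = adj A (r k) \<otimes> ((complex_of_real c \<odot> \<one>) \<otimes> r l)" for k l
    by (simp add: r smult_mult_left smult_mult_right ring_facts)
  then show "c \<boxdot> sq r = sq (\<lambda>k. b \<otimes> r k) \<boxplus> sq (\<lambda>k. y \<otimes> r k)"
    unfolding eq
    by (intro ext) (simp add: add_form_def scale_form_def sq_def r b y ring_facts adj_mult)
qed (use b r in \<open>simp add: ring_facts\<close>)

text \<open>The squares are stacked as the rows of a matrix R with m rows, and X = R^* R.\<close>

lemma sos_rows:
  assumes "sos X"
  shows "\<exists>m r. (\<forall>i k. r i k \<in> carrier A) \<and>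
     (\<forall>k l. X k l = (\<Oplus>i\<in>{..<m::nat}. adj A (r i k) \<otimes> r i l))"
  using assms
proof (induction rule: sos.induct)
  case sos_zero
  then show ?case
    by (intro exI[of _ 0] exI[of _ "\<lambda>i k. \<zero>"]) (simp add: ring_facts)
next
  case (sos_add_sq X r)
  then obtain m r' where r': "\<And>i k. r' i k \<in> carrier A"
    "\<And>k l. X k l = (\<Oplus>i\<in>{..<m::nat}. adj A (r' i k) \<otimes> r' i l)" by blast
  have "(\<Oplus>i\<in>{..<Suc m}. adj A ((r'(m := r)) i k) \<otimes> (r'(m := r)) i l)
      = adj A (r k) \<otimes> r l \<oplus> (\<Oplus>i\<in>{..<m}. adj A (r' i k) \<otimes> r' i l)" for k l
  proof -
    have "(\<Oplus>i\<in>{..<Suc m}. adj A ((r'(m := r)) i k) \<otimes> (r'(m := r)) i l)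
      = adj A (r k) \<otimes> r l \<oplus> (\<Oplus>i\<in>{..<m}. adj A ((r'(m := r)) i k) \<otimes> (r'(m := r)) i l)"
      unfolding lessThan_Suc
      by (subst abelian_monoid.finsum_insert[OF abelian_group.axioms(1)[OF abelian_group_A]])
         (auto simp: r'(1) sos_add_sq.hyps(2) ring_facts)
    also have "(\<Oplus>i\<in>{..<m}. adj A ((r'(m := r)) i k) \<otimes> (r'(m := r)) i l)
        = (\<Oplus>i\<in>{..<m}. adj A (r' i k) \<otimes> r' i l)"
      by (rule abelian_monoid.finsum_cong'[OF abelian_group.axioms(1)[OF abelian_group_A]])
         (auto simp: r'(1) ring_facts)
    finally show ?thesis .
  qed
  moreover have "(X \<boxplus> sq r) k l = adj A (r k) \<otimes> r l \<oplus> (\<Oplus>i\<in>{..<m}. adj A (r' i k) \<otimes> r' i l)" for k l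
    unfolding add_form_def sq_def r'(2)[symmetric]
    using sos_form[OF sos_add_sq.hyps(1)] sos_add_sq.hyps(2) by (intro ring_facts(10)) (auto simp: ring_facts)
  ultimately have "\<forall>k l. (X \<boxplus> sq r) k l
      = (\<Oplus>i\<in>{..<Suc m}. adj A ((r'(m := r)) i k) \<otimes> (r'(m := r)) i l)"
    by metis
  moreover have "\<forall>i k. (r'(m := r)) i k \<in> carrier A"
    by (simp add: r'(1) sos_add_sq.hyps(2))
  ultimately show ?case by blast
qed

text \<open>\<open>mat_positive\<close> asks for a square factor of the same size p, so the m rows
  are padded with zero rows; this is why p has to be at least the number of squares. The map
  \<open>e\<close> places the formal indices in the matrix.\<close>

lemma sos_mat_positive:
  assumes "sos X"
  obtains m where "\<And>p e. m \<le> p \<Longrightarrow> mat_positive A p (mat p p (\<lambda>(i, j). X (e i) (e j)))"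
proof -
  obtain m r where r: "\<And>i k. r i k \<in> carrier A"
    "\<And>k l. X k l = (\<Oplus>i\<in>{..<m::nat}. adj A (r i k) \<otimes> r i l)" using sos_rows[OF assms] by blast
  have "mat_positive A p (mat p p (\<lambda>(i, j). X (e i) (e j)))" if mp: "m \<le> p" for p and e
  proof -
    define Y where "Y = mat p p (\<lambda>(i, j). if i < m then r i (e j) else \<zero>)"
    have "Y \<in> matrices_over p (carrier A)"
      by (auto simp: Y_def matrices_over_def elements_mat_def r ring_facts)
    moreover have "mat p p (\<lambda>(i, j). X (e i) (e j))
      = mat p p (\<lambda>(i, j). \<Oplus>k\<in>{..<p}. adj A (Y $$ (k, i)) \<otimes> Y $$ (k, j))"
    proof (rule cong_mat[OF refl refl], clarify)
      fix i j assume ij: "i < p" "j < p"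
      have "(\<Oplus>k\<in>{..<p}. adj A (Y $$ (k, i)) \<otimes> Y $$ (k, j))
          = (\<Oplus>k\<in>{..<m}. adj A (r k (e i)) \<otimes> r k (e j))"
        unfolding finsum_def
        by (rule comm_monoid.finprod_mono_neutral_cong_right
              [OF abelian_monoid.a_comm_monoid[OF abelian_group.axioms(1)[OF abelian_group_A]]])
           (use mp ij r in \<open>auto simp: Y_def ring_facts\<close>)
      then show "X (e i) (e j) = (\<Oplus>k\<in>{..<p}. adj A (Y $$ (k, i)) \<otimes> Y $$ (k, j))"
        by (simp add: r(2))
    qed
    ultimately show ?thesis unfolding mat_positive_def by blast
  qed
  then show thesis using that by blast
qed

end

section \<open>Toeplitz isometries and their images\<close>

lemma toeplitz_iff:
  "X \<in> toeplitz n \<longleftrightarrow> X \<in> carrier_mat n n \<and>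
     (\<exists>t. \<forall>k<n. \<forall>l<n. X $$ (k, l) = t (int k - int l))"
  by (auto simp: toeplitz_def intro!: eq_matI)

lemma toeplitz_carrier [simp]: "X \<in> toeplitz n \<Longrightarrow> X \<in> carrier_mat n n"
  by (simp add: toeplitz_iff)

lemma toeplitz_add: "X \<in> toeplitz n \<Longrightarrow> Y \<in> toeplitz n \<Longrightarrow> X + Y \<in> toeplitz n"
  unfolding toeplitz_iff
  by (elim conjE exE, rule conjI, simp, rule_tac x = "\<lambda>i. t i + ta i" in exI) auto

lemma toeplitz_smult: "X \<in> toeplitz n \<Longrightarrow> c \<cdot>\<^sub>m X \<in> toeplitz n"
  unfolding toeplitz_iff
  by (elim conjE exE, rule conjI, simp, rule_tac x = "\<lambda>i. c * t i" in exI) auto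

lemma toeplitz_one: "1\<^sub>m n \<in> toeplitz n"
  unfolding toeplitz_iff
  by (intro conjI exI[of _ "\<lambda>i. of_bool (i = 0)"]) auto

lemma toeplitz_zero: "0\<^sub>m n n \<in> toeplitz n"
  unfolding toeplitz_iff
  by (intro conjI exI[of _ "\<lambda>i. 0"]) auto

lemma toeplitz_adjoint: "X \<in> toeplitz n \<Longrightarrow> mat_adjoint X \<in> toeplitz n"
  unfolding toeplitz_iff
  by (elim conjE exE, rule conjI, simp, rule_tac x = "\<lambda>i. cnj (t (- i))" in exI) auto

lemma mat_adjoint_one [simp]: "mat_adjoint (1\<^sub>m n) = (1\<^sub>m n :: complex mat)"
  by (rule eq_matI) auto

text \<open>Noncommutative polynomials in isometries, built by multiplying with an isometry from the
  left and by \<open>(c, p, q) \<mapsto> c p + q\<close>. The terms themselves index the variables of the quadratic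
  forms below, so that no reindexing is needed when two computations are combined.\<close>

datatype isometry_term = One | Gen "complex mat" isometry_term | Lin complex isometry_term isometry_term

primrec ev :: "('a, 'm) cstar_scheme \<Rightarrow> (complex mat \<Rightarrow> 'a) \<Rightarrow> isometry_term \<Rightarrow> 'a" where
  "ev A \<kappa> One = \<one>\<^bsub>A\<^esub>"
| "ev A \<kappa> (Gen g s) = \<kappa> g \<otimes>\<^bsub>A\<^esub> ev A \<kappa> s"
| "ev A \<kappa> (Lin c s s') = c \<odot>\<^bsub>A\<^esub> ev A \<kappa> s \<oplus>\<^bsub>A\<^esub> ev A \<kappa> s'"

text \<open>Written with \<open>\<kappa>\<close> at g and at its adjoint, not with
  \<open>adj A\<close>, so that the form over \<open>A\<close> is literally the entrywise image of
  the one with the identity in place of \<open>\<kappa>\<close>. That \<open>\<kappa>\<close>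
  respects the adjoint is a separate fact.\<close>

definition gen_defect ::
  "('a, 'm) cstar_scheme \<Rightarrow> (complex mat \<Rightarrow> 'a) \<Rightarrow> complex mat \<Rightarrow> isometry_term \<Rightarrow> isometry_term \<Rightarrow> isometry_term \<Rightarrow> isometry_term \<Rightarrow> 'a" where
  "gen_defect A \<kappa> g t s k l =
     (if k = t \<and> l = t \<or> k = s \<and> l = s then \<one>\<^bsub>A\<^esub>
      else if k = t \<and> l = s then (-1) \<odot>\<^bsub>A\<^esub> \<kappa> g
      else if k = s \<and> l = t then (-1) \<odot>\<^bsub>A\<^esub> \<kappa> (mat_adjoint g)
      else \<zero>\<^bsub>A\<^esub>)"

text \<open>The row of v_t - c v_s - v_s'. Indicators are summed and not distinguished by cases
  because s and s' may coincide.\<close>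

definition lin_row :: "complex \<Rightarrow> isometry_term \<Rightarrow> isometry_term \<Rightarrow> isometry_term \<Rightarrow> isometry_term \<Rightarrow> complex" where
  "lin_row c t s s' k = of_bool (k = t) - c * of_bool (k = s) - of_bool (k = s')"

text \<open>The total penalty of a computation. The weights 2 and |c|^2 are dictated by the
  induction in \<open>sq_defect_row_le_pencil\<close>, where each splitting of a row into two
  summands costs a factor 2. With \<open>A\<close> and \<open>\<kappa>\<close> as parameters the
  same form can be read in the abstract algebra and over M_n.\<close>

primrec pencil :: "('a, 'm) cstar_scheme \<Rightarrow> (complex mat \<Rightarrow> 'a) \<Rightarrow> isometry_term \<Rightarrow> isometry_term \<Rightarrow> isometry_term \<Rightarrow> 'a" where
  "pencil A \<kappa> One = (\<lambda>k l. \<zero>\<^bsub>A\<^esub>)"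
| "pencil A \<kappa> (Gen g s) = (\<lambda>k l.
     2 \<odot>\<^bsub>A\<^esub> gen_defect A \<kappa> g (Gen g s) s k l \<oplus>\<^bsub>A\<^esub> 2 \<odot>\<^bsub>A\<^esub> pencil A \<kappa> s k l)"
| "pencil A \<kappa> (Lin c s s') = (\<lambda>k l.
     2 \<odot>\<^bsub>A\<^esub> ((cnj (lin_row c (Lin c s s') s s' k) * lin_row c (Lin c s s') s s' l) \<odot>\<^bsub>A\<^esub> \<one>\<^bsub>A\<^esub>)
     \<oplus>\<^bsub>A\<^esub> 2 \<odot>\<^bsub>A\<^esub> (2 \<odot>\<^bsub>A\<^esub> (complex_of_real ((cmod c)\<^sup>2) \<odot>\<^bsub>A\<^esub> pencil A \<kappa> s k l)
            \<oplus>\<^bsub>A\<^esub> 2 \<odot>\<^bsub>A\<^esub> pencil A \<kappa> s' k l))"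

primrec well_formed :: "nat \<Rightarrow> isometry_term \<Rightarrow> bool" where
  "well_formed n One \<longleftrightarrow> True"
| "well_formed n (Gen g s) \<longleftrightarrow> g \<in> toeplitz n \<and> mat_adjoint g * g = 1\<^sub>m n \<and> well_formed n s"
| "well_formed n (Lin c s s') \<longleftrightarrow> well_formed n s \<and> well_formed n s'"

lemma (in cstar_algebra) finsum_lessThan_2:
  assumes "f 0 \<in> carrier A" "f 1 \<in> carrier A"
  shows "(\<Oplus>k\<in>{..<2::nat}. f k) = f 0 \<oplus> f 1"
proof -
  interpret abelian_monoid A using abelian_group_A by (rule abelian_group.axioms(1))
  have "{..<2::nat} = insert 0 {1}" by auto
  then show ?thesis using assms by (simp add: finsum_insert)
qed

lemma matrices_over_index: "X \<in> matrices_over p S \<Longrightarrow> i < p \<Longrightarrow> j < p \<Longrightarrow> X $$ (i, j) \<in> S"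
  by (auto simp: matrices_over_def)

lemma matrices_overI:
  "(\<And>i j. i < p \<Longrightarrow> j < p \<Longrightarrow> f (i, j) \<in> S) \<Longrightarrow> mat p p f \<in> matrices_over p S"
  by (auto simp: matrices_over_def dest!: elements_matD)

section \<open>Images of isometries and domination of the deviations by the penalty\<close>

locale toeplitz_injection = cstar_algebra A for A :: "('a, 'm) cstar_scheme" (structure) +
  fixes n :: nat and \<kappa> :: "complex mat \<Rightarrow> 'a"
  assumes injection: "unital_complete_order_injection (mat_cstar n) (toeplitz n) A \<kappa>"
begin

lemma kappa_closed [simp]: "x \<in> toeplitz n \<Longrightarrow> \<kappa> x \<in> carrier A"
  using injection by (auto simp: unital_complete_order_injection_def)

lemma kappa_add: "x \<in> toeplitz n \<Longrightarrow> y \<in> toeplitz n \<Longrightarrow> \<kappa> (x + y) = \<kappa> x \<oplus> \<kappa> y"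
  using injection by (auto simp: unital_complete_order_injection_def)

lemma kappa_smult: "x \<in> toeplitz n \<Longrightarrow> \<kappa> (c \<cdot>\<^sub>m x) = c \<odot> \<kappa> x"
  using injection by (auto simp: unital_complete_order_injection_def)

lemma kappa_one: "\<kappa> (1\<^sub>m n) = \<one>"
  using injection by (auto simp: unital_complete_order_injection_def)

lemma kappa_zero: "\<kappa> (0\<^sub>m n n) = \<zero>"
proof -
  have "0 \<cdot>\<^sub>m (1\<^sub>m n :: complex mat) = 0\<^sub>m n n" by auto
  then show ?thesis using kappa_smult[OF toeplitz_one, of 0] by (simp add: kappa_one ring_facts)
qed

lemma kappa_positive:
  "X \<in> matrices_over p (toeplitz n) \<Longrightarrow>
   mat_positive (mat_cstar n) p X \<longleftrightarrow> mat_positive A p (map_mat \<kappa> X)"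
  using injection by (auto simp: unital_complete_order_injection_def)

text \<open>If the positive matrix \<open>[[1, h], [h\<^sup>*, 1]]\<close> is \<open>Z\<^sup>*Z\<close> with rows \<open>(a, b)\<close> and \<open>(c, d)\<close> of \<open>Z\<close>,
  then \<open>1 - h\<^sup>*h\<close> is the sum of the squares of \<open>b - a h\<close> and \<open>d - c h\<close>.\<close>

lemma isometry_image:
  assumes g: "g \<in> toeplitz n" "mat_adjoint g * g = 1\<^sub>m n"
  shows "\<kappa> (mat_adjoint g) = adj A (\<kappa> g)"
    and "\<exists>y\<in>carrier A. \<exists>z\<in>carrier A. \<one> = adj A (\<kappa> g) \<otimes> \<kappa> g \<oplus> (adj A y \<otimes> y \<oplus> adj A z \<otimes> z)"
proof -
  interpret M: cstar_algebra "mat_cstar n" by (rule cstar_algebra_mat_cstar)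
  define X where "X = mat 2 2 (\<lambda>(i, j). if i = j then 1\<^sub>m n else if i < j then g else mat_adjoint g)"
  \<comment> \<open>The factor with rows (1, g) and (0, 0): its Gram matrix is [[1, g],
    [g^*, g^* g]], which is \<open>X\<close> because g is an isometry.\<close>
  define Y where "Y = mat 2 2 (\<lambda>(i, j). if i = 0 then if j = 0 then 1\<^sub>m n else g else 0\<^sub>m n n)"
  have gc: "g \<in> carrier_mat n n" using g by simp
  have X: "X \<in> matrices_over 2 (toeplitz n)"
    unfolding X_def using g by (intro matrices_overI) (auto simp: toeplitz_one toeplitz_adjoint)
  have "Y \<in> matrices_over 2 (carrier (mat_cstar n))"
    unfolding Y_def using gc by (intro matrices_overI) auto
  moreover have "X = mat 2 2 (\<lambda>(i, j). \<Oplus>\<^bsub>mat_cstar n\<^esub>k\<in>{..<2}.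
      adj (mat_cstar n) (Y $$ (k, i)) \<otimes>\<^bsub>mat_cstar n\<^esub> Y $$ (k, j))"
    unfolding X_def
  proof (rule cong_mat[OF refl refl], clarify)
    fix i j :: nat assume "i < 2" "j < 2"
    then have "i = 0 \<or> i = 1" "j = 0 \<or> j = 1" by auto
    then show "(if i = j then 1\<^sub>m n else if i < j then g else mat_adjoint g) =
       (\<Oplus>\<^bsub>mat_cstar n\<^esub>k\<in>{..<2}. adj (mat_cstar n) (Y $$ (k, i)) \<otimes>\<^bsub>mat_cstar n\<^esub> Y $$ (k, j))"
      using gc g(2) by (subst M.finsum_lessThan_2) (auto simp: Y_def)
  qed
  ultimately have "mat_positive (mat_cstar n) 2 X"
    unfolding mat_positive_def by blast
  then have "mat_positive A 2 (map_mat \<kappa> X)" using kappa_positive[OF X] by simp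
  then obtain Z where Z: "Z \<in> matrices_over 2 (carrier A)"
    "map_mat \<kappa> X = mat 2 2 (\<lambda>(i, j). \<Oplus>k\<in>{..<2}. adj A (Z $$ (k, i)) \<otimes> Z $$ (k, j))"
    unfolding mat_positive_def by blast
  define a b c d where abcd: "a = Z $$ (0, 0)" "b = Z $$ (0, 1)" "c = Z $$ (1, 0)" "d = Z $$ (1, 1)"
  have cl [simp]: "a \<in> carrier A" "b \<in> carrier A" "c \<in> carrier A" "d \<in> carrier A"
    using Z(1) by (auto simp: abcd intro: matrices_over_index)
  have eq: "\<kappa> (X $$ (i, j)) = adj A (Z $$ (0, i)) \<otimes> Z $$ (0, j) \<oplus> adj A (Z $$ (1, i)) \<otimes> Z $$ (1, j)"
    if "i < 2" "j < 2" for i j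
  proof -
    have zc: "Z $$ (k, l) \<in> carrier A" if "k < 2" "l < 2" for k l
      using Z(1) that by (auto intro: matrices_over_index)
    have "\<kappa> (X $$ (i, j)) = map_mat \<kappa> X $$ (i, j)"
      using that by (simp add: X_def)
    also have "\<dots> = (\<Oplus>k\<in>{..<2}. adj A (Z $$ (k, i)) \<otimes> Z $$ (k, j))"
      unfolding Z(2) using that by simp
    also have "\<dots> = adj A (Z $$ (0, i)) \<otimes> Z $$ (0, j) \<oplus> adj A (Z $$ (1, i)) \<otimes> Z $$ (1, j)"
      using that zc by (intro finsum_lessThan_2) (auto simp: ring_facts)
    finally show ?thesis .
  qed
  have e00: "\<one> = adj A a \<otimes> a \<oplus> adj A c \<otimes> c" using eq[of 0 0] by (simp add: X_def kappa_one abcd)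
  have e01: "\<kappa> g = adj A a \<otimes> b \<oplus> adj A c \<otimes> d" using eq[of 0 1] by (simp add: X_def abcd)
  have e10: "\<kappa> (mat_adjoint g) = adj A b \<otimes> a \<oplus> adj A d \<otimes> c" using eq[of 1 0] by (simp add: X_def abcd)
  have e11: "\<one> = adj A b \<otimes> b \<oplus> adj A d \<otimes> d" using eq[of 1 1] by (simp add: X_def kappa_one abcd)
  show adj: "\<kappa> (mat_adjoint g) = adj A (\<kappa> g)"
    unfolding e01 e10 by (simp add: adj_add adj_mult ring_facts)
  define h where "h = \<kappa> g"
  have h [simp]: "h \<in> carrier A" using g by (simp add: h_def)
  define y z where "y = b \<ominus> a \<otimes> h" and "z = d \<ominus> c \<otimes> h"
  have yz: "y \<in> carrier A" "z \<in> carrier A" by (auto simp: y_def z_def ring_facts)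
  \<comment> \<open>By \<open>e01\<close>, \<open>e10\<close> and \<open>e00\<close> each of these
    three products equals h^* h. They enter with signs -, - and +, so a single h^* h is subtracted
    from 1.\<close>
  let ?p = "adj A h \<otimes> (adj A a \<otimes> b \<oplus> adj A c \<otimes> d)"
  let ?q = "(adj A b \<otimes> a \<oplus> adj A d \<otimes> c) \<otimes> h"
  let ?r = "adj A h \<otimes> ((adj A a \<otimes> a \<oplus> adj A c \<otimes> c) \<otimes> h)"
  have "adj A y \<otimes> y \<oplus> adj A z \<otimes> z = (adj A b \<otimes> b \<oplus> adj A d \<otimes> d) \<ominus> ?p \<ominus> ?q \<oplus> ?r"
    by (simp add: y_def z_def adj_add adj_mult adj_uminus ring_facts)
  also have "\<dots> = \<one> \<ominus> adj A h \<otimes> h \<ominus> adj A h \<otimes> h \<oplus> adj A h \<otimes> h"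
    using e01 e10 by (simp only: e00[symmetric] e11[symmetric] h_def[symmetric] adj)
      (simp add: ring_facts)
  also have "\<dots> = \<one> \<ominus> adj A h \<otimes> h" by (simp add: ring_facts)
  finally have "adj A h \<otimes> h \<oplus> (adj A y \<otimes> y \<oplus> adj A z \<otimes> z) = \<one>"
    by (simp add: add_diff_cancel ring_facts(1-6))
  with yz show "\<exists>y\<in>carrier A. \<exists>z\<in>carrier A.
      \<one> = adj A (\<kappa> g) \<otimes> \<kappa> g \<oplus> (adj A y \<otimes> y \<oplus> adj A z \<otimes> z)"
    unfolding h_def by metis
qed

definition delta :: "isometry_term \<Rightarrow> isometry_term \<Rightarrow> 'a" where
  "delta t k = of_bool (k = t) \<odot> \<one>"

text \<open>How far the variable v_t is from the exact value of \<open>t\<close> on the input, whose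
  variable is indexed by \<open>One\<close>; \<open>delta t\<close> is the row that reads off
  v_t.\<close>

definition defect_row :: "isometry_term \<Rightarrow> isometry_term \<Rightarrow> 'a" where
  "defect_row t k = delta t k \<ominus> ev A \<kappa> t \<otimes> delta One k"

lemma delta_closed [simp]: "delta t k \<in> carrier A"
  by (simp add: delta_def ring_facts)

lemma ev_closed [simp]: "well_formed n t \<Longrightarrow> ev A \<kappa> t \<in> carrier A"
  by (induction t) (auto simp: ring_facts)

lemma defect_row_closed [simp]: "well_formed n t \<Longrightarrow> defect_row t k \<in> carrier A"
  by (simp add: defect_row_def ring_facts)

text \<open>The same insertion as in \<open>sq_mult_le\<close>, now of 1 = h^* h + y^* y + z^* z
  with h = \<open>\<kappa> g\<close>; the remainder consists of two squares.\<close>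

lemma sq_isometry_le:
  assumes g: "g \<in> toeplitz n" "mat_adjoint g * g = 1\<^sub>m n" and r: "\<And>k. r k \<in> carrier A"
  shows "sq (\<lambda>k. \<kappa> g \<otimes> r k) \<preceq> sq r"
proof -
  obtain y z where yz: "y \<in> carrier A" "z \<in> carrier A"
    "\<one> = adj A (\<kappa> g) \<otimes> \<kappa> g \<oplus> (adj A y \<otimes> y \<oplus> adj A z \<otimes> z)"
    using isometry_image(2)[OF g] by blast
  have "adj A (r k) \<otimes> r l = adj A (r k) \<otimes> (\<one> \<otimes> r l)" for k l using r by (simp add: ring_facts)
  then have "sq r = sq (\<lambda>k. \<kappa> g \<otimes> r k) \<boxplus> (sq (\<lambda>k. y \<otimes> r k) \<boxplus> sq (\<lambda>k. z \<otimes> r k))"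
    unfolding yz(3) using r yz(1,2) g
    by (intro ext) (simp add: sq_def add_form_def adj_mult ring_facts)
  moreover have "sos (sq (\<lambda>k. y \<otimes> r k) \<boxplus> sq (\<lambda>k. z \<otimes> r k))"
    using r yz(1,2) by (intro sos_add sos_sq) (auto simp: ring_facts)
  ultimately show ?thesis
    using r g by (intro sos_leI) (auto simp: ring_facts)
qed

text \<open>With h = \<open>\<kappa> g\<close>, subtracting |v_t - h v_s|^2 from the defect leaves
  |v_s|^2 - |h v_s|^2 = |y v_s|^2 + |z v_s|^2. The condition t \<noteq> s keeps the four nonzero
  entries of the defect in different places.\<close>

lemma gen_defect_ge:
  assumes g: "g \<in> toeplitz n" "mat_adjoint g * g = 1\<^sub>m n" and ts: "t \<noteq> s"
  shows "sq (\<lambda>k. delta t k \<ominus> \<kappa> g \<otimes> delta s k) \<preceq> gen_defect A \<kappa> g t s"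
proof -
  obtain y z where yz: "y \<in> carrier A" "z \<in> carrier A"
    "\<one> = adj A (\<kappa> g) \<otimes> \<kappa> g \<oplus> (adj A y \<otimes> y \<oplus> adj A z \<otimes> z)"
    using isometry_image(2)[OF g] by blast
  have gc: "\<kappa> g \<in> carrier A" using g by simp
  have "gen_defect A \<kappa> g t s k l = (sq (\<lambda>k. delta t k \<ominus> \<kappa> g \<otimes> delta s k)
      \<boxplus> (sq (\<lambda>k. y \<otimes> delta s k) \<boxplus> sq (\<lambda>k. z \<otimes> delta s k))) k l" for k l
    using ts yz(1,2) gc yz(3)[symmetric]
    by (cases "k = t"; cases "l = t"; cases "k = s"; cases "l = s")
       (simp_all add: gen_defect_def isometry_image(1)[OF g] sq_def add_form_def delta_def adj_mult
         adj_uminus uminus_smult a_minus_def ring_facts(1-3) ring_facts(5-13) ring_facts(15-27))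
  then have "gen_defect A \<kappa> g t s = sq (\<lambda>k. delta t k \<ominus> \<kappa> g \<otimes> delta s k)
      \<boxplus> (sq (\<lambda>k. y \<otimes> delta s k) \<boxplus> sq (\<lambda>k. z \<otimes> delta s k))"
    by blast
  moreover have "sos (sq (\<lambda>k. y \<otimes> delta s k) \<boxplus> sq (\<lambda>k. z \<otimes> delta s k))"
    using yz(1,2) by (intro sos_add sos_sq) (auto simp: ring_facts)
  ultimately show ?thesis
    using gc by (intro sos_leI) (auto simp: ring_facts)
qed

lemma sq_scale_row:
  "(\<And>k. r k \<in> carrier A) \<Longrightarrow> sq (\<lambda>k. c \<odot> r k) = (cmod c)\<^sup>2 \<boxdot> sq r"
  by (simp add: sq_def scale_form_def adj_smult smult_mult_left smult_mult_right smult_smult ring_facts(5)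
      complex_norm_square mult.commute del: of_real_power)

lemma pencil_Gen:
  "pencil A \<kappa> (Gen g s) = 2 \<boxdot> gen_defect A \<kappa> g (Gen g s) s \<boxplus> 2 \<boxdot> pencil A \<kappa> s"
  by (simp add: scale_form_def add_form_def)

lemma pencil_Lin:
  "pencil A \<kappa> (Lin c s s') = 2 \<boxdot> sq (\<lambda>k. lin_row c (Lin c s s') s s' k \<odot> \<one>)
     \<boxplus> 2 \<boxdot> (2 \<boxdot> ((cmod c)\<^sup>2 \<boxdot> pencil A \<kappa> s) \<boxplus> 2 \<boxdot> pencil A \<kappa> s')"
  by (simp add: scale_form_def add_form_def sq_def adj_smult smult_mult_left smult_mult_right
      smult_smult ring_facts(5,6,12) mult.commute)

text \<open>Errors telescope: the deviation at a term is the error of its last step plus what that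
  step makes of the deviations of the subterms. Splitting the two parts costs a factor 2; a
  contraction does not enlarge the propagated square, and a scalar c enlarges it by |c|^2.\<close>

lemma sq_defect_row_le_pencil: "well_formed n t \<Longrightarrow> sq (defect_row t) \<preceq> pencil A \<kappa> t"
proof (induction t)
  case One
  have "defect_row One = (\<lambda>k. \<zero>)"
    by (rule ext) (simp add: defect_row_def ring_facts)
  then have "sq (defect_row One) = pencil A \<kappa> One" by (simp add: sq_def ring_facts)
  moreover have "form (sq (defect_row One))" by (rule form_sq) (simp add: ring_facts)
  ultimately show ?case using sos_le_refl by metis
next
  case (Gen g s)
  then have g: "g \<in> toeplitz n" "mat_adjoint g * g = 1\<^sub>m n" and s: "well_formed n s" by auto
  have gc: "\<kappa> g \<in> carrier A" using g by simp
  let ?t = "Gen g s"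
  have "defect_row ?t = (\<lambda>k. (delta ?t k \<ominus> \<kappa> g \<otimes> delta s k) \<oplus> \<kappa> g \<otimes> defect_row s k)"
  proof
    fix k
    have "\<kappa> g \<otimes> defect_row s k = \<kappa> g \<otimes> delta s k \<ominus> (\<kappa> g \<otimes> ev A \<kappa> s) \<otimes> delta One k"
      using gc s by (simp add: defect_row_def ring_facts)
    then show "defect_row ?t k = (delta ?t k \<ominus> \<kappa> g \<otimes> delta s k) \<oplus> \<kappa> g \<otimes> defect_row s k"
      using gc s by (simp add: defect_row_def[of ?t] diff_add_diff ring_facts(5))
  qed
  then have "sq (defect_row ?t) \<preceq> 2 \<boxdot> sq (\<lambda>k. delta ?t k \<ominus> \<kappa> g \<otimes> delta s k)
      \<boxplus> 2 \<boxdot> sq (\<lambda>k. \<kappa> g \<otimes> defect_row s k)"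
    using sq_add_le[of "\<lambda>k. delta ?t k \<ominus> \<kappa> g \<otimes> delta s k" "\<lambda>k. \<kappa> g \<otimes> defect_row s k"] gc s
    by (simp add: ring_facts(4,5))
  also have "\<dots> \<preceq> 2 \<boxdot> gen_defect A \<kappa> g ?t s \<boxplus> 2 \<boxdot> pencil A \<kappa> s"
    using sos_le_trans[OF sq_isometry_le[OF g, of "defect_row s"] Gen.IH[OF s]] s
    by (intro sos_le_add sos_le_scale gen_defect_ge[OF g]) auto
  finally show ?case by (simp only: pencil_Gen)
next
  case (Lin c s s')
  then have s: "well_formed n s" "well_formed n s'" by auto
  let ?t = "Lin c s s'"
  \<comment> \<open>\<open>?d\<close> is the row of c v_s + v_s', and \<open>?w\<close> is the same
    combination of the earlier deviations. The local error v_t - ?d is the row that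
    \<open>pencil\<close> penalises.\<close>
  let ?d = "\<lambda>k. c \<odot> delta s k \<oplus> delta s' k"
  let ?w = "\<lambda>k. c \<odot> defect_row s k \<oplus> defect_row s' k"
  have w: "?w k = ?d k \<ominus> ev A \<kappa> ?t \<otimes> delta One k" for k
    using s by (simp add: defect_row_def smult_add_right smult_uminus smult_mult_left ring_facts)
  have lin: "(\<lambda>k. lin_row c ?t s s' k \<odot> \<one>) = (\<lambda>k. delta ?t k \<ominus> ?d k)"
  proof
    fix k
    have "lin_row c ?t s s' k = of_bool (k = ?t) + - (c * of_bool (k = s) + of_bool (k = s'))"
      by (simp add: lin_row_def)
    then show "lin_row c ?t s s' k \<odot> \<one> = delta ?t k \<ominus> ?d k"
      by (simp only: smult_add_left uminus_smult delta_def ring_facts(6) smult_smult ring_facts(14))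
  qed
  have "defect_row ?t = (\<lambda>k. (delta ?t k \<ominus> ?d k) \<oplus> ?w k)"
    unfolding w using s by (intro ext) (simp add: defect_row_def[of ?t] diff_add_diff ring_facts(1,5))
  then have "sq (defect_row ?t) \<preceq> 2 \<boxdot> sq (\<lambda>k. delta ?t k \<ominus> ?d k) \<boxplus> 2 \<boxdot> sq ?w"
    using sq_add_le[of "\<lambda>k. delta ?t k \<ominus> ?d k" ?w] s by (simp add: ring_facts(1,4,5))
  also have "\<dots> \<preceq> 2 \<boxdot> sq (\<lambda>k. lin_row c ?t s s' k \<odot> \<one>)
     \<boxplus> 2 \<boxdot> (2 \<boxdot> ((cmod c)\<^sup>2 \<boxdot> pencil A \<kappa> s) \<boxplus> 2 \<boxdot> pencil A \<kappa> s')"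
    unfolding lin
  proof (intro sos_le_add sos_le_scale)
    show "sq (\<lambda>k. delta ?t k \<ominus> ?d k) \<preceq> sq (\<lambda>k. delta ?t k \<ominus> ?d k)"
      by (intro sos_le_refl form_sq) (simp add: ring_facts(1,4))
    have "sq ?w \<preceq> 2 \<boxdot> sq (\<lambda>k. c \<odot> defect_row s k) \<boxplus> 2 \<boxdot> sq (defect_row s')"
      using sq_add_le[of "\<lambda>k. c \<odot> defect_row s k" "defect_row s'"] s by simp
    also have "\<dots> \<preceq> 2 \<boxdot> ((cmod c)\<^sup>2 \<boxdot> pencil A \<kappa> s) \<boxplus> 2 \<boxdot> pencil A \<kappa> s'"
      using Lin.IH s by (subst sq_scale_row) (auto intro!: sos_le_add sos_le_scale)
    finally show "sq ?w \<preceq> 2 \<boxdot> ((cmod c)\<^sup>2 \<boxdot> pencil A \<kappa> s) \<boxplus> 2 \<boxdot> pencil A \<kappa> s'" .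
  qed auto
  finally show ?case by (simp only: pencil_Lin)
qed

end

section \<open>The norm estimate\<close>

lemma cscalar_add_mult_mat_vec:
  fixes S T :: "complex mat"
  assumes "S \<in> carrier_mat n n" "T \<in> carrier_mat n n" "v \<in> carrier_vec n" "w \<in> carrier_vec n"
  shows "((S + T) *\<^sub>v v) \<bullet>c w = (S *\<^sub>v v) \<bullet>c w + (T *\<^sub>v v) \<bullet>c w"
  unfolding add_mult_distrib_mat_vec[OF assms(1-3)]
  by (rule add_scalar_prod_distrib[where n = n]) (use assms in auto)

lemma sum_rotate:
  "(\<Sum>i\<in>A. \<Sum>j\<in>B. \<Sum>k\<in>C. f i j k) = (\<Sum>k\<in>C. \<Sum>i\<in>A. \<Sum>j\<in>B. f i j k)"
proof -
  have "(\<Sum>i\<in>A. \<Sum>j\<in>B. \<Sum>k\<in>C. f i j k) = (\<Sum>i\<in>A. \<Sum>k\<in>C. \<Sum>j\<in>B. f i j k)"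
    by (intro sum.cong refl sum.swap)
  also have "\<dots> = (\<Sum>k\<in>C. \<Sum>i\<in>A. \<Sum>j\<in>B. f i j k)" by (rule sum.swap)
  finally show ?thesis .
qed

lemma smult_mult_mat_vec:
  "M \<in> carrier_mat m n \<Longrightarrow> v \<in> carrier_vec n \<Longrightarrow> (c \<cdot>\<^sub>m M) *\<^sub>v v = c \<cdot>\<^sub>v (M *\<^sub>v (v :: complex vec))"
  by auto

lemma finsum_mat_apply:
  assumes "finite K" "\<And>k. k \<in> K \<Longrightarrow> f k \<in> carrier_mat n n"
    and v: "v \<in> carrier_vec n" and w: "w \<in> carrier_vec n"
  shows "(finsum (mat_cstar n) f K *\<^sub>v v) \<bullet>c w = (\<Sum>k\<in>K. (f k *\<^sub>v v) \<bullet>c w)"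
proof -
  interpret abelian_monoid "mat_cstar n"
    using abelian_group_mat_cstar by (rule abelian_group.axioms(1))
  show ?thesis
    using assms(1,2)
  proof (induction K rule: finite_induct)
    case empty
    have "0\<^sub>m n n *\<^sub>v v = 0\<^sub>v n" using v by auto
    then show ?case using v w by simp
  next
    case (insert k K)
    have fk: "f k \<in> carrier_mat n n" using insert by simp
    have fK: "finsum (mat_cstar n) f K \<in> carrier_mat n n"
      using finsum_closed[of f K] insert.prems by auto
    have "finsum (mat_cstar n) f (insert k K) = f k + finsum (mat_cstar n) f K"
      using finsum_insert[of K k f] insert by auto
    then show ?case
      using insert v w fk fK
      by (simp add: cscalar_add_mult_mat_vec[of _ n])
  qed
qed

text \<open>For X = Y^* Y the form is the sum over k of |sum_j Y_kj \<eta>_j|^2. The inner sum is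
  taken coordinate by coordinate, so that no sum of vectors has to be formed.\<close>

lemma mat_positive_quadratic_form:
  assumes X: "mat_positive (mat_cstar n) p X" and \<eta>: "\<And>i. i < p \<Longrightarrow> \<eta> i \<in> carrier_vec n"
  shows "0 \<le> Re (\<Sum>i<p. \<Sum>j<p. (X $$ (i, j) *\<^sub>v \<eta> j) \<bullet>c \<eta> i)"
proof -
  obtain Y where Y: "Y \<in> matrices_over p (carrier_mat n n)"
    "X = mat p p (\<lambda>(i, j). \<Oplus>\<^bsub>mat_cstar n\<^esub>k\<in>{..<p}. mat_adjoint (Y $$ (k, i)) * Y $$ (k, j))"
    using X by (auto simp: mat_positive_def)
  have Yc: "Y $$ (i, j) \<in> carrier_mat n n" if "i < p" "j < p" for i j
    using Y(1) that by (rule matrices_over_index)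
  define u where "u k j = Y $$ (k, j) *\<^sub>v \<eta> j" for k j
  have u: "u k j \<in> carrier_vec n" if "k < p" "j < p" for k j
    using Yc[OF that] \<eta>[OF that(2)] by (auto simp: u_def)
  have "(\<Sum>i<p. \<Sum>j<p. (X $$ (i, j) *\<^sub>v \<eta> j) \<bullet>c \<eta> i) = (\<Sum>i<p. \<Sum>j<p. \<Sum>k<p. u k j \<bullet>c u k i)"
  proof (intro sum.cong refl)
    fix i j assume i: "i \<in> {..<p}" and j: "j \<in> {..<p}"
    have "(X $$ (i, j) *\<^sub>v \<eta> j) \<bullet>c \<eta> i
        = (\<Sum>k<p. ((mat_adjoint (Y $$ (k, i)) * Y $$ (k, j)) *\<^sub>v \<eta> j) \<bullet>c \<eta> i)"
    proof -
      have "mat_adjoint (Y $$ (k, i)) * Y $$ (k, j) \<in> carrier_mat n n" if "k \<in> {..<p}" for k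
        by (rule mult_carrier_mat[of _ n n _ n]) (use Yc i j that in auto)
      then show ?thesis
        unfolding Y(2) using i j \<eta>
          finsum_mat_apply[of "{..<p}" "\<lambda>k. mat_adjoint (Y $$ (k, i)) * Y $$ (k, j)" n "\<eta> j" "\<eta> i"]
        by simp
    qed
    also have "\<dots> = (\<Sum>k<p. u k j \<bullet>c u k i)"
    proof (intro sum.cong refl)
      fix k assume k: "k \<in> {..<p}"
      have Yi: "Y $$ (k, i) \<in> carrier_mat n n" and Yj: "Y $$ (k, j) \<in> carrier_mat n n"
        using Yc i j k by auto
      have "(mat_adjoint (Y $$ (k, i)) * Y $$ (k, j)) *\<^sub>v \<eta> j = mat_adjoint (Y $$ (k, i)) *\<^sub>v u k j"
        unfolding u_def by (rule assoc_mult_mat_vec) (use Yi Yj \<eta> j in auto)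
      then show "((mat_adjoint (Y $$ (k, i)) * Y $$ (k, j)) *\<^sub>v \<eta> j) \<bullet>c \<eta> i = u k j \<bullet>c u k i"
        using cscalar_mult_mat_vec[of "mat_adjoint (Y $$ (k, i))" n n "u k j" "\<eta> i"] Yi u \<eta> i j k
        by (simp add: u_def[of k i])
    qed
    finally show "(X $$ (i, j) *\<^sub>v \<eta> j) \<bullet>c \<eta> i = (\<Sum>k<p. u k j \<bullet>c u k i)" .
  qed
  also have "\<dots> = (\<Sum>i<p. \<Sum>j<p. \<Sum>k<p. \<Sum>m<n. u k j $ m * cnj (u k i $ m))"
    using u by (intro sum.cong refl) (auto simp: scalar_prod_def atLeast0LessThan carrier_vecD[OF u])
  also have "\<dots> = (\<Sum>k<p. \<Sum>m<n. \<Sum>i<p. \<Sum>j<p. u k j $ m * cnj (u k i $ m))"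
    by (subst sum_rotate, subst sum_rotate) (rule refl)
  also have "\<dots> = (\<Sum>k<p. \<Sum>m<n. complex_of_real ((cmod (\<Sum>j<p. u k j $ m))\<^sup>2))"
    unfolding complex_norm_square cnj_sum sum_product
    by (rule sum.cong[OF refl], rule sum.cong[OF refl], rule sum.swap)
  finally show ?thesis by (simp add: sum_nonneg del: of_real_power)
qed

section \<open>The penalty along an actual computation\<close>

primrec subterms :: "isometry_term \<Rightarrow> isometry_term set" where
  "subterms One = {One}"
| "subterms (Gen g s) = insert (Gen g s) (subterms s)"
| "subterms (Lin c s s') = insert (Lin c s s') (subterms s \<union> subterms s')"

lemma finite_subterms [simp]: "finite (subterms t)"
  by (induction t) auto

lemma self_in_subterms [simp]: "t \<in> subterms t"
  by (cases t) auto

lemma One_in_subterms [simp]: "One \<in> subterms t"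
  by (induction t) auto

text \<open>A supply of further indices: the index set, which consists of terms, has to be at least
  as large as the number of squares.\<close>

lemma infinite_isometry_term: "infinite (UNIV :: isometry_term set)"
proof
  assume "finite (UNIV :: isometry_term set)"
  then have "finite (range (\<lambda>c. Lin c One One))" by (rule rev_finite_subset) simp
  then have "finite (UNIV :: complex set)" by (rule finite_imageD) (simp add: inj_on_def)
  then show False using infinite_UNIV_char_0 by blast
qed

abbreviation evT :: "nat \<Rightarrow> isometry_term \<Rightarrow> complex mat" where
  "evT n \<equiv> ev (mat_cstar n) (\<lambda>x. x)"

abbreviation pencilT :: "nat \<Rightarrow> isometry_term \<Rightarrow> isometry_term \<Rightarrow> isometry_term \<Rightarrow> complex mat" where
  "pencilT n \<equiv> pencil (mat_cstar n) (\<lambda>x. x)"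

lemma evT_carrier [simp]: "well_formed n t \<Longrightarrow> evT n t \<in> carrier_mat n n"
  by (induction t) (simp_all add: mult_carrier_mat[of _ n n _ n])

lemma gen_defectT_toeplitz: "g \<in> toeplitz n \<Longrightarrow> gen_defect (mat_cstar n) (\<lambda>x. x) g t s k l \<in> toeplitz n"
  by (auto simp: gen_defect_def toeplitz_one toeplitz_zero toeplitz_smult toeplitz_adjoint)

text \<open>Isometries enter only through linear operations and adjoints, never through products.
  This is the purpose of the extra variables: every coefficient lies in the domain of
  \<open>\<kappa>\<close>.\<close>

lemma pencilT_toeplitz: "well_formed n t \<Longrightarrow> pencilT n t k l \<in> toeplitz n"
  by (induction t arbitrary: k l)
     (simp_all add: toeplitz_add toeplitz_smult gen_defectT_toeplitz toeplitz_one toeplitz_zero)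

context toeplitz_injection
begin

lemma kappa_gen_defect:
  "g \<in> toeplitz n \<Longrightarrow> \<kappa> (gen_defect (mat_cstar n) (\<lambda>x. x) g t s k l) = gen_defect A \<kappa> g t s k l"
  by (auto simp: gen_defect_def kappa_one kappa_zero kappa_smult toeplitz_adjoint)

lemma kappa_pencil: "well_formed n t \<Longrightarrow> \<kappa> (pencilT n t k l) = pencil A \<kappa> t k l"
  by (induction t arbitrary: k l)
     (simp_all add: kappa_add kappa_smult kappa_zero kappa_one kappa_gen_defect toeplitz_add
       toeplitz_smult toeplitz_one gen_defectT_toeplitz pencilT_toeplitz)

end

definition quad :: "isometry_term set \<Rightarrow> (isometry_term \<Rightarrow> complex vec) \<Rightarrow> (isometry_term \<Rightarrow> isometry_term \<Rightarrow> complex mat) \<Rightarrow> complex" where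
  "quad I \<eta> X = (\<Sum>k\<in>I. \<Sum>l\<in>I. (X k l *\<^sub>v \<eta> l) \<bullet>c \<eta> k)"

lemma quad_add:
  assumes "\<And>k l. X k l \<in> carrier_mat n n" "\<And>k l. Y k l \<in> carrier_mat n n"
    "\<And>k. k \<in> I \<Longrightarrow> \<eta> k \<in> carrier_vec n"
  shows "quad I \<eta> (\<lambda>k l. X k l + Y k l) = quad I \<eta> X + quad I \<eta> Y"
  unfolding quad_def sum.distrib[symmetric]
  using assms by (intro sum.cong refl)
    (simp add: cscalar_add_mult_mat_vec[of _ n])

lemma quad_smult:
  assumes "\<And>k l. X k l \<in> carrier_mat n n" "\<And>k. k \<in> I \<Longrightarrow> \<eta> k \<in> carrier_vec n"
  shows "quad I \<eta> (\<lambda>k l. c \<cdot>\<^sub>m X k l) = c * quad I \<eta> X"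
proof -
  have "((c \<cdot>\<^sub>m X k l) *\<^sub>v \<eta> l) \<bullet>c \<eta> k = c * ((X k l *\<^sub>v \<eta> l) \<bullet>c \<eta> k)" if "k \<in> I" "l \<in> I" for k l
  proof -
    have "(c \<cdot>\<^sub>m X k l) *\<^sub>v \<eta> l = c \<cdot>\<^sub>v (X k l *\<^sub>v \<eta> l)"
      using assms(1)[of k l] assms(2)[OF that(2)] by auto
    then show ?thesis using assms(1)[of k l] assms(2)[OF that(1)] by simp
  qed
  then show ?thesis by (simp add: quad_def sum_distrib_left)
qed

text \<open>The coefficients are of rank one. For fixed k the sum over l is a multiple of the inner
  product of \<eta>_t - c \<eta>_s - \<eta>_s' = 0 with \<eta>_k.\<close>

lemma quad_lin_zero:
  assumes I: "finite I" "t \<in> I" "s \<in> I" "s' \<in> I"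
    and \<eta>: "\<And>k. k \<in> I \<Longrightarrow> \<eta> k \<in> carrier_vec n" and eq: "\<eta> t = c \<cdot>\<^sub>v \<eta> s + \<eta> s'"
  shows "quad I \<eta> (\<lambda>k l. (cnj (lin_row c t s s' k) * lin_row c t s s' l) \<cdot>\<^sub>m 1\<^sub>m n) = 0"
  unfolding quad_def
proof (rule sum.neutral, rule ballI)
  fix k assume k: "k \<in> I"
  let ?\<rho> = "lin_row c t s s'"
  have "((cnj (?\<rho> k) * ?\<rho> l) \<cdot>\<^sub>m 1\<^sub>m n *\<^sub>v \<eta> l) \<bullet>c \<eta> k = cnj (?\<rho> k) * (?\<rho> l * (\<eta> l \<bullet>c \<eta> k))"
    if "l \<in> I" for l
  proof -
    have "(cnj (?\<rho> k) * ?\<rho> l) \<cdot>\<^sub>m 1\<^sub>m n *\<^sub>v \<eta> l = (cnj (?\<rho> k) * ?\<rho> l) \<cdot>\<^sub>v \<eta> l"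
      using \<eta>[OF that] by auto
    then show ?thesis using \<eta>[OF that] \<eta>[OF k] by simp
  qed
  then have "(\<Sum>l\<in>I. ((cnj (?\<rho> k) * ?\<rho> l) \<cdot>\<^sub>m 1\<^sub>m n *\<^sub>v \<eta> l) \<bullet>c \<eta> k)
      = cnj (?\<rho> k) * (\<Sum>l\<in>I. ?\<rho> l * (\<eta> l \<bullet>c \<eta> k))"
    by (simp add: sum_distrib_left)
  also have "(\<Sum>l\<in>I. ?\<rho> l * (\<eta> l \<bullet>c \<eta> k))
      = (\<Sum>l\<in>I. (if l = t then \<eta> l \<bullet>c \<eta> k else 0) - (if l = s then c * (\<eta> l \<bullet>c \<eta> k) else 0)
          - (if l = s' then \<eta> l \<bullet>c \<eta> k else 0))"
    by (intro sum.cong refl) (simp add: lin_row_def left_diff_distrib)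
  also have "\<dots> = \<eta> t \<bullet>c \<eta> k - c * (\<eta> s \<bullet>c \<eta> k) - \<eta> s' \<bullet>c \<eta> k"
    using I by (simp add: sum_subtractf)
  also have "\<dots> = 0"
    unfolding eq using \<eta>[OF k] \<eta>[OF I(3)] \<eta>[OF I(4)]
    by (subst add_scalar_prod_distrib[where n = n]) auto
  finally show "(\<Sum>l\<in>I. ((cnj (?\<rho> k) * ?\<rho> l) \<cdot>\<^sub>m 1\<^sub>m n *\<^sub>v \<eta> l) \<bullet>c \<eta> k) = 0" by simp
qed

text \<open>Because g is an isometry, the four nonzero entries evaluate to plus or minus
  |\<eta>_s|^2, two with each sign.\<close>

lemma quad_gen_zero:
  assumes I: "finite I" "t \<in> I" "s \<in> I" "t \<noteq> s"
    and \<eta>: "\<And>k. k \<in> I \<Longrightarrow> \<eta> k \<in> carrier_vec n" and eq: "\<eta> t = g *\<^sub>v \<eta> s"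
    and g: "g \<in> carrier_mat n n" "mat_adjoint g * g = 1\<^sub>m n"
  shows "quad I \<eta> (gen_defect (mat_cstar n) (\<lambda>x. x) g t s) = 0"
proof -
  let ?a = "\<eta> s \<bullet>c \<eta> s"
  have s: "\<eta> s \<in> carrier_vec n" and t: "\<eta> t \<in> carrier_vec n" using \<eta> I by auto
  have gg: "mat_adjoint g *\<^sub>v \<eta> t = \<eta> s"
    unfolding eq using g s by (subst assoc_mult_mat_vec[symmetric, of _ n n _ n]) auto
  have tt: "\<eta> t \<bullet>c \<eta> t = ?a"
    using cscalar_mult_mat_vec[OF g(1) s t] by (simp add: gg flip: eq)
  have neg: "((- 1 \<cdot>\<^sub>m h) *\<^sub>v v) \<bullet>c w = - ((h *\<^sub>v v) \<bullet>c w)"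
    if "h \<in> carrier_mat n n" "v \<in> carrier_vec n" "w \<in> carrier_vec n" for h v and w :: "complex vec"
  proof -
    have "(- 1 \<cdot>\<^sub>m h) *\<^sub>v v = (- 1) \<cdot>\<^sub>v (h *\<^sub>v v)" using that by auto
    then show ?thesis using that by simp
  qed
  have zero: "(0\<^sub>m n n *\<^sub>v v) \<bullet>c w = 0" 
    if "v \<in> carrier_vec n" "w \<in> carrier_vec n" for v w :: "complex vec"
  proof -
    have "0\<^sub>m n n *\<^sub>v v = 0\<^sub>v n" using that by auto
    then show ?thesis using that by simp
  qed
  have "quad I \<eta> (gen_defect (mat_cstar n) (\<lambda>x. x) g t s)
      = (\<Sum>k\<in>I. \<Sum>l\<in>I. (if l = t then if k = t then ?a else 0 else 0)
          + (if l = s then if k = s then ?a else 0 else 0)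
          - (if l = s then if k = t then ?a else 0 else 0)
          - (if l = t then if k = s then ?a else 0 else 0))"
    unfolding quad_def
    using I(4) s t tt gg g \<eta> 
    by (intro sum.cong refl) (auto simp: gen_defect_def neg zero simp flip: eq)
  also have "\<dots> = 0"
    using I by (simp add: sum.distrib sum_subtractf)
  finally show ?thesis .
qed

lemma quad_pencil_zero:
  assumes I: "finite I" and \<xi>: "\<xi> \<in> carrier_vec n"
    and \<eta>: "\<And>k. k \<in> I \<Longrightarrow> \<eta> k \<in> carrier_vec n"
    and eq: "\<And>s. s \<in> subterms t \<Longrightarrow> \<eta> s = evT n s *\<^sub>v \<xi>"
  shows "well_formed n t \<Longrightarrow> subterms t \<subseteq> I \<Longrightarrow> quad I \<eta> (pencilT n t) = 0"
  using eq
proof (induction t)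
  case One
  have "0\<^sub>m n n *\<^sub>v v = 0\<^sub>v n" if "v \<in> carrier_vec n" for v :: "complex vec" using that by auto
  then show ?case using \<eta> by (simp add: quad_def)
next
  case (Gen g s)
  have g: "g \<in> toeplitz n" "mat_adjoint g * g = 1\<^sub>m n" and s: "well_formed n s" using Gen.prems by auto
  have gc: "g \<in> carrier_mat n n" using g by simp
  have "\<eta> (Gen g s) = g *\<^sub>v \<eta> s"
    using Gen.prems(3) gc \<xi> s by (simp add: assoc_mult_mat_vec[of _ n n _ n])
  moreover have "Gen g s \<noteq> s" using size_neq_size_imp_neq[of "Gen g s" s] by simp
  ultimately have "quad I \<eta> (gen_defect (mat_cstar n) (\<lambda>x. x) g (Gen g s) s) = 0"
    using Gen.prems by (intro quad_gen_zero[OF I _ _ _ \<eta>]) (auto simp: subset_iff)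
  moreover have "quad I \<eta> (pencilT n s) = 0"
    by (rule Gen.IH[OF s]) (use Gen.prems in auto)
  ultimately show ?case
    using gen_defectT_toeplitz[OF g(1)] pencilT_toeplitz[OF s] \<eta>
    by (simp add: quad_add[of _ n] quad_smult[of _ n])
next
  case (Lin c s s')
  have s: "well_formed n s" "well_formed n s'" using Lin.prems by auto
  have "\<eta> (Lin c s s') = c \<cdot>\<^sub>v \<eta> s + \<eta> s'"
  proof -
    have "(c \<cdot>\<^sub>m evT n s) *\<^sub>v \<xi> = c \<cdot>\<^sub>v (evT n s *\<^sub>v \<xi>)" using s \<xi> by (intro smult_mult_mat_vec[of _ n n]) auto
    then show ?thesis
      using Lin.prems(3) s \<xi> by (simp add: add_mult_distrib_mat_vec[of _ n n])
  qed
  then have "quad I \<eta> (\<lambda>k l. (cnj (lin_row c (Lin c s s') s s' k) * lin_row c (Lin c s s') s s' l) \<cdot>\<^sub>m 1\<^sub>m n) = 0"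
    using Lin.prems by (intro quad_lin_zero[OF I _ _ _ \<eta>]) (auto simp: subset_iff)
  moreover have "quad I \<eta> (pencilT n s) = 0"
    by (rule Lin.IH(1)[OF s(1)]) (use Lin.prems in auto)
  moreover have "quad I \<eta> (pencilT n s') = 0"
    by (rule Lin.IH(2)[OF s(2)]) (use Lin.prems in auto)
  ultimately show ?case
    using pencilT_toeplitz[OF s(1)] pencilT_toeplitz[OF s(2)] \<eta>
    by (simp add: quad_add[of _ n] quad_smult[of _ n])
qed

context toeplitz_injection
begin

lemma operator_norm_evT_le:
  assumes t: "well_formed n t"
  shows "operator_norm (evT n t) \<le> 2 * nrm A (ev A \<kappa> t)"
proof -
  let ?b = "ev A \<kappa> t" and ?x = "evT n t"
  have b: "?b \<in> carrier A" and x: "?x \<in> carrier_mat n n" using t by auto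
  have bound: "(vnorm (?x *\<^sub>v \<xi>))\<^sup>2 \<le> 2 * s * (vnorm \<xi>)\<^sup>2"
    if s: "(nrm A ?b)\<^sup>2 < s" and \<xi>: "\<xi> \<in> carrier_vec n" for s \<xi>
  proof -
    obtain y where y: "y \<in> carrier A" "complex_of_real s \<odot> \<one> = adj A ?b \<otimes> ?b \<oplus> adj A y \<otimes> y"
      using scaled_one_minus_square[OF b s] .
    \<comment> \<open>This is 2 Q + 2 s |v_1|^2. It dominates |v_t|^2 because v_t is its own
      deviation plus b v_1, where b is the value of \<open>t\<close> in \<open>A\<close>.\<close>
    let ?R = "2 \<boxdot> pencil A \<kappa> t \<boxplus> 2 \<boxdot> (s \<boxdot> sq (delta One))"
    have "delta t = (\<lambda>k. defect_row t k \<oplus> ?b \<otimes> delta One k)"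
    proof
      fix k
      have "defect_row t k \<oplus> ?b \<otimes> delta One k = ?b \<otimes> delta One k \<oplus> defect_row t k"
        using b t by (intro ring_facts(10)) (auto simp: ring_facts(5))
      then show "delta t k = defect_row t k \<oplus> ?b \<otimes> delta One k"
        using b by (simp add: defect_row_def add_diff_cancel ring_facts(5))
    qed
    then have "sq (delta t) \<preceq> 2 \<boxdot> sq (defect_row t) \<boxplus> 2 \<boxdot> sq (\<lambda>k. ?b \<otimes> delta One k)"
      using sq_add_le[of "defect_row t" "\<lambda>k. ?b \<otimes> delta One k"] b t by (simp add: ring_facts(5))
    also have "\<dots> \<preceq> ?R"
      by (intro sos_le_add sos_le_scale sq_defect_row_le_pencil[OF t] sq_mult_le[OF b y]) auto
    finally obtain S where S: "sos S" "form S" "?R = sq (delta t) \<boxplus> S"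
      by (rule sos_leE)
    \<comment> \<open>The Toeplitz version of \<open>?R\<close> minus |v_t|^2. Applying
      \<open>\<kappa>\<close> entrywise gives the remainder \<open>S\<close>, which is a sum of
      squares, so positivity can be pulled back to M_n.\<close>
    define XT where "XT k l = 2 \<cdot>\<^sub>m pencilT n t k l + ((2 * complex_of_real s * of_bool (k = One \<and> l = One)) \<cdot>\<^sub>m 1\<^sub>m n
        + (- of_bool (k = t \<and> l = t)) \<cdot>\<^sub>m 1\<^sub>m n)" for k l
    have XT: "XT k l \<in> toeplitz n" for k l
      unfolding XT_def by (intro toeplitz_add toeplitz_smult toeplitz_one pencilT_toeplitz[OF t])
    have \<kappa>XT: "\<kappa> (XT k l) = S k l" for k l
    proof -
      have d: "sq (delta u) k l = of_bool (k = u \<and> l = u) \<odot> \<one>" for u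
        by (simp add: sq_def delta_def adj_smult smult_mult_left smult_mult_right smult_smult ring_facts(5,6,12))
      have "\<kappa> (XT k l) = 2 \<odot> pencil A \<kappa> t k l \<oplus> (2 \<odot> (complex_of_real s \<odot> sq (delta One) k l) \<ominus> sq (delta t) k l)"
        unfolding XT_def using t
        by (simp add: kappa_add kappa_smult kappa_one kappa_pencil pencilT_toeplitz toeplitz_add
            toeplitz_smult toeplitz_one d smult_smult uminus_smult ring_facts(6,14))
      also have "\<dots> = ?R k l \<ominus> sq (delta t) k l"
        using sos_le_form(2)[OF sq_defect_row_le_pencil[OF t]]
        by (simp add: add_form_def scale_form_def d ring_facts)
      also have "\<dots> = S k l"
        unfolding S(3) using S(2) by (simp add: add_form_def d ring_facts)
      finally show ?thesis .
    qed
    obtain m where m: "\<And>p e. m \<le> p \<Longrightarrow> mat_positive A p (mat p p (\<lambda>(i, j). S (e i) (e j)))"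
      using sos_mat_positive[OF S(1)] by blast
    \<comment> \<open>Padding indices that bring the matrix size up to the number m of squares.
      Those that are not subterms of \<open>t\<close> will carry the zero vector.\<close>
    obtain B :: "isometry_term set" where B: "finite B" "card B = m"
      using infinite_arbitrarily_large[OF infinite_isometry_term] by blast
    define I where "I = subterms t \<union> B"
    have I: "finite I" "subterms t \<subseteq> I" and cI: "m \<le> card I"
      using B by (auto simp: I_def intro!: card_mono)
    obtain e where e: "bij_betw e {..<card I} I"
      using ex_bij_betw_nat_finite[OF I(1)] by (auto simp: atLeast0LessThan)
    define X where "X = mat (card I) (card I) (\<lambda>(i, j). XT (e i) (e j))"
    have "X \<in> matrices_over (card I) (toeplitz n)"
      unfolding X_def by (intro matrices_overI) (simp add: XT)
    moreover have "map_mat \<kappa> X = mat (card I) (card I) (\<lambda>(i, j). S (e i) (e j))"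
      by (rule eq_matI) (auto simp: X_def \<kappa>XT)
    ultimately have pos: "mat_positive (mat_cstar n) (card I) X"
      using kappa_positive m[OF cI] by simp
    define \<eta> where "\<eta> k = (if k \<in> subterms t then evT n k *\<^sub>v \<xi> else 0\<^sub>v n)" for k
    have wf_sub: "well_formed n u" if "u \<in> subterms t" for u
      using t that by (induction t) auto
    have \<eta>: "\<eta> k \<in> carrier_vec n" for k
      using mult_mat_vec_carrier[OF evT_carrier[OF wf_sub] \<xi>, of k] by (auto simp: \<eta>_def)
    have quad_diag: "quad I \<eta> (\<lambda>k l. (c * of_bool (k = u \<and> l = u)) \<cdot>\<^sub>m 1\<^sub>m n) = c * (\<eta> u \<bullet>c \<eta> u)"
      if "u \<in> I" for u c
    proof -
      have "quad I \<eta> (\<lambda>k l. (c * of_bool (k = u \<and> l = u)) \<cdot>\<^sub>m 1\<^sub>m n)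
          = (\<Sum>k\<in>I. \<Sum>l\<in>I. if l = u then if k = u then c * (\<eta> u \<bullet>c \<eta> u) else 0 else 0)"
      proof -
        have "((a \<cdot>\<^sub>m 1\<^sub>m n) *\<^sub>v \<eta> l) \<bullet>c \<eta> k = a * (\<eta> l \<bullet>c \<eta> k)" for a k l
          using \<eta>[of k] \<eta>[of l] by (simp add: smult_mult_mat_vec[OF one_carrier_mat])
        then show ?thesis
          unfolding quad_def by (intro sum.cong refl) simp
      qed
      then show ?thesis using I(1) that by simp
    qed
    have "0 \<le> Re (\<Sum>i<card I. \<Sum>j<card I. (X $$ (i, j) *\<^sub>v \<eta> (e j)) \<bullet>c \<eta> (e i))"
      by (rule mat_positive_quadratic_form[OF pos]) (rule \<eta>)
    also have "(\<Sum>i<card I. \<Sum>j<card I. (X $$ (i, j) *\<^sub>v \<eta> (e j)) \<bullet>c \<eta> (e i))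
        = (\<Sum>i<card I. \<Sum>j<card I. (XT (e i) (e j) *\<^sub>v \<eta> (e j)) \<bullet>c \<eta> (e i))"
      by (intro sum.cong refl) (simp add: X_def)
    also have "\<dots> = quad I \<eta> XT"
      unfolding quad_def
      by (simp add: sum.reindex_bij_betw[OF e, of "\<lambda>l. (XT (e _) l *\<^sub>v \<eta> l) \<bullet>c \<eta> (e _)"]
          sum.reindex_bij_betw[OF e, of "\<lambda>k. \<Sum>l\<in>I. (XT k l *\<^sub>v \<eta> l) \<bullet>c \<eta> k"])
    also have "quad I \<eta> XT = 2 * quad I \<eta> (pencilT n t)
        + (quad I \<eta> (\<lambda>k l. (2 * complex_of_real s * of_bool (k = One \<and> l = One)) \<cdot>\<^sub>m 1\<^sub>m n)
        + quad I \<eta> (\<lambda>k l. (- of_bool (k = t \<and> l = t)) \<cdot>\<^sub>m 1\<^sub>m n))"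
      unfolding XT_def using pencilT_toeplitz[OF t] \<eta>
      by (simp add: quad_add[of _ n] quad_smult[of _ n])
    also have "quad I \<eta> (pencilT n t) = 0"
      by (rule quad_pencil_zero[OF I(1) \<xi> \<eta> _ t I(2)]) (auto simp: \<eta>_def)
    also have "quad I \<eta> (\<lambda>k l. (2 * complex_of_real s * of_bool (k = One \<and> l = One)) \<cdot>\<^sub>m 1\<^sub>m n)
        = 2 * complex_of_real s * (\<eta> One \<bullet>c \<eta> One)"
      by (rule quad_diag) (use I in auto)
    also have "quad I \<eta> (\<lambda>k l. (- of_bool (k = t \<and> l = t)) \<cdot>\<^sub>m 1\<^sub>m n) = - (\<eta> t \<bullet>c \<eta> t)"
      using quad_diag[OF subsetD[OF I(2) self_in_subterms], of "-1"] by simp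
    finally have "0 \<le> Re (2 * complex_of_real s * (\<eta> One \<bullet>c \<eta> One) - \<eta> t \<bullet>c \<eta> t)"
      by simp
    moreover have "\<eta> One = \<xi>" "\<eta> t = ?x *\<^sub>v \<xi>" using \<xi> by (auto simp: \<eta>_def)
    ultimately show ?thesis by (simp flip: vnorm_square)
  qed
  show ?thesis
  proof (rule operator_norm_le[OF x])
    show nn: "0 \<le> 2 * nrm A ?b" using nrm_nonneg[OF b] by simp
    fix \<xi> :: "complex vec" assume \<xi>: "\<xi> \<in> carrier_vec n"
    \<comment> \<open>Let s decrease to ||b||^2. The constant obtained for the norm is sqrt 2, which
      the next step rounds up to 2.\<close>
    have "(vnorm (?x *\<^sub>v \<xi>))\<^sup>2 \<le> (nrm A ?b)\<^sup>2 * (2 * (vnorm \<xi>)\<^sup>2)"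
      by (rule le_mult_if_le_greater) (use bound[OF _ \<xi>] in \<open>simp_all add: ac_simps\<close>)
    also have "\<dots> \<le> (2 * nrm A ?b * vnorm \<xi>)\<^sup>2"
      by (simp add: power_mult_distrib mult_right_mono)
    finally show "vnorm (?x *\<^sub>v \<xi>) \<le> 2 * nrm A ?b * vnorm \<xi>"
      by (rule power2_le_imp_le) (use nn in simp)
  qed
qed

end

section \<open>Generation by Toeplitz matrices\<close>

definition toeplitz_mat :: "nat \<Rightarrow> (int \<Rightarrow> complex) \<Rightarrow> complex mat" where
  "toeplitz_mat n t = mat n n (\<lambda>(k, l). t (int k - int l))"

lemma toeplitz_mat_simps [simp]:
  "dim_row (toeplitz_mat n t) = n" "dim_col (toeplitz_mat n t) = n"
  "k < n \<Longrightarrow> l < n \<Longrightarrow> toeplitz_mat n t $$ (k, l) = t (int k - int l)"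
  by (auto simp: toeplitz_mat_def)

lemma toeplitz_mat_in [simp]: "toeplitz_mat n t \<in> toeplitz n"
  by (auto simp: toeplitz_def toeplitz_mat_def)

text \<open>For \<open>\<epsilon> = 1\<close> this is a power of the cyclic shift; in general it maps every unit vector to a
  unit vector or to \<open>\<epsilon>\<close> times one, permuting the indices cyclically.\<close>

lemma toeplitz_isometry:
  assumes j: "j < n" and \<epsilon>: "cmod \<epsilon> = 1"
  defines "g \<equiv> toeplitz_mat n (\<lambda>i. of_bool (i = int j) + \<epsilon> * of_bool (i = int j - int n))"
  shows "mat_adjoint g * g = 1\<^sub>m n"
proof (rule eq_matI)
  define \<sigma> where "\<sigma> l = (if l + j < n then l + j else l + j - n)" for l
  define s where "s l = (if l + j < n then 1 else \<epsilon>)" for l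
  have s1: "cnj (s k) * s k = 1" for k
    using \<epsilon> complex_norm_square[of \<epsilon>] by (simp add: s_def mult.commute)
  have gs: "g $$ (m, l) = (if m = \<sigma> l then s l else 0)" if "m < n" "l < n" for m l
    using that j by (auto simp: g_def \<sigma>_def s_def)
  have \<sigma>: "\<sigma> l < n" if "l < n" for l using that j by (auto simp: \<sigma>_def)
  have \<sigma>_inj: "\<sigma> k = \<sigma> l \<longleftrightarrow> k = l" if "k < n" "l < n" for k l
    using that j by (auto simp: \<sigma>_def split: if_splits)
  fix k l assume "k < dim_row (1\<^sub>m n :: complex mat)" "l < dim_col (1\<^sub>m n :: complex mat)"
  then have kl: "k < n" "l < n" by auto
  have "(mat_adjoint g * g) $$ (k, l) = (\<Sum>m<n. cnj (g $$ (m, k)) * g $$ (m, l))"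
    using kl by (simp add: g_def scalar_prod_def atLeast0LessThan)
  also have "\<dots> = (\<Sum>m<n. if m = \<sigma> k then (if \<sigma> k = \<sigma> l then cnj (s k) * s l else 0) else 0)"
    using kl by (intro sum.cong refl) (auto simp: gs)
  also have "\<dots> = (1\<^sub>m n) $$ (k, l)"
    using kl \<sigma>_inj[OF kl] \<sigma>[OF kl(1)] s1 by auto
  finally show "(mat_adjoint g * g) $$ (k, l) = (1\<^sub>m n) $$ (k, l)" .
qed (auto simp: g_def)

lemma toeplitz_isometry_induct:
  assumes n: "n > 0" and x: "x \<in> toeplitz n"
    and iso: "\<And>g. g \<in> toeplitz n \<Longrightarrow> mat_adjoint g * g = 1\<^sub>m n \<Longrightarrow> P g"
    and add: "\<And>x y. x \<in> toeplitz n \<Longrightarrow> y \<in> toeplitz n \<Longrightarrow> P x \<Longrightarrow> P y \<Longrightarrow> P (x + y)"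
    and smult: "\<And>c x. x \<in> toeplitz n \<Longrightarrow> P x \<Longrightarrow> P (c \<cdot>\<^sub>m x)"
  shows "P x"
proof -
  define e where "e i = toeplitz_mat n (\<lambda>k. of_bool (k = i))" for i
  have Pe: "P (e i)" if i: "i \<in> {- int n<..<int n}" for i
  proof -
    \<comment> \<open>The residue j in [0, n), for which i = j or i = j - n. Then T_i is half the
      sum or half the difference of the unitaries with \<epsilon> = 1 and \<epsilon> = -1.\<close>
    define j where "j = nat (i mod int n)"
    have j: "j < n" using n by (simp add: j_def nat_less_iff)
    define g where "g \<epsilon> = toeplitz_mat n (\<lambda>i. of_bool (i = int j) + \<epsilon> * of_bool (i = int j - int n))" for \<epsilon>
    have Pg: "P (g \<epsilon>)" if "cmod \<epsilon> = 1" for \<epsilon>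
      unfolding g_def using toeplitz_isometry[OF j that] by (intro iso) simp_all
    have gT: "g \<epsilon> \<in> toeplitz n" for \<epsilon> by (simp add: g_def)
    have "int j = i mod int n" using n by (simp add: j_def)
    moreover have "i mod int n = (if i < 0 then i + int n else i)"
      using i mod_pos_pos_trivial[of "i + int n" "int n"] by auto
    ultimately have "i = int j \<or> i = int j - int n" by (auto split: if_splits)
    then have "e i = (1/2) \<cdot>\<^sub>m g 1 + (if i = int j then 1/2 else - 1/2) \<cdot>\<^sub>m g (-1)"
      using j by (auto simp: e_def g_def intro!: eq_matI)
    then show ?thesis
      using add[OF toeplitz_smult toeplitz_smult] smult[OF gT] gT Pg[of 1] Pg[of "-1"] by simp
  qed
  obtain t where t: "x = toeplitz_mat n t"
    using x by (auto simp: toeplitz_def toeplitz_mat_def)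
  \<comment> \<open>Only the diagonals strictly between -n and n are visible in the matrix, so it is
    a finite combination of the \<open>e i\<close>.\<close>
  have "P (toeplitz_mat n (\<lambda>i. if i \<in> J then t i else 0))" if "finite J" "J \<subseteq> {- int n<..<int n}" for J
    using that
  proof (induction J rule: finite_induct)
    case empty
    have "toeplitz_mat n (\<lambda>i. if i \<in> {} then t i else 0) = 0 \<cdot>\<^sub>m 1\<^sub>m n"
      by (rule eq_matI) auto
    then show ?case using smult[OF toeplitz_one iso[OF toeplitz_one]] by simp
  next
    case (insert i J)
    have "toeplitz_mat n (\<lambda>k. if k \<in> insert i J then t k else 0)
        = t i \<cdot>\<^sub>m e i + toeplitz_mat n (\<lambda>k. if k \<in> J then t k else 0)"
      using insert by (intro eq_matI) (auto simp: e_def)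
    then show ?case
      using insert Pe[of i] by (auto intro!: add smult toeplitz_smult simp: e_def)
  qed
  from this[of "{- int n<..<int n}"] show ?thesis
    unfolding t by (rule back_subst[of P]) (auto intro!: eq_matI)
qed

lemma toeplitz_product_induct:
  assumes x: "x \<in> carrier_mat n n"
    and prod: "\<And>a b. a \<in> toeplitz n \<Longrightarrow> b \<in> toeplitz n \<Longrightarrow> P (a * b)"
    and add: "\<And>x y. x \<in> carrier_mat n n \<Longrightarrow> y \<in> carrier_mat n n \<Longrightarrow> P x \<Longrightarrow> P y \<Longrightarrow> P (x + y)"
    and smult: "\<And>c x. x \<in> carrier_mat n n \<Longrightarrow> P x \<Longrightarrow> P (c \<cdot>\<^sub>m x)"
  shows "P x"
proof -
  define S where "S k = toeplitz_mat n (\<lambda>i. of_bool (i = k))" for k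
  \<comment> \<open>The ones of this product start at (k, m) and run down that diagonal. Raising
    both k and m by 1 loses just the first of them, so the difference is a matrix unit. The bound j
    \<ge> m guards the natural subtraction j - m.\<close>
  have SS: "(S (int k) * S (- int m)) $$ (i, j) = of_bool (j \<ge> m \<and> i + m = j + k)"
    if ij: "i < n" "j < n" for i j k m
  proof -
    have "(S (int k) * S (- int m)) $$ (i, j) = (\<Sum>l<n. if l = j - m then of_bool (j \<ge> m \<and> i + m = j + k) else 0)"
    proof -
      have "(S (int k) * S (- int m)) $$ (i, j)
          = (\<Sum>l<n. of_bool (int i - int l = int k) * of_bool (int l - int j = - int m))"
        using ij by (simp add: S_def scalar_prod_def atLeast0LessThan)
      also have "\<dots> = (\<Sum>l<n. if l = j - m then of_bool (j \<ge> m \<and> i + m = j + k) else 0)"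
      proof (rule sum.cong[OF refl])
        fix l
        have "int i - int l = int k \<and> int l - int j = - int m \<longleftrightarrow> l = j - m \<and> j \<ge> m \<and> i + m = j + k"
          by auto
        then show "of_bool (int i - int l = int k) * of_bool (int l - int j = - int m)
          = (if l = j - m then of_bool (j \<ge> m \<and> i + m = j + k) else 0 :: complex)"
          by (simp flip: of_bool_conj)
      qed
      finally show ?thesis .
    qed
    also have "\<dots> = of_bool (j \<ge> m \<and> i + m = j + k)" using ij by auto
    finally show ?thesis .
  qed
  have ST: "S k \<in> toeplitz n" for k by (simp add: S_def)
  have SSc: "S k * S m \<in> carrier_mat n n" for k m
    by (rule mult_carrier_mat[OF toeplitz_carrier[OF ST] toeplitz_carrier[OF ST]])
  define e where "e k m = mat n n (\<lambda>(i, j). of_bool (i = k \<and> j = m) :: complex)" for k m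
  have Pe: "P (e k m)" for k m
  proof -
    have "e k m = S (int k) * S (- int m) + (-1) \<cdot>\<^sub>m (S (int (Suc k)) * S (- int (Suc m)))"
      (is "_ = ?a + (-1) \<cdot>\<^sub>m ?b")
    proof (rule eq_matI)
      fix i j assume "i < dim_row (?a + (-1) \<cdot>\<^sub>m ?b)" "j < dim_col (?a + (-1) \<cdot>\<^sub>m ?b)"
      then have ij: "i < n" "j < n" using SSc by (auto simp: S_def)
      have "(?a + (-1) \<cdot>\<^sub>m ?b) $$ (i, j) = ?a $$ (i, j) - ?b $$ (i, j)"
        using ij by (simp add: S_def)
      then show "e k m $$ (i, j) = (?a + (-1) \<cdot>\<^sub>m ?b) $$ (i, j)"
        unfolding SS[OF ij] using ij by (auto simp: e_def)
    qed (auto simp: e_def S_def)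
    then show ?thesis
      using add smult prod[OF ST ST] SSc smult_carrier_mat[OF SSc] by metis
  qed
  have "P (mat n n (\<lambda>p. if p \<in> J then x $$ p else 0))" (is "P (?x J)") if "finite J" for J
    using that
  proof (induction J rule: finite_induct)
    case empty
    have eq: "?x {} = 0 \<cdot>\<^sub>m e 0 0"
      by (rule eq_matI) (auto simp: e_def)
    have "P (0 \<cdot>\<^sub>m e 0 0)" by (rule smult[OF _ Pe]) (simp add: e_def)
    then show ?case by (simp only: eq)
  next
    case (insert p J)
    obtain k m where p: "p = (k, m)" by (cases p)
    have eq: "?x (insert p J) = x $$ p \<cdot>\<^sub>m e k m + ?x J"
      using insert unfolding p by (intro eq_matI) (auto simp: e_def)
    have "e k m \<in> carrier_mat n n" by (simp add: e_def)
    then have "P (x $$ p \<cdot>\<^sub>m e k m + ?x J)"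
      by (intro add smult Pe insert.IH) auto
    then show ?case by (simp only: eq)
  qed
  from this[of "{..<n} \<times> {..<n}"] show ?thesis
    by (rule back_subst[of P]) (use x in \<open>auto intro!: eq_matI\<close>)
qed

section \<open>Terms under products and adjoints\<close>

lemma one_smult_mat [simp]: "1 \<cdot>\<^sub>m (M :: complex mat) = M"
  by (rule eq_matI) auto

text \<open>Terms multiply by generators on the left only. A product is the computation that runs u
  first, so u replaces every \<open>One\<close> in the left factor.\<close>

primrec term_mult :: "isometry_term \<Rightarrow> isometry_term \<Rightarrow> isometry_term" where
  "term_mult One u = u"
| "term_mult (Gen g s) u = Gen g (term_mult s u)"
| "term_mult (Lin c s s') u = Lin c (term_mult s u) (term_mult s' u)"

lemma well_formed_term_mult: "well_formed n t \<Longrightarrow> well_formed n u \<Longrightarrow> well_formed n (term_mult t u)"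
  by (induction t) auto

lemma (in cstar_algebra) ev_term_mult:
  assumes \<kappa>: "\<And>x. x \<in> toeplitz n \<Longrightarrow> \<kappa> x \<in> carrier A" and u: "well_formed n u"
  shows "well_formed n t \<Longrightarrow> ev A \<kappa> (term_mult t u) = ev A \<kappa> t \<otimes> ev A \<kappa> u"
proof -
  have c: "ev A \<kappa> s \<in> carrier A" if "well_formed n s" for s
    using that by (induction s) (auto simp: ring_facts \<kappa>)
  show "well_formed n t \<Longrightarrow> ?thesis"
    by (induction t) (auto simp: c u \<kappa> smult_mult_left ring_facts)
qed

lemma evT_term_mult: "well_formed n t \<Longrightarrow> well_formed n u \<Longrightarrow> evT n (term_mult t u) = evT n t * evT n u"
  using cstar_algebra.ev_term_mult[OF cstar_algebra_mat_cstar[of n], of n "\<lambda>x. x" u t] by simp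

context toeplitz_injection
begin

text \<open>A single term represents x on both sides, which is what links \<open>\<kappa>\<close> to
  the identity in the construction of the homomorphism.\<close>

lemma toeplitz_term:
  assumes n: "n > 0" and x: "x \<in> toeplitz n"
  obtains t where "well_formed n t" "ev A \<kappa> t = \<kappa> x" "evT n t = x"
proof -
  have "\<exists>t. well_formed n t \<and> ev A \<kappa> t = \<kappa> x \<and> evT n t = x"
    using n x
  proof (rule toeplitz_isometry_induct)
    fix g assume "g \<in> toeplitz n" "mat_adjoint g * g = 1\<^sub>m n"
    then show "\<exists>t. well_formed n t \<and> ev A \<kappa> t = \<kappa> g \<and> evT n t = g"
      by (intro exI[of _ "Gen g One"]) (simp add: right_mult_one_mat[of _ n n])
  next
    fix x y assume x: "x \<in> toeplitz n" and y: "y \<in> toeplitz n"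
    assume "\<exists>t. well_formed n t \<and> ev A \<kappa> t = \<kappa> x \<and> evT n t = x" "\<exists>t. well_formed n t \<and> ev A \<kappa> t = \<kappa> y \<and> evT n t = y"
    then obtain t u where "well_formed n t" "ev A \<kappa> t = \<kappa> x" "evT n t = x" "well_formed n u" "ev A \<kappa> u = \<kappa> y" "evT n u = y"
      by blast
    then show "\<exists>t. well_formed n t \<and> ev A \<kappa> t = \<kappa> (x + y) \<and> evT n t = x + y"
      using x y by (intro exI[of _ "Lin 1 t u"]) (auto simp: kappa_add)
  next
    fix c x assume x: "x \<in> toeplitz n" and "\<exists>t. well_formed n t \<and> ev A \<kappa> t = \<kappa> x \<and> evT n t = x"
    then obtain t where t: "well_formed n t" "ev A \<kappa> t = \<kappa> x" "evT n t = x" by blast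
    \<comment> \<open>\<open>Lin\<close> always adds a second term; this splitting lets the term of
      x serve twice, so no term for zero is involved.\<close>
    have "c \<cdot>\<^sub>m x = (c - 1) \<cdot>\<^sub>m x + x" using toeplitz_carrier[OF x] by (intro eq_matI) (auto simp: algebra_simps)
    moreover from this have "\<kappa> (c \<cdot>\<^sub>m x) = (c - 1) \<odot> \<kappa> x \<oplus> \<kappa> x"
      using x by (simp add: kappa_add kappa_smult toeplitz_smult)
    ultimately show "\<exists>t. well_formed n t \<and> ev A \<kappa> t = \<kappa> (c \<cdot>\<^sub>m x) \<and> evT n t = c \<cdot>\<^sub>m x"
      using t by (intro exI[of _ "Lin (c - 1) t t"]) simp
  qed
  then show thesis using that by blast
qed

text \<open>The adjoint reverses products, so the adjoint of g has to be attached on the right, by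
  \<open>term_mult\<close>. It is Toeplitz and has a term by \<open>toeplitz_term\<close>.\<close>

lemma adjoint_term:
  assumes n: "n > 0"
  shows "well_formed n t \<Longrightarrow> \<exists>u. well_formed n u \<and> ev A \<kappa> u = adj A (ev A \<kappa> t) \<and> evT n u = mat_adjoint (evT n t)"
proof (induction t)
  case One
  then show ?case by (intro exI[of _ One]) simp
next
  case (Gen g s)
  then obtain u where u: "well_formed n u" "ev A \<kappa> u = adj A (ev A \<kappa> s)" "evT n u = mat_adjoint (evT n s)"
    by auto
  have g: "g \<in> toeplitz n" "mat_adjoint g * g = 1\<^sub>m n" and s: "well_formed n s" using Gen.prems by auto
  obtain v where v: "well_formed n v" "ev A \<kappa> v = \<kappa> (mat_adjoint g)" "evT n v = mat_adjoint g"
    using toeplitz_term[OF n toeplitz_adjoint[OF g(1)]] .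
  have "ev A \<kappa> (term_mult u v) = adj A (ev A \<kappa> (Gen g s))"
    using u v g s by (simp add: ev_term_mult[of n] isometry_image(1)[OF g] adj_mult)
  moreover have "evT n (term_mult u v) = mat_adjoint (evT n (Gen g s))"
    using u v g s by (simp add: evT_term_mult mat_adjoint_mult[of _ n n _ n])
  ultimately show ?case using well_formed_term_mult[OF u(1) v(1)] by blast
next
  case (Lin c s s')
  then obtain u u' where u: "well_formed n u" "ev A \<kappa> u = adj A (ev A \<kappa> s)" "evT n u = mat_adjoint (evT n s)"
    "well_formed n u'" "ev A \<kappa> u' = adj A (ev A \<kappa> s')" "evT n u' = mat_adjoint (evT n s')"
    by auto
  have "evT n s \<in> carrier_mat n n" "evT n s' \<in> carrier_mat n n" using Lin.prems by auto
  then have "mat_adjoint (c \<cdot>\<^sub>m evT n s + evT n s') = cnj c \<cdot>\<^sub>m mat_adjoint (evT n s) + mat_adjoint (evT n s')"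
    by (intro eq_matI) auto
  then show ?case
    using u Lin.prems by (intro exI[of _ "Lin (cnj c) u u'"]) (simp add: adj_add adj_smult)
qed

lemma matrix_term:
  assumes n: "n > 0" and x: "x \<in> carrier_mat n n"
  obtains t where "well_formed n t" "evT n t = x"
proof -
  have "\<exists>t. well_formed n t \<and> evT n t = x"
    using x
  proof (rule toeplitz_product_induct)
    fix a b assume a: "a \<in> toeplitz n" and b: "b \<in> toeplitz n"
    obtain t u where "well_formed n t" "evT n t = a" "well_formed n u" "evT n u = b"
      using toeplitz_term[OF n a] toeplitz_term[OF n b] by metis
    then show "\<exists>t. well_formed n t \<and> evT n t = a * b"
      using well_formed_term_mult evT_term_mult by metis
  next
    fix x y assume "\<exists>t. well_formed n t \<and> evT n t = x" "\<exists>t. well_formed n t \<and> evT n t = y"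
      and c: "x \<in> carrier_mat n n"
    then obtain t u where "well_formed n t" "evT n t = x" "well_formed n u" "evT n u = y" by blast
    moreover have "1 \<cdot>\<^sub>m x = x" using c by (intro eq_matI) auto
    ultimately show "\<exists>t. well_formed n t \<and> evT n t = x + y"
      by (intro exI[of _ "Lin 1 t u"]) simp
  next
    fix c x assume c: "x \<in> carrier_mat n n" and "\<exists>t. well_formed n t \<and> evT n t = x"
    then obtain t where "well_formed n t" "evT n t = x" by blast
    moreover have "c \<cdot>\<^sub>m x = (c - 1) \<cdot>\<^sub>m x + x" using c by (intro eq_matI) (auto simp: algebra_simps)
    ultimately show "\<exists>t. well_formed n t \<and> evT n t = c \<cdot>\<^sub>m x"
      by (intro exI[of _ "Lin (c - 1) t t"]) simp
  qed
  then show thesis using that by blast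
qed

end

section \<open>The quotient map onto the matrices\<close>

context cstar_algebra
begin

definition converges :: "(nat \<Rightarrow> 'a) \<Rightarrow> 'a \<Rightarrow> bool" where
  "converges f l \<longleftrightarrow> (\<forall>k. f k \<in> carrier A) \<and> l \<in> carrier A \<and> (\<lambda>k. nrm A (f k \<ominus> l)) \<longlonglongrightarrow> 0"

lemma convergesI:
  assumes "\<And>k. f k \<in> carrier A" "l \<in> carrier A" "\<And>k. nrm A (f k \<ominus> l) \<le> h k" "h \<longlonglongrightarrow> 0"
  shows "converges f l"
  unfolding converges_def
proof (intro conjI allI)
  show "(\<lambda>k. nrm A (f k \<ominus> l)) \<longlonglongrightarrow> 0"
    by (rule tendsto_sandwich[OF _ _ tendsto_const assms(4)])
       (use assms nrm_nonneg in \<open>auto simp: ring_facts\<close>)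
qed (use assms in auto)

lemma converges_const: "l \<in> carrier A \<Longrightarrow> converges (\<lambda>k. l) l"
  by (simp add: converges_def ring_facts)

lemma converges_closed: "converges f l \<Longrightarrow> f k \<in> carrier A" "converges f l \<Longrightarrow> l \<in> carrier A"
  by (auto simp: converges_def)

lemma converges_nrm_diff: "converges f l \<Longrightarrow> (\<lambda>k. nrm A (f k \<ominus> l)) \<longlonglongrightarrow> 0"
  by (auto simp: converges_def)

lemma nrm_le_diff_add: "x \<in> carrier A \<Longrightarrow> y \<in> carrier A \<Longrightarrow> nrm A x \<le> nrm A (x \<ominus> y) + nrm A y"
  using nrm_triangle[of "x \<ominus> y" y] by (simp add: ring_facts)

lemma converges_nrm:
  assumes "converges f l"
  shows "(\<lambda>k. nrm A (f k)) \<longlonglongrightarrow> nrm A l"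
proof -
  note c = converges_closed[OF assms]
  have "(\<lambda>k. nrm A (f k) - nrm A l) \<longlonglongrightarrow> 0"
  proof (rule Lim_null_comparison[OF _ converges_nrm_diff[OF assms]], rule always_eventually, rule allI)
    fix k
    show "norm (nrm A (f k) - nrm A l) \<le> nrm A (f k \<ominus> l)"
      using nrm_le_diff_add[OF c, of k] nrm_le_diff_add[OF c(2) c(1), of k] nrm_diff_commute[OF c, of k]
      by simp
  qed
  then show ?thesis by (simp add: LIM_zero_iff)
qed

lemma converges_add:
  assumes f: "converges f l" and g: "converges g m"
  shows "converges (\<lambda>k. f k \<oplus> g k) (l \<oplus> m)"
proof (rule convergesI)
  note c = converges_closed[OF f] converges_closed[OF g]
  show "(\<lambda>k. nrm A (f k \<ominus> l) + nrm A (g k \<ominus> m)) \<longlonglongrightarrow> 0"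
    using tendsto_add[OF converges_nrm_diff[OF f] converges_nrm_diff[OF g]] by simp
  fix k
  have "(f k \<oplus> g k) \<ominus> (l \<oplus> m) = (f k \<ominus> l) \<oplus> (g k \<ominus> m)" using c by (simp add: ring_facts)
  then show "nrm A ((f k \<oplus> g k) \<ominus> (l \<oplus> m)) \<le> nrm A (f k \<ominus> l) + nrm A (g k \<ominus> m)"
    using nrm_triangle[of "f k \<ominus> l" "g k \<ominus> m"] c by (simp add: ring_facts(4))
qed (use converges_closed[OF f] converges_closed[OF g] in \<open>auto simp: ring_facts\<close>)

lemma converges_smult:
  assumes f: "converges f l"
  shows "converges (\<lambda>k. c \<odot> f k) (c \<odot> l)"
proof (rule convergesI)
  note cl = converges_closed[OF f]
  show "(\<lambda>k. cmod c * nrm A (f k \<ominus> l)) \<longlonglongrightarrow> 0"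
    using tendsto_mult_left[OF converges_nrm_diff[OF f], of "cmod c"] by simp
  fix k
  have "c \<odot> f k \<ominus> c \<odot> l = c \<odot> (f k \<ominus> l)"
    using cl by (simp add: smult_add_right smult_uminus ring_facts)
  then show "nrm A (c \<odot> f k \<ominus> c \<odot> l) \<le> cmod c * nrm A (f k \<ominus> l)"
    using cl by (simp add: nrm_smult ring_facts(4))
qed (use converges_closed[OF f] in auto)

lemma converges_adj:
  assumes f: "converges f l"
  shows "converges (\<lambda>k. adj A (f k)) (adj A l)"
proof (rule convergesI[OF _ _ _ converges_nrm_diff[OF f]])
  note cl = converges_closed[OF f]
  fix k
  have "adj A (f k) \<ominus> adj A l = adj A (f k \<ominus> l)"
    using cl by (simp add: adj_add adj_uminus ring_facts)
  then show "nrm A (adj A (f k) \<ominus> adj A l) \<le> nrm A (f k \<ominus> l)"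
    using cl by (simp add: nrm_adj ring_facts(4))
qed (use converges_closed[OF f] in auto)

lemma converges_mult:
  assumes f: "converges f l" and g: "converges g m"
  shows "converges (\<lambda>k. f k \<otimes> g k) (l \<otimes> m)"
proof (rule convergesI)
  note c = converges_closed[OF f] converges_closed[OF g]
  have "(\<lambda>k. nrm A (f k) * nrm A (g k \<ominus> m) + nrm A (f k \<ominus> l) * nrm A m) \<longlonglongrightarrow> nrm A l * 0 + 0 * nrm A m"
    by (intro tendsto_intros converges_nrm[OF f] converges_nrm_diff[OF f] converges_nrm_diff[OF g])
  then show "(\<lambda>k. nrm A (f k) * nrm A (g k \<ominus> m) + nrm A (f k \<ominus> l) * nrm A m) \<longlonglongrightarrow> 0" by simp
  fix k
  have "f k \<otimes> (g k \<ominus> m) = f k \<otimes> g k \<ominus> f k \<otimes> m" "(f k \<ominus> l) \<otimes> m = f k \<otimes> m \<ominus> l \<otimes> m"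
    using c by (simp_all add: ring_facts)
  then have "f k \<otimes> g k \<ominus> l \<otimes> m = f k \<otimes> (g k \<ominus> m) \<oplus> (f k \<ominus> l) \<otimes> m"
    using c by (simp add: diff_add_diff ring_facts(5))
  then have "nrm A (f k \<otimes> g k \<ominus> l \<otimes> m) \<le> nrm A (f k \<otimes> (g k \<ominus> m)) + nrm A ((f k \<ominus> l) \<otimes> m)"
    using nrm_triangle[of "f k \<otimes> (g k \<ominus> m)" "(f k \<ominus> l) \<otimes> m"] c by (simp add: ring_facts(4,5))
  also have "\<dots> \<le> nrm A (f k) * nrm A (g k \<ominus> m) + nrm A (f k \<ominus> l) * nrm A m"
    using c by (intro add_mono nrm_mult) (auto simp: ring_facts)
  finally show "nrm A (f k \<otimes> g k \<ominus> l \<otimes> m)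
      \<le> nrm A (f k) * nrm A (g k \<ominus> m) + nrm A (f k \<ominus> l) * nrm A m" .
qed (use converges_closed[OF f] converges_closed[OF g] in \<open>auto simp: ring_facts\<close>)

end

lemma converges_mat_iff:
  "cstar_algebra.converges (mat_cstar n) f L \<longleftrightarrow>
     (\<forall>k. f k \<in> carrier_mat n n) \<and> L \<in> carrier_mat n n \<and> (\<lambda>k. operator_norm (f k - L)) \<longlonglongrightarrow> 0"
proof -
  interpret M: cstar_algebra "mat_cstar n" by (rule cstar_algebra_mat_cstar)
  show ?thesis by (auto simp: M.converges_def mat_cstar_minus)
qed

context toeplitz_injection
begin

interpretation M: cstar_algebra "mat_cstar n" by (rule cstar_algebra_mat_cstar)

text \<open>The closure of the set of pairs of values of a term in \<open>A\<close> and in M_n. The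
  homomorphism is constructed as this graph; one and the same sequence of terms has to converge on
  both sides.\<close>

definition approx :: "'a \<Rightarrow> complex mat \<Rightarrow> bool" where
  "approx b x \<longleftrightarrow> (\<exists>t. (\<forall>k. well_formed n (t k)) \<and> converges (\<lambda>k. ev A \<kappa> (t k)) b \<and> M.converges (\<lambda>k. evT n (t k)) x)"

lemma approx_closed: "approx b x \<Longrightarrow> b \<in> carrier A" "approx b x \<Longrightarrow> x \<in> carrier_mat n n"
  using converges_closed(2) M.converges_closed(2) by (auto simp: approx_def)

lemma approx_ev: "well_formed n t \<Longrightarrow> approx (ev A \<kappa> t) (evT n t)"
  unfolding approx_def by (intro exI[of _ "\<lambda>k. t"]) (simp add: converges_const M.converges_const)

lemma approx_bound:
  assumes "approx b x"
  shows "operator_norm x \<le> 2 * nrm A b"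
proof -
  obtain t where t: "\<And>k. well_formed n (t k)" "converges (\<lambda>k. ev A \<kappa> (t k)) b" "M.converges (\<lambda>k. evT n (t k)) x"
    using assms by (auto simp: approx_def)
  have "(\<lambda>k. operator_norm (evT n (t k))) \<longlonglongrightarrow> operator_norm x"
    using M.converges_nrm[OF t(3)] by simp
  moreover have "(\<lambda>k. 2 * nrm A (ev A \<kappa> (t k))) \<longlonglongrightarrow> 2 * nrm A b"
    by (intro tendsto_intros converges_nrm t)
  ultimately show ?thesis
    by (rule LIMSEQ_le) (use operator_norm_evT_le[OF t(1)] in auto)
qed

lemma approx_lin:
  assumes "approx b x" "approx b' x'"
  shows "approx (c \<odot> b \<oplus> b') (c \<cdot>\<^sub>m x + x')"
proof -
  obtain t t' where t: "\<And>k. well_formed n (t k)" "converges (\<lambda>k. ev A \<kappa> (t k)) b" "M.converges (\<lambda>k. evT n (t k)) x"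
    and t': "\<And>k. well_formed n (t' k)" "converges (\<lambda>k. ev A \<kappa> (t' k)) b'" "M.converges (\<lambda>k. evT n (t' k)) x'"
    using assms by (auto simp: approx_def)
  show ?thesis
    unfolding approx_def
    using converges_add[OF converges_smult[OF t(2)] t'(2)] M.converges_add[OF M.converges_smult[OF t(3)] t'(3)] t(1) t'(1)
    by (intro exI[of _ "\<lambda>k. Lin c (t k) (t' k)"]) simp
qed

lemma approx_zero: "approx \<zero> (0\<^sub>m n n)"
proof -
  have "(-1) \<cdot>\<^sub>m (1\<^sub>m n) + 1\<^sub>m n = (0\<^sub>m n n :: complex mat)" by (intro eq_matI) auto
  then show ?thesis using approx_ev[of "Lin (-1) One One"] by (simp add: uminus_smult ring_facts)
qed

lemma approx_mult:
  assumes "approx b x" "approx b' x'"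
  shows "approx (b \<otimes> b') (x * x')"
proof -
  obtain t t' where t: "\<And>k. well_formed n (t k)" "converges (\<lambda>k. ev A \<kappa> (t k)) b" "M.converges (\<lambda>k. evT n (t k)) x"
    and t': "\<And>k. well_formed n (t' k)" "converges (\<lambda>k. ev A \<kappa> (t' k)) b'" "M.converges (\<lambda>k. evT n (t' k)) x'"
    using assms by (auto simp: approx_def)
  show ?thesis
    unfolding approx_def
    using converges_mult[OF t(2) t'(2)] M.converges_mult[OF t(3) t'(3)] t(1) t'(1)
    by (intro exI[of _ "\<lambda>k. term_mult (t k) (t' k)"])
       (simp add: well_formed_term_mult evT_term_mult ev_term_mult[of n])
qed

lemma approx_adj:
  assumes n: "n > 0" and "approx b x"
  shows "approx (adj A b) (mat_adjoint x)"
proof -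
  obtain t where t: "\<And>k. well_formed n (t k)" "converges (\<lambda>k. ev A \<kappa> (t k)) b" "M.converges (\<lambda>k. evT n (t k)) x"
    using assms by (auto simp: approx_def)
  obtain u where u: "\<And>k. well_formed n (u k)" "\<And>k. ev A \<kappa> (u k) = adj A (ev A \<kappa> (t k))"
      "\<And>k. evT n (u k) = mat_adjoint (evT n (t k))"
    using adjoint_term[OF n t(1)] by metis
  show ?thesis
    unfolding approx_def
    using converges_adj[OF t(2)] M.converges_adj[OF t(3)] by (intro exI[of _ u]) (simp add: u)
qed

text \<open>By linearity two partners of b differ by a partner of zero, and
  \<open>approx_bound\<close> makes that zero.\<close>

lemma approx_unique:
  assumes "approx b x" "approx b x'"
  shows "x = x'"
proof -
  have x: "x \<in> carrier_mat n n" "x' \<in> carrier_mat n n" using assms approx_closed by auto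
  have "(-1) \<odot> b \<oplus> b = \<zero>" using approx_closed(1)[OF assms(1)] by (simp add: uminus_smult ring_facts)
  moreover have "(-1) \<cdot>\<^sub>m x' + x = x - x'" using x by (intro eq_matI) auto
  ultimately have "approx \<zero> (x - x')" using approx_lin[OF assms(2,1), of "-1"] by simp
  then have "operator_norm (x - x') = 0"
    using approx_bound[of "\<zero>" "x - x'"] operator_norm_nonneg[OF minus_carrier_mat[OF x(2), of x]]
    by simp
  then have "x - x' = 0\<^sub>m n n"
    using operator_norm_eq_0[OF minus_carrier_mat[OF x(2), of x]] by simp
  then have "(x - x') + x' = x'" using x by simp
  then show ?thesis using x by (auto simp: minus_add_uminus_mat[of x n n x'])
qed

text \<open>Differences of terms are again terms, so the norm estimate turns a sequence of terms
  converging in \<open>A\<close> into a Cauchy sequence of matrices. Completeness of M_n supplies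
  the partner.\<close>

lemma approx_exists:
  assumes l: "l \<in> carrier A" and lim: "\<And>e. e > 0 \<Longrightarrow> \<exists>t. well_formed n t \<and> nrm A (ev A \<kappa> t \<ominus> l) < e"
  shows "\<exists>x. approx l x"
proof -
  have "\<exists>t. well_formed n t \<and> nrm A (ev A \<kappa> t \<ominus> l) < inverse (real (Suc k))" for k
    by (rule lim) simp
  then obtain t where t: "\<And>k. well_formed n (t k)" "\<And>k. nrm A (ev A \<kappa> (t k) \<ominus> l) < inverse (real (Suc k))"
    by metis
  have converges: "converges (\<lambda>k. ev A \<kappa> (t k)) l"
    by (rule convergesI[OF _ l less_imp_le[OF t(2)] LIMSEQ_inverse_real_of_nat]) (simp add: t(1))
  have diff: "operator_norm (evT n (t k) - evT n (t j))
      \<le> 2 * (nrm A (ev A \<kappa> (t k) \<ominus> l) + nrm A (ev A \<kappa> (t j) \<ominus> l))" for j k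
  proof -
    have c: "ev A \<kappa> (t k) \<in> carrier A" "ev A \<kappa> (t j) \<in> carrier A" by (simp_all add: t(1))
    have "evT n (t k) \<in> carrier_mat n n" "evT n (t j) \<in> carrier_mat n n" by (simp_all add: t(1))
    then have "evT n (t k) - evT n (t j) = evT n (Lin (-1) (t j) (t k))"
      by (intro eq_matI) auto
    then have "operator_norm (evT n (t k) - evT n (t j)) \<le> 2 * nrm A (ev A \<kappa> (Lin (-1) (t j) (t k)))"
      using operator_norm_evT_le[of "Lin (-1) (t j) (t k)"] t(1) by simp
    also have "ev A \<kappa> (Lin (-1) (t j) (t k)) = (ev A \<kappa> (t k) \<ominus> l) \<oplus> (l \<ominus> ev A \<kappa> (t j))"
      using c l by (simp add: uminus_smult ring_facts)
    also have "nrm A \<dots> \<le> nrm A (ev A \<kappa> (t k) \<ominus> l) + nrm A (l \<ominus> ev A \<kappa> (t j))"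
      using c l by (intro nrm_triangle) (auto simp: ring_facts)
    finally show ?thesis using nrm_diff_commute[OF l c(2)] by simp
  qed
  have "\<exists>N. \<forall>k\<ge>N. \<forall>j\<ge>N. operator_norm (evT n (t k) - evT n (t j)) < e" if "e > 0" for e
  proof -
    have "e / 4 > 0" using that by simp
    then obtain N where N: "inverse (real (Suc N)) < e / 4" using reals_Archimedean by blast
    have small: "nrm A (ev A \<kappa> (t k) \<ominus> l) < e / 4" if "k \<ge> N" for k
    proof -
      have "inverse (real (Suc k)) \<le> inverse (real (Suc N))" using that by (simp add: field_simps)
      then show ?thesis using t(2)[of k] N by linarith
    qed
    have "operator_norm (evT n (t k) - evT n (t j)) < e" if "k \<ge> N" "j \<ge> N" for k j
    proof -
      have "nrm A (ev A \<kappa> (t k) \<ominus> l) + nrm A (ev A \<kappa> (t j) \<ominus> l) < e / 4 + e / 4"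
        by (intro add_strict_mono small that)
      then show ?thesis using diff[of k j] \<open>e > 0\<close> by (simp add: field_simps)
    qed
    then show ?thesis by blast
  qed
  note cauchy = this
  obtain x where "x \<in> carrier_mat n n" "(\<lambda>k. operator_norm (evT n (t k) - x)) \<longlonglongrightarrow> 0"
    by (rule operator_norm_convergent[OF _ cauchy]) (use t(1) in auto)
  then have "M.converges (\<lambda>k. evT n (t k)) x"
    using t(1) by (simp add: converges_mat_iff)
  then show ?thesis unfolding approx_def using t(1) converges by blast
qed

text \<open>The domain of the graph is a C*-subalgebra containing the generators, hence everything.
  The norm estimate enters through \<open>approx_exists\<close>, for closedness.\<close>

lemma approx_total:
  assumes n: "n > 0" and gen: "carrier A = cstar_generated A (\<kappa> ` toeplitz n)" and b: "b \<in> carrier A"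
  shows "\<exists>x. approx b x"
proof -
  let ?S = "{b. \<exists>x. approx b x}"
  have "cstar_subalgebra A ?S"
  proof (rule cstar_subalgebraI)
    show "?S \<subseteq> carrier A" using approx_closed by auto
    show one: "\<one> \<in> ?S" using approx_ev[of One] by auto
    show "x \<oplus> y \<in> ?S" if xy: "x \<in> ?S" "y \<in> ?S" for x y
    proof -
      obtain x' y' where "approx x x'" "approx y y'" using xy by blast
      from approx_lin[OF this, of 1] show ?thesis using approx_closed(1)[OF \<open>approx x x'\<close>] by auto
    qed
    show "x \<otimes> y \<in> ?S" if "x \<in> ?S" "y \<in> ?S" for x y using that approx_mult by blast
    show "c \<odot> x \<in> ?S" if x: "x \<in> ?S" for c x
    proof -
      obtain x' where "approx x x'" using x by auto
      from approx_lin[OF this approx_zero, of c] show ?thesis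
        using approx_closed(1)[OF \<open>approx x x'\<close>] by (auto simp: ring_facts)
    qed
    show "adj A x \<in> ?S" if "x \<in> ?S" for x using that approx_adj[OF n] by blast
    fix l assume l: "l \<in> carrier A" and lim: "\<And>e. e > 0 \<Longrightarrow> \<exists>x\<in>?S. nrm A (x \<ominus> l) < e"
    \<comment> \<open>A limit of elements of the domain is also a limit of values of terms: e / 2 is
      spent on an element b of the domain and e / 2 on a term close to b.\<close>
    have "\<exists>t. well_formed n t \<and> nrm A (ev A \<kappa> t \<ominus> l) < e" if e: "e > 0" for e
    proof -
      obtain b x where b: "approx b x" "nrm A (b \<ominus> l) < e / 2" using lim[OF half_gt_zero[OF e]] by blast
      then obtain t where t: "\<And>k. well_formed n (t k)" "converges (\<lambda>k. ev A \<kappa> (t k)) b" by (auto simp: approx_def)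
      have "\<forall>\<^sub>F k in sequentially. nrm A (ev A \<kappa> (t k) \<ominus> b) < e / 2"
        by (rule order_tendstoD(2)[OF converges_nrm_diff[OF t(2)]]) (use e in simp)
      then obtain k where k: "nrm A (ev A \<kappa> (t k) \<ominus> b) < e / 2"
        using eventually_happens[of _ sequentially] by auto
      have c: "ev A \<kappa> (t k) \<in> carrier A" "b \<in> carrier A" using t(1) approx_closed(1)[OF b(1)] by auto
      have "ev A \<kappa> (t k) \<ominus> l = (ev A \<kappa> (t k) \<ominus> b) \<oplus> (b \<ominus> l)"
        using c l by (simp add: ring_facts)
      then have "nrm A (ev A \<kappa> (t k) \<ominus> l) \<le> nrm A (ev A \<kappa> (t k) \<ominus> b) + nrm A (b \<ominus> l)"
        using nrm_triangle[of "ev A \<kappa> (t k) \<ominus> b" "b \<ominus> l"] c l by (simp add: ring_facts(4))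
      then have "nrm A (ev A \<kappa> (t k) \<ominus> l) < e" using k b(2) by simp
      then show ?thesis using t(1) by blast
    qed
    then show "l \<in> ?S" using approx_exists[OF l] by blast
  qed
  moreover have "\<kappa> ` toeplitz n \<subseteq> ?S"
  proof
    fix y assume "y \<in> \<kappa> ` toeplitz n"
    then obtain x where x: "x \<in> toeplitz n" "y = \<kappa> x" by auto
    obtain t where "well_formed n t" "ev A \<kappa> t = \<kappa> x" "evT n t = x" using toeplitz_term[OF n x(1)] .
    then show "y \<in> ?S" using approx_ev[of t] x by auto
  qed
  ultimately have "cstar_generated A (\<kappa> ` toeplitz n) \<subseteq> ?S"
    unfolding cstar_generated_def by (intro hull_minimal)
  then show ?thesis using gen b by auto
qed

lemma exists_star_hom:
  assumes n: "n > 0" and gen: "carrier A = cstar_generated A (\<kappa> ` toeplitz n)"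
  shows "\<exists>\<rho>. \<rho> \<in> extensional (carrier A) \<and> \<rho> \<in> star_hom A (mat_cstar n) \<and>
    \<rho> ` carrier A = carrier (mat_cstar n) \<and> (\<forall>x\<in>toeplitz n. \<rho> (\<kappa> x) = x)"
proof -
  define \<rho> where "\<rho> = restrict (\<lambda>b. THE x. approx b x) (carrier A)"
  have eq: "\<rho> b = x" if "approx b x" for b x
    unfolding \<rho>_def using that approx_closed(1)[OF that] approx_unique
    by (auto intro!: the_equality)
  have ap: "approx b (\<rho> b)" if "b \<in> carrier A" for b
    using approx_total[OF n gen that] eq by blast
  have c: "\<rho> b \<in> carrier_mat n n" if "b \<in> carrier A" for b using approx_closed(2)[OF ap[OF that]] .
  have "\<rho> \<in> star_hom A (mat_cstar n)"
    unfolding star_hom_def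
  proof (intro CollectI conjI ballI allI)
    show "\<rho> \<in> Ring.ring_hom A (mat_cstar n)"
    proof (rule ring_hom_memI)
      fix x y assume x: "x \<in> carrier A" and y: "y \<in> carrier A"
      show "\<rho> x \<in> carrier (mat_cstar n)" using c[OF x] by simp
      show "\<rho> (x \<otimes> y) = \<rho> x \<otimes>\<^bsub>mat_cstar n\<^esub> \<rho> y"
        using eq[OF approx_mult[OF ap[OF x] ap[OF y]]] by simp
      show "\<rho> (x \<oplus> y) = \<rho> x \<oplus>\<^bsub>mat_cstar n\<^esub> \<rho> y"
        using eq[OF approx_lin[OF ap[OF x] ap[OF y], of 1]] x by simp
    next
      show "\<rho> \<one> = \<one>\<^bsub>mat_cstar n\<^esub>" using eq[OF approx_ev[of One]] by simp
    qed
  next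
    fix x assume x: "x \<in> carrier A"
    show "\<rho> (adj A x) = adj (mat_cstar n) (\<rho> x)" using eq[OF approx_adj[OF n ap[OF x]]] by simp
    show "\<rho> (a \<odot> x) = a \<odot>\<^bsub>mat_cstar n\<^esub> \<rho> x" for a
      using eq[OF approx_lin[OF ap[OF x] approx_zero, of a]] x c[OF x] by (simp add: ring_facts)
  qed
  moreover have "\<rho> ` carrier A = carrier (mat_cstar n)"
  proof
    show "\<rho> ` carrier A \<subseteq> carrier (mat_cstar n)" using c by auto
    show "carrier (mat_cstar n) \<subseteq> \<rho> ` carrier A"
    proof
      fix x assume "x \<in> carrier (mat_cstar n)"
      then obtain t where t: "well_formed n t" "evT n t = x" using matrix_term[OF n, of x] by auto
      then show "x \<in> \<rho> ` carrier A" using eq[OF approx_ev[OF t(1)]] t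
        by (intro image_eqI[of _ _ "ev A \<kappa> t"]) auto
    qed
  qed
  moreover have "\<rho> (\<kappa> x) = x" if x: "x \<in> toeplitz n" for x
  proof -
    obtain t where "well_formed n t" "ev A \<kappa> t = \<kappa> x" "evT n t = x" using toeplitz_term[OF n x] .
    then show ?thesis using eq[OF approx_ev[of t]] by simp
  qed
  ultimately show ?thesis by (intro exI[of _ \<rho>]) (simp add: \<rho>_def)
qed

end

section \<open>Contractivity and uniqueness of homomorphisms into matrices\<close>

lemma star_homD:
  assumes "\<rho> \<in> star_hom A B"
  shows "x \<in> carrier A \<Longrightarrow> \<rho> x \<in> carrier B"
    "x \<in> carrier A \<Longrightarrow> y \<in> carrier A \<Longrightarrow> \<rho> (x \<otimes>\<^bsub>A\<^esub> y) = \<rho> x \<otimes>\<^bsub>B\<^esub> \<rho> y"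
    "x \<in> carrier A \<Longrightarrow> y \<in> carrier A \<Longrightarrow> \<rho> (x \<oplus>\<^bsub>A\<^esub> y) = \<rho> x \<oplus>\<^bsub>B\<^esub> \<rho> y"
    "\<rho> \<one>\<^bsub>A\<^esub> = \<one>\<^bsub>B\<^esub>"
    "x \<in> carrier A \<Longrightarrow> \<rho> (adj A x) = adj B (\<rho> x)"
    "x \<in> carrier A \<Longrightarrow> \<rho> (c \<odot>\<^bsub>A\<^esub> x) = c \<odot>\<^bsub>B\<^esub> \<rho> x"
  using assms unfolding star_hom_def
  by (auto simp: ring_hom_closed ring_hom_mult ring_hom_add ring_hom_one)

lemma star_hom_comp:
  assumes "\<rho> \<in> star_hom A B" "\<sigma> \<in> star_hom B C"
  shows "(\<lambda>x. \<sigma> (\<rho> x)) \<in> star_hom A C"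
  unfolding star_hom_def
  by (auto intro!: ring_hom_memI simp: star_homD[OF assms(1)] star_homD[OF assms(2)])

context cstar_algebra
begin

text \<open>Apply the homomorphism to s 1 = b^* b + y^* y and test on v: s |v|^2 = |\<rho>(b) v|^2 +
  |\<rho>(y) v|^2. This gives the constant 1 in place of the 2 from the construction.\<close>

lemma star_hom_contractive:
  assumes \<rho>: "\<rho> \<in> star_hom A (mat_cstar m)" and b: "b \<in> carrier A"
  shows "operator_norm (\<rho> b) \<le> nrm A b"
proof -
  note h = star_homD[OF \<rho>]
  have \<rho>b: "\<rho> b \<in> carrier_mat m m" using h(1)[OF b] by simp
  have bound: "(vnorm (\<rho> b *\<^sub>v v))\<^sup>2 \<le> s * (vnorm v)\<^sup>2"
    if s: "(nrm A b)\<^sup>2 < s" and v: "v \<in> carrier_vec m" for s v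
  proof -
    obtain y where y: "y \<in> carrier A" "complex_of_real s \<odot> \<one> = adj A b \<otimes> b \<oplus> adj A y \<otimes> y"
      using scaled_one_minus_square[OF b s] .
    have \<rho>y: "\<rho> y \<in> carrier_mat m m" using h(1)[OF y(1)] by simp
    have "complex_of_real s \<cdot>\<^sub>m 1\<^sub>m m = mat_adjoint (\<rho> b) * \<rho> b + mat_adjoint (\<rho> y) * \<rho> y"
      using arg_cong[OF y(2), of \<rho>] b y(1) by (simp add: h ring_facts(1-6))
    then have "((complex_of_real s \<cdot>\<^sub>m 1\<^sub>m m) *\<^sub>v v) \<bullet>c v
        = ((mat_adjoint (\<rho> b) * \<rho> b) *\<^sub>v v) \<bullet>c v + ((mat_adjoint (\<rho> y) * \<rho> y) *\<^sub>v v) \<bullet>c v"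
      using \<rho>b \<rho>y v by (simp add: cscalar_add_mult_mat_vec[of _ m] mult_carrier_mat[of _ m m _ m])
    moreover have "((mat_adjoint M * M) *\<^sub>v v) \<bullet>c v = complex_of_real ((vnorm (M *\<^sub>v v))\<^sup>2)"
      if M: "M \<in> carrier_mat m m" for M
    proof -
      have "(mat_adjoint M * M) *\<^sub>v v = mat_adjoint M *\<^sub>v (M *\<^sub>v v)"
        by (rule assoc_mult_mat_vec) (use M v in auto)
      then show ?thesis
        unfolding vnorm_square
        using cscalar_mult_mat_vec[of "mat_adjoint M" m m "M *\<^sub>v v" v] M v by simp
    qed
    moreover have "((complex_of_real s \<cdot>\<^sub>m 1\<^sub>m m) *\<^sub>v v) \<bullet>c v = complex_of_real (s * (vnorm v)\<^sup>2)"
      using v by (simp add: smult_mult_mat_vec[of _ m m] vnorm_square del: of_real_power)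
    ultimately have "complex_of_real (s * (vnorm v)\<^sup>2)
        = complex_of_real ((vnorm (\<rho> b *\<^sub>v v))\<^sup>2 + (vnorm (\<rho> y *\<^sub>v v))\<^sup>2)"
      using \<rho>b \<rho>y by (simp del: of_real_power)
    then have "s * (vnorm v)\<^sup>2 = (vnorm (\<rho> b *\<^sub>v v))\<^sup>2 + (vnorm (\<rho> y *\<^sub>v v))\<^sup>2"
      by (simp only: of_real_eq_iff)
    then show ?thesis by simp
  qed
  show ?thesis
  proof (rule operator_norm_le[OF \<rho>b nrm_nonneg[OF b]])
    fix v :: "complex vec" assume v: "v \<in> carrier_vec m"
    have "(vnorm (\<rho> b *\<^sub>v v))\<^sup>2 \<le> (nrm A b)\<^sup>2 * (vnorm v)\<^sup>2"
      by (rule le_mult_if_le_greater) (use bound[OF _ v] in simp_all)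
    then have "(vnorm (\<rho> b *\<^sub>v v))\<^sup>2 \<le> (nrm A b * vnorm v)\<^sup>2"
      by (simp add: power_mult_distrib)
    then show "vnorm (\<rho> b *\<^sub>v v) \<le> nrm A b * vnorm v"
      by (rule power2_le_imp_le) (use nrm_nonneg[OF b] in simp)
  qed
qed

lemma star_hom_minus:
  assumes \<rho>: "\<rho> \<in> star_hom A (mat_cstar m)" and "x \<in> carrier A" "y \<in> carrier A"
  shows "\<rho> (x \<ominus> y) = \<rho> x - \<rho> y"
proof -
  note h = star_homD[OF \<rho>]
  have "x \<ominus> y = x \<oplus> (-1) \<odot> y" using assms by (simp add: uminus_smult ring_facts(14))
  moreover have "\<rho> x \<in> carrier_mat m m" "\<rho> y \<in> carrier_mat m m" using h(1) assms by auto
  ultimately show ?thesis using assms by (auto simp: h intro!: eq_matI)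
qed

text \<open>The set where two homomorphisms agree is a C*-subalgebra, closed because both are
  contractive; it contains the generators.\<close>

lemma star_hom_unique:
  assumes \<rho>: "\<rho> \<in> star_hom A (mat_cstar m)" and \<sigma>: "\<sigma> \<in> star_hom A (mat_cstar m)"
    and eq: "\<And>x. x \<in> F \<Longrightarrow> \<rho> x = \<sigma> x" and gen: "carrier A = cstar_generated A F"
    and b: "b \<in> carrier A"
  shows "\<rho> b = \<sigma> b"
proof -
  note h = star_homD[OF \<rho>] and h' = star_homD[OF \<sigma>]
  let ?S = "{x \<in> carrier A. \<rho> x = \<sigma> x}"
  have F: "F \<subseteq> carrier A" using gen unfolding cstar_generated_def by (metis hull_subset)
  have "cstar_subalgebra A ?S"
  proof (rule cstar_subalgebraI)
    fix l assume l: "l \<in> carrier A" and lim: "\<And>e. e > 0 \<Longrightarrow> \<exists>x\<in>?S. nrm A (x \<ominus> l) < e"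
    have c: "\<rho> l \<in> carrier_mat m m" "\<sigma> l \<in> carrier_mat m m" using h(1)[OF l] h'(1)[OF l] by auto
    have "operator_norm (\<rho> l - \<sigma> l) \<le> 0 + e" if e: "e > 0" for e
    proof -
      obtain x where x: "x \<in> carrier A" "\<rho> x = \<sigma> x" "nrm A (x \<ominus> l) < e / 2"
        using lim[OF half_gt_zero[OF e]] by auto
      have cx: "\<rho> x \<in> carrier_mat m m" "\<sigma> x \<in> carrier_mat m m" using h(1)[OF x(1)] h'(1)[OF x(1)] by auto
      have "\<rho> l - \<sigma> l = (-1) \<cdot>\<^sub>m (\<rho> x - \<rho> l) + (\<sigma> x - \<sigma> l)"
        using c cx x(2) by (intro eq_matI) auto
      then have "operator_norm (\<rho> l - \<sigma> l) \<le> operator_norm ((-1) \<cdot>\<^sub>m (\<rho> x - \<rho> l)) + operator_norm (\<sigma> x - \<sigma> l)"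
        using c cx by (simp add: operator_norm_triangle[of _ m m] minus_carrier_mat)
      also have "operator_norm ((-1) \<cdot>\<^sub>m (\<rho> x - \<rho> l)) = operator_norm (\<rho> x - \<rho> l)"
        using operator_norm_smult[of "\<rho> x - \<rho> l" m m "-1"] c by (simp add: minus_carrier_mat)
      also have "operator_norm (\<rho> x - \<rho> l) \<le> nrm A (x \<ominus> l)"
        using star_hom_contractive[OF \<rho>, of "x \<ominus> l"] x l by (simp add: star_hom_minus[OF \<rho>] ring_facts(4))
      also have "operator_norm (\<sigma> x - \<sigma> l) \<le> nrm A (x \<ominus> l)"
        using star_hom_contractive[OF \<sigma>, of "x \<ominus> l"] x l by (simp add: star_hom_minus[OF \<sigma>] ring_facts(4))
      finally show ?thesis using x(3) by simp
    qed
    then have "operator_norm (\<rho> l - \<sigma> l) \<le> 0" by (rule field_le_epsilon)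
    then have "\<rho> l - \<sigma> l = 0\<^sub>m m m"
      using operator_norm_nonneg[of "\<rho> l - \<sigma> l" m m] operator_norm_eq_0[of "\<rho> l - \<sigma> l" m m] c
      by (simp add: minus_carrier_mat)
    then have "(\<rho> l - \<sigma> l) + \<sigma> l = \<sigma> l" using c by simp
    then have "\<rho> l = \<sigma> l" using c by (auto simp: minus_add_uminus_mat[of _ m m])
    then show "l \<in> ?S" using l by simp
  qed (auto simp: h h' ring_facts)
  then have "cstar_generated A F \<subseteq> ?S"
    unfolding cstar_generated_def using F eq by (intro hull_minimal) auto
  then show ?thesis using b gen by auto
qed

end

section \<open>Envelope and propagation number\<close>

lemma submodule_toeplitz: "Module.submodule (toeplitz n) (class_ring :: complex ring) (mat_cstar n)"
proof -
  interpret M: cstar_algebra "mat_cstar n" by (rule cstar_algebra_mat_cstar)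
  show ?thesis
  proof (rule Module.module.submoduleI[OF M.module_A])
    fix v assume v: "v \<in> toeplitz n"
    show "\<ominus>\<^bsub>mat_cstar n\<^esub> v \<in> toeplitz n"
      using M.uminus_smult[of v 1] v toeplitz_smult[OF v, of "-1"] by simp
  qed (auto simp: toeplitz_zero toeplitz_add toeplitz_smult)
qed

lemma operator_system_toeplitz: "operator_system (mat_cstar n) (toeplitz n)"
  unfolding operator_system_def
  by (simp add: cstar_algebra_mat_cstar submodule_toeplitz toeplitz_one toeplitz_adjoint)

lemma cstar_generated_toeplitz: "cstar_generated (mat_cstar n) (toeplitz n) = carrier_mat n n"
proof
  interpret M: cstar_algebra "mat_cstar n" by (rule cstar_algebra_mat_cstar)
  show "cstar_generated (mat_cstar n) (toeplitz n) \<subseteq> carrier_mat n n"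
    unfolding cstar_generated_def
    by (rule hull_minimal) (use M.cstar_subalgebra_carrier in auto)
  show "carrier_mat n n \<subseteq> cstar_generated (mat_cstar n) (toeplitz n)"
    unfolding cstar_generated_def hull_def
  proof (intro subsetI InterI, clarify)
    fix x :: "complex mat" and S
    assume x: "x \<in> carrier_mat n n" and S: "cstar_subalgebra (mat_cstar n) S" "toeplitz n \<subseteq> S"
    note D = M.cstar_subalgebraD[OF S(1), simplified]
    show "x \<in> S"
      by (rule toeplitz_product_induct[OF x]) (use S(2) in \<open>blast intro: D\<close>)+
  qed
qed

lemma cstar_extension_toeplitz: "cstar_extension (mat_cstar n) (toeplitz n) (mat_cstar n) (\<lambda>T. T)"
proof -
  have "map_mat (\<lambda>T. T) X = X" for X :: "complex mat mat"
    by (rule eq_matI) auto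
  then show ?thesis
    by (simp add: cstar_extension_def unital_complete_order_injection_def
        cstar_algebra_mat_cstar cstar_generated_toeplitz inj_on_def)
qed

lemma cstar_extension_exists_unique:
  fixes B :: "'b cstar"
  assumes n: "n > 0" and ext: "cstar_extension (mat_cstar n) (toeplitz n) B \<kappa>"
  shows "\<exists>!\<rho>. \<rho> \<in> extensional (carrier B) \<and> \<rho> \<in> star_hom B (mat_cstar n) \<and>
              \<rho> ` carrier B = carrier (mat_cstar n) \<and> (\<forall>x\<in>toeplitz n. \<rho> (\<kappa> x) = x)"
proof -
  interpret B: toeplitz_injection B n \<kappa>
    using ext by (auto simp: cstar_extension_def toeplitz_injection_def toeplitz_injection_axioms_def)
  have gen: "carrier B = cstar_generated B (\<kappa> ` toeplitz n)"
    using ext by (simp add: cstar_extension_def)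
  show ?thesis
  proof (rule ex_ex1I)
    show "\<exists>\<rho>. \<rho> \<in> extensional (carrier B) \<and> \<rho> \<in> star_hom B (mat_cstar n) \<and>
      \<rho> ` carrier B = carrier (mat_cstar n) \<and> (\<forall>x\<in>toeplitz n. \<rho> (\<kappa> x) = x)"
      by (rule B.exists_star_hom[OF n gen])
    fix \<rho> \<sigma>
    assume \<rho>: "\<rho> \<in> extensional (carrier B) \<and> \<rho> \<in> star_hom B (mat_cstar n) \<and>
      \<rho> ` carrier B = carrier (mat_cstar n) \<and> (\<forall>x\<in>toeplitz n. \<rho> (\<kappa> x) = x)"
      and \<sigma>: "\<sigma> \<in> extensional (carrier B) \<and> \<sigma> \<in> star_hom B (mat_cstar n) \<and>
      \<sigma> ` carrier B = carrier (mat_cstar n) \<and> (\<forall>x\<in>toeplitz n. \<sigma> (\<kappa> x) = x)"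
    show "\<rho> = \<sigma>"
    proof (rule extensionalityI[of _ "carrier B"])
      fix b assume b: "b \<in> carrier B"
      have "\<rho> x = \<sigma> x" if "x \<in> \<kappa> ` toeplitz n" for x
        using that \<rho> \<sigma> by (elim imageE) simp
      then show "\<rho> b = \<sigma> b"
        using B.star_hom_unique[OF _ _ _ gen b] \<rho> \<sigma> by blast
    qed (use \<rho> \<sigma> in blast)+
  qed
qed

lemma cstar_envelope_toeplitz:
  assumes "n > 0"
  shows "cstar_envelope TYPE('b) (mat_cstar n) (toeplitz n) (mat_cstar n) (\<lambda>T. T)"
  unfolding cstar_envelope_def
  using operator_system_toeplitz cstar_extension_toeplitz cstar_extension_exists_unique[OF assms]
  by blast

text \<open>Equations between entries survive limits, unlike a description by an unspecified
  function t. To recover t, the diagonal d is read off at (d, 0) or (0, -d), which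
  \<open>nat\<close> selects.\<close>

lemma toeplitz_iff_diagonals:
  "X \<in> toeplitz n \<longleftrightarrow> X \<in> carrier_mat n n \<and>
     (\<forall>k<n. \<forall>l<n. \<forall>k'<n. \<forall>l'<n. int k - int l = int k' - int l' \<longrightarrow> X $$ (k, l) = X $$ (k', l'))"
  (is "?L \<longleftrightarrow> ?R")
proof
  assume ?L
  then show ?R by (auto simp: toeplitz_iff)
next
  assume R: ?R
  have "X $$ (k, l) = X $$ (nat (int k - int l), nat (- (int k - int l)))" if "k < n" "l < n" for k l
  proof -
    have "nat (int k - int l) < n" "nat (- (int k - int l)) < n"
      "int k - int l = int (nat (int k - int l)) - int (nat (- (int k - int l)))" using that by auto
    then show ?thesis using R that by blast
  qed
  then show ?L
    unfolding toeplitz_iff using R by (intro conjI exI[of _ "\<lambda>d. X $$ (nat d, nat (- d))"]) blast+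
qed

text \<open>Two entries of X on the same diagonal are both within e / 2 of the common entry of an
  approximating T.\<close>

lemma toeplitz_closed:
  assumes X: "X \<in> carrier_mat n n" and lim: "\<And>e. e > 0 \<Longrightarrow> \<exists>T\<in>toeplitz n. operator_norm (T - X) < e"
  shows "X \<in> toeplitz n"
  unfolding toeplitz_iff_diagonals
proof (intro conjI X allI impI)
  fix k l k' l' assume k: "k < n" "l < n" "k' < n" "l' < n" and d: "int k - int l = int k' - int l'"
  have "cmod (X $$ (k, l) - X $$ (k', l')) \<le> 0 + e" if e: "e > 0" for e
  proof -
    obtain T where T: "T \<in> toeplitz n" "operator_norm (T - X) < e / 2"
      using lim[OF half_gt_zero[OF e]] by blast
    have Tc: "T \<in> carrier_mat n n" using T by simp
    have "T $$ (k, l) = T $$ (k', l')" using T(1) k d unfolding toeplitz_iff_diagonals by blast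
    moreover have near: "cmod (T $$ (i, j) - X $$ (i, j)) < e / 2" if "i < n" "j < n" for i j
      using cmod_entry_le[OF minus_carrier_mat[OF X, of T] that] that T(2) X Tc by simp
    ultimately have "cmod (T $$ (k, l) - X $$ (k, l)) < e / 2" "cmod (T $$ (k, l) - X $$ (k', l')) < e / 2"
      using near[OF k(1,2)] near[OF k(3,4)] by simp_all
    then have "cmod ((T $$ (k, l) - X $$ (k', l')) - (T $$ (k, l) - X $$ (k, l))) \<le> e"
      using norm_triangle_ineq4[of "T $$ (k, l) - X $$ (k', l')" "T $$ (k, l) - X $$ (k, l)"] by linarith
    then show ?thesis by simp
  qed
  then have "cmod (X $$ (k, l) - X $$ (k', l')) \<le> 0" by (rule field_le_epsilon)
  then show "X $$ (k, l) = X $$ (k', l')" by simp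
qed

section \<open>Arbitrary envelopes and their propagation number\<close>

text \<open>The inclusion into M_n is itself an extension, with elements of type
  \<open>complex mat\<close>, so the universal property of C yields \<open>\<rho>\<close>. The map
  \<open>\<sigma>\<close> comes from the construction applied to C as an extension. The composite
  fixes the Toeplitz matrices, hence all of M_n by uniqueness.\<close>

lemma cstar_envelope_toeplitz_isomorphism:
  assumes n: "n > 0" and env: "cstar_envelope TYPE(complex mat) (mat_cstar n) (toeplitz n) C \<iota>"
  obtains \<rho> \<sigma> where "\<rho> \<in> star_hom (mat_cstar n) C" "\<rho> ` carrier_mat n n = carrier C"
    "\<And>x. x \<in> toeplitz n \<Longrightarrow> \<rho> x = \<iota> x"
    "\<sigma> \<in> star_hom C (mat_cstar n)" "\<And>x. x \<in> carrier_mat n n \<Longrightarrow> \<sigma> (\<rho> x) = x"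
proof -
  interpret M: cstar_algebra "mat_cstar n" by (rule cstar_algebra_mat_cstar)
  obtain \<rho> where \<rho>: "\<rho> \<in> star_hom (mat_cstar n) C" "\<rho> ` carrier (mat_cstar n) = carrier C"
    "\<forall>x\<in>toeplitz n. \<rho> x = \<iota> x"
    using env cstar_extension_toeplitz[of n] unfolding cstar_envelope_def by blast
  have ext: "cstar_extension (mat_cstar n) (toeplitz n) C \<iota>"
    using env by (simp add: cstar_envelope_def)
  interpret C: toeplitz_injection C n \<iota>
    using ext by (auto simp: cstar_extension_def toeplitz_injection_def toeplitz_injection_axioms_def)
  have gen: "carrier C = cstar_generated C (\<iota> ` toeplitz n)"
    using ext by (simp add: cstar_extension_def)
  obtain \<sigma> where \<sigma>: "\<sigma> \<in> star_hom C (mat_cstar n)" "\<forall>x\<in>toeplitz n. \<sigma> (\<iota> x) = x"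
    using C.exists_star_hom[OF n gen] by blast
  have id: "(\<lambda>x. x) \<in> star_hom (mat_cstar n) (mat_cstar n)"
    unfolding star_hom_def by (auto intro!: ring_hom_memI)
  have "\<sigma> (\<rho> x) = x" if "x \<in> carrier_mat n n" for x
    by (rule M.star_hom_unique[OF star_hom_comp[OF \<rho>(1) \<sigma>(1)] id, of "toeplitz n"])
       (use \<rho>(3) \<sigma>(2) that cstar_generated_toeplitz in auto)
  then show thesis using that[OF \<rho>(1) _ _ \<sigma>(1)] \<rho> by simp
qed

lemma cstar_envelope_toeplitz_isomorphic:
  assumes n: "n > 0" and env: "cstar_envelope TYPE(complex mat) (mat_cstar n) (toeplitz n) C \<iota>"
  shows "cstar_isomorphic C (mat_cstar n)"
proof -
  obtain \<rho> \<sigma> where h: "\<rho> \<in> star_hom (mat_cstar n) C" "\<rho> ` carrier_mat n n = carrier C"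
    "\<sigma> \<in> star_hom C (mat_cstar n)" "\<And>x. x \<in> carrier_mat n n \<Longrightarrow> \<sigma> (\<rho> x) = x"
    using cstar_envelope_toeplitz_isomorphism[OF assms] by metis
  have "bij_betw \<sigma> (carrier C) (carrier_mat n n)"
  proof (rule bij_betw_byWitness[of _ \<rho>])
    show "\<forall>a\<in>carrier C. \<rho> (\<sigma> a) = a" unfolding h(2)[symmetric] using h(4) by simp
  qed (use h(2,4) star_homD(1)[OF h(3)] in auto)
  then show ?thesis using h(3) by (auto simp: cstar_isomorphic_def)
qed

text \<open>Powers in C are compared with M_n along \<open>\<rho>\<close> and
  \<open>\<sigma>\<close>. The bound n \<ge> 2 is essential: for n = 1 the Toeplitz matrices are
  already all of M_1, and the number is 1.\<close>

lemma propagation_number_toeplitz: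
  assumes n: "n \<ge> 2" and env: "cstar_envelope TYPE(complex mat) (mat_cstar n) (toeplitz n) C \<iota>"
  shows "propagation_number C (\<iota> ` toeplitz n) = 2"
proof -
  have n0: "n > 0" using n by simp
  interpret M: cstar_algebra "mat_cstar n" by (rule cstar_algebra_mat_cstar)
  have ext: "cstar_extension (mat_cstar n) (toeplitz n) C \<iota>"
    using env by (simp add: cstar_envelope_def)
  interpret C: toeplitz_injection C n \<iota>
    using ext by (auto simp: cstar_extension_def toeplitz_injection_def toeplitz_injection_axioms_def)
  obtain \<rho> \<sigma> where \<rho>: "\<rho> \<in> star_hom (mat_cstar n) C" "\<rho> ` carrier_mat n n = carrier C"
    "\<And>x. x \<in> toeplitz n \<Longrightarrow> \<rho> x = \<iota> x"
    and \<sigma>: "\<sigma> \<in> star_hom C (mat_cstar n)" "\<And>x. x \<in> carrier_mat n n \<Longrightarrow> \<sigma> (\<rho> x) = x"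
    using cstar_envelope_toeplitz_isomorphism[OF n0 env] by metis
  note \<rho>D = star_homD[OF \<rho>(1), unfolded mat_cstar_simps] and \<sigma>D = star_homD[OF \<sigma>(1), unfolded mat_cstar_simps]
  let ?F = "\<iota> ` toeplitz n"
  let ?W = "\<lambda>k. {foldr (\<otimes>\<^bsub>C\<^esub>) xs \<one>\<^bsub>C\<^esub> | xs. set xs \<subseteq> ?F \<and> xs \<noteq> [] \<and> length xs \<le> k}"
  let ?span = "LinearCombinations.module.span (class_ring :: complex ring) C"
  have F: "?F \<subseteq> carrier C" by auto
  have W: "?W k \<subseteq> carrier C" for k
  proof clarify
    fix xs assume "set xs \<subseteq> ?F"
    then have "set xs \<subseteq> carrier C" using F by blast
    then show "foldr (\<otimes>\<^bsub>C\<^esub>) xs \<one>\<^bsub>C\<^esub> \<in> carrier C"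
      by (induction xs) (auto simp: C.ring_facts)
  qed
  note span_carrier = LinearCombinations.module.span_is_subset2[OF C.module_A W]
  have not1: "\<not> cstar_subalgebra C (system_power C ?F 1)"
  proof
    assume sub: "cstar_subalgebra C (system_power C ?F 1)"
    have W1: "?W 1 = ?F"
    proof
      show "?W 1 \<subseteq> ?F"
      proof clarify
        fix xs assume xs: "set xs \<subseteq> ?F" "xs \<noteq> []" "length xs \<le> 1"
        then obtain x where "xs = [x]" by (cases xs) auto
        then show "foldr (\<otimes>\<^bsub>C\<^esub>) xs \<one>\<^bsub>C\<^esub> \<in> ?F" using xs F by auto
      qed
      show "?F \<subseteq> ?W 1"
      proof
        fix x assume "x \<in> ?F"
        then show "x \<in> ?W 1" using F by (intro CollectI exI[of _ "[x]"]) auto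
      qed
    qed
    have "LinearCombinations.submodule (class_ring :: complex ring) ?F C"
    proof (rule submodule.intro[OF C.module_A F])
      show "\<zero>\<^bsub>C\<^esub> \<in> ?F" unfolding C.kappa_zero[symmetric] using toeplitz_zero by (rule imageI)
      fix v w assume "v \<in> ?F" "w \<in> ?F"
      then obtain x y where "x \<in> toeplitz n" "y \<in> toeplitz n" "v = \<iota> x" "w = \<iota> y" by blast
      then show "v \<oplus>\<^bsub>C\<^esub> w \<in> ?F"
        by (intro image_eqI[of _ _ "x + y"]) (simp_all add: C.kappa_add toeplitz_add)
    next
      fix c :: complex and v assume "v \<in> ?F"
      then obtain x where "x \<in> toeplitz n" "v = \<iota> x" by blast
      then show "c \<odot>\<^bsub>C\<^esub> v \<in> ?F"
        by (intro image_eqI[of _ _ "c \<cdot>\<^sub>m x"]) (simp_all add: C.kappa_smult toeplitz_smult)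
    qed
    then have "?span ?F \<subseteq> ?F"
      by (intro LinearCombinations.module.span_is_subset[OF C.module_A]) auto
    moreover have "?F \<subseteq> ?span ?F"
      by (rule LinearCombinations.module.in_own_span[OF C.module_A F])
    ultimately have P: "system_power C ?F 1 = norm_closure C ?F"
      unfolding system_power_def W1 by (simp add: subset_antisym)
    \<comment> \<open>For the shift, S S^* = diag(0, 1, ..., 1), which is not constant along the
      main diagonal once n \<ge> 2.\<close>
    define S where "S = toeplitz_mat n (\<lambda>i. of_bool (i = 1))"
    have S: "S \<in> toeplitz n" by (simp add: S_def)
    have \<iota>S: "\<iota> S \<in> carrier C" using S by simp
    have "\<iota> S \<in> norm_closure C ?F"
      unfolding C.norm_closure_eq[OF F]
    proof (intro CollectI conjI allI impI \<iota>S bexI)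
      show "nrm C (\<iota> S \<ominus>\<^bsub>C\<^esub> \<iota> S) < e" if "e > 0" for e :: real
        using that \<iota>S by (simp add: C.ring_facts(14,16))
      show "\<iota> S \<in> ?F" using S by (rule imageI)
    qed
    then have "\<iota> S \<otimes>\<^bsub>C\<^esub> adj C (\<iota> S) \<in> norm_closure C ?F"
      using C.cstar_subalgebraD(4,6)[OF sub] P by metis
    then have lim: "\<exists>y\<in>?F. nrm C (y \<ominus>\<^bsub>C\<^esub> \<iota> S \<otimes>\<^bsub>C\<^esub> adj C (\<iota> S)) < e" if "e > 0" for e
      using that unfolding C.norm_closure_eq[OF F] by blast
    have \<sigma>\<iota>: "\<sigma> (\<iota> x) = x" if "x \<in> toeplitz n" for x
      using \<rho>(3)[OF that] \<sigma>(2)[of x] that by simp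
    have SS: "\<sigma> (\<iota> S \<otimes>\<^bsub>C\<^esub> adj C (\<iota> S)) = S * mat_adjoint S"
      using \<iota>S S by (simp add: \<sigma>D \<sigma>\<iota>)
    have SSc: "S * mat_adjoint S \<in> carrier_mat n n"
      using S by (simp add: mult_carrier_mat[of _ n n _ n])
    \<comment> \<open>\<open>\<sigma>\<close> is contractive and undoes \<open>\<iota>\<close> on
      Toeplitz matrices, so approximants of the product in C become Toeplitz approximants of S S^*
      in M_n.\<close>
    have "S * mat_adjoint S \<in> toeplitz n"
    proof (rule toeplitz_closed[OF SSc])
      fix e :: real assume "e > 0"
      from lim[OF this] obtain T where T: "T \<in> toeplitz n"
        "nrm C (\<iota> T \<ominus>\<^bsub>C\<^esub> \<iota> S \<otimes>\<^bsub>C\<^esub> adj C (\<iota> S)) < e" by auto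
      have c: "\<iota> T \<in> carrier C" "\<iota> S \<otimes>\<^bsub>C\<^esub> adj C (\<iota> S) \<in> carrier C"
        using T(1) \<iota>S by (auto simp: C.ring_facts)
      have "operator_norm (\<sigma> (\<iota> T \<ominus>\<^bsub>C\<^esub> \<iota> S \<otimes>\<^bsub>C\<^esub> adj C (\<iota> S))) < e"
        using C.star_hom_contractive[OF \<sigma>(1) C.ring_facts(4)[OF c]] T(2) by linarith
      then have "operator_norm (T - S * mat_adjoint S) < e"
        by (simp only: C.star_hom_minus[OF \<sigma>(1) c] SS \<sigma>\<iota>[OF T(1)])
      then show "\<exists>T\<in>toeplitz n. operator_norm (T - S * mat_adjoint S) < e" using T(1) by blast
    qed
    then have "(S * mat_adjoint S) $$ (0, 0) = (S * mat_adjoint S) $$ (1, 1)"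
      using n unfolding toeplitz_iff_diagonals by auto
    moreover have "(S * mat_adjoint S) $$ (0, 0) = 0"
      using n by (simp add: S_def scalar_prod_def)
    moreover have "(S * mat_adjoint S) $$ (1, 1) = (\<Sum>l<n. if l = 0 then 1 else 0)"
      using n by (auto simp: S_def scalar_prod_def atLeast0LessThan intro!: sum.cong)
    ultimately show False using n by simp
  qed
  have two: "system_power C ?F 2 = carrier C"
  proof -
    have sm: "LinearCombinations.submodule (class_ring :: complex ring) (?span (?W 2)) C"
      by (rule LinearCombinations.module.span_is_submodule[OF C.module_A W])
    \<comment> \<open>Products of two Toeplitz matrices span M_n, and \<open>\<rho>\<close> sends
      such a product to a word of length two in the image of \<open>\<iota>\<close>.\<close>
    have in_span: "\<rho> x \<in> ?span (?W 2)" if "x \<in> carrier_mat n n" for x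
      using that
    proof (rule toeplitz_product_induct)
      fix a b assume a: "a \<in> toeplitz n" and b: "b \<in> toeplitz n"
      have "\<rho> (a * b) = foldr (\<otimes>\<^bsub>C\<^esub>) [\<iota> a, \<iota> b] \<one>\<^bsub>C\<^esub>"
        using a b by (simp add: \<rho>D \<rho>(3))
      moreover have "set [\<iota> a, \<iota> b] \<subseteq> ?F" using a b by auto
      ultimately have "\<rho> (a * b) \<in> ?W 2" by (intro CollectI exI[of _ "[\<iota> a, \<iota> b]"]) simp
      then show "\<rho> (a * b) \<in> ?span (?W 2)"
        using LinearCombinations.module.in_own_span[OF C.module_A W[of 2]] by blast
    next
      fix x y :: "complex mat" assume "x \<in> carrier_mat n n" "y \<in> carrier_mat n n"
        "\<rho> x \<in> ?span (?W 2)" "\<rho> y \<in> ?span (?W 2)"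
      then show "\<rho> (x + y) \<in> ?span (?W 2)"
        using submodule.m_closed[OF sm] by (simp add: \<rho>D)
    next
      fix c and x :: "complex mat" assume "x \<in> carrier_mat n n" "\<rho> x \<in> ?span (?W 2)"
      then show "\<rho> (c \<cdot>\<^sub>m x) \<in> ?span (?W 2)"
        using submodule.smult_closed[OF sm, of c] by (simp add: \<rho>D)
    qed
    have "?span (?W 2) = carrier C"
    proof
      show "carrier C \<subseteq> ?span (?W 2)"
        unfolding \<rho>(2)[symmetric] using in_span by (intro image_subsetI)
    qed (rule span_carrier)
    then show ?thesis
    proof -
      have "\<exists>y\<in>carrier C. nrm C (y \<ominus>\<^bsub>C\<^esub> x) < e" if "x \<in> carrier C" "e > 0" for x e
        using that by (intro bexI[of _ x]) (simp_all add: C.ring_facts(14,16))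
      then show ?thesis
        unfolding system_power_def \<open>?span (?W 2) = carrier C\<close> C.norm_closure_eq[OF subset_refl] by blast
    qed
  qed
  have "enat 2 \<in> {enat k | k. 0 < k \<and> cstar_subalgebra C (system_power C ?F k)}"
    using two C.cstar_subalgebra_carrier by auto
  moreover have "enat 2 \<le> m" if m: "m \<in> {enat k | k. 0 < k \<and> cstar_subalgebra C (system_power C ?F k)}" for m
  proof -
    obtain k where k: "m = enat k" "0 < k" "cstar_subalgebra C (system_power C ?F k)" using m by blast
    then have "k \<noteq> 1" using not1 by auto
    then show ?thesis using k by simp
  qed
  ultimately have "propagation_number C ?F = enat 2"
    unfolding propagation_number_def by (intro antisym Inf_lower Inf_greatest)
  then show ?thesis unfolding numeral_eq_enat[symmetric] .
qed

theorem proposition4p2: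
  fixes n :: nat
  assumes "n > 0"
  shows "cstar_envelope TYPE('b) (mat_cstar n) (toeplitz n) (mat_cstar n) (\<lambda>T. T) \<and>
    (\<forall>(C :: 'c cstar) \<iota>.
       cstar_envelope TYPE(complex mat) (mat_cstar n) (toeplitz n) C \<iota> \<longrightarrow>
         cstar_isomorphic C (mat_cstar n) \<and>
         (n \<ge> 2 \<longrightarrow> propagation_number C (\<iota> ` toeplitz n) = 2))"
  using cstar_envelope_toeplitz[OF assms] cstar_envelope_toeplitz_isomorphic[OF assms]
    propagation_number_toeplitz by blast

end
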